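(* Let $T\in\mathcal{KC}(V)$ be such that $T$ and $\overline{T}$ are operators of type $\omega\in(0,\pi)$, and let $\theta\in(\omega,\pi)$. Then for every $f\in\Psi_L^Q(S_\theta)$ (resp. $f\in\Psi_R^Q(S_\theta)$), every $\varphi\in(\omega,\theta)$ and every $J\in\mathbb{S}$, the integral $$Df(T):=\frac{-1}{\pi}\int_{\partial(S_\varphi\cap\mathbb{C}_J)}Q_{c,s}^{-1}(T)\,ds_J\,f(s)\qquad\Big(\text{resp. }(fD)(T):=\frac{-1}{\pi}\int_{\partial(S_\varphi\cap\mathbb{C}_J)}f(s)\,ds_J\,Q_{c,s}^{-1}(T)\Big)$$ is absolutely convergent, and its value depends neither on the angle $\varphi\in(\omega,\theta)$ nor on the imaginary unit $J\in\mathbb{S}$. Moreover, if $f,g\in\Psi_L^Q(S_\theta)$ satisfy $Df=Dg$ on $S_\theta$ (resp. $f,g\in\Psi_R^Q(S_\theta)$ satisfy $fD=gD$ on $S_\theta$), then $Df(T)=Dg(T)$ (resp. $(fD)(T)=(gD)(T)$).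
   Context: $\mathbb{H}$ denotes the quaternions $s=s_0+s_1e_1+s_2e_2+s_3e_3$ ($s_i\in\mathbb{R}$) with $e_1^2=e_2^2=e_3^2=-1$, $e_1e_2=-e_2e_1=e_3$, $e_2e_3=-e_3e_2=e_1$, $e_3e_1=-e_1e_3=e_2$; $\overline{s}=s_0-s_1e_1-s_2e_2-s_3e_3$, $|s|=(s_0^2+s_1^2+s_2^2+s_3^2)^{1/2}$, $\mathbb{S}=\{s\in\mathbb{H}: s_0=0,\ |s|=1\}$, and $\mathbb{C}_J=\{u+Jv:u,v\in\mathbb{R}\}$ for $J\in\mathbb{S}$. For $\omega\in(0,\pi)$ the open sector is $S_\omega=\{re^{J\phi}: r>0,\ J\in\mathbb{S},\ |\phi|<\omega\}$, $\overline{S_\omega}$ its closure and $S_\omega^c=\mathbb{H}\setminus S_\omega$. $V$ is a two-sided Banach space over $\mathbb{H}$, $\mathcal{I}$ the identity. $\mathcal{KC}(V)$ is the class of closed right-linear operators $T$ on $V$ with two-sided linear domain $\operatorname{dom}(T)$ such that $T=T_0+e_1T_1+e_2T_2+e_3T_3$ with two-sided linear operators $T_i$, $\operatorname{dom}(T_i)=\operatorname{dom}(T)$, $\operatorname{dom}(T^2)\subseteq\operatorname{dom}(T_iT_j)$ and $T_iT_j=T_jT_i$ on $\operatorname{dom}(T^2)$ for all $i,j\in\{0,1,2,3\}$. For such $T$, $\overline{T}:=T_0-e_1T_1-e_2T_2-e_3T_3$ (also in $\mathcal{KC}(V)$), $|T|^2:=T_0^2+T_1^2+T_2^2+T_3^2$,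 and for $s\in\mathbb{H}$, $Q_{c,s}(T):=s^2\mathcal{I}-2sT_0+|T|^2$ with domain $\operatorname{dom}(T^2)$. The $S$-resolvent set $\rho_S(T)$ is the set of $s\in\mathbb{H}$ for which $Q_{c,s}(T):\operatorname{dom}(T^2)\to V$ is bijective; $Q_{c,s}^{-1}(T)$ is its inverse, and $\sigma_S(T)=\mathbb{H}\setminus\rho_S(T)$ is the $S$-spectrum. For $s\in\rho_S(T)$, $S_L^{-1}(s,T):=(s\mathcal{I}-\overline{T})Q_{c,s}^{-1}(T)$ and $S_R^{-1}(s,T):=sQ_{c,s}^{-1}(T)-\sum_{i=0}^3T_iQ_{c,s}^{-1}(T)\overline{e_i}$ (with $e_0=1$). $T\in\mathcal{KC}(V)$ is of type $\omega\in(0,\pi)$ if $\sigma_S(T)\subseteq\overline{S_\omega}$ and for every $\theta\in(\omega,\pi)$ there is $C_\theta\geq0$ with $\|S_L^{-1}(s,T)\|\leq C_\theta/|s|$ and $\|S_R^{-1}(s,T)\|\leq C_\theta/|s|$ for all $s\in S_\theta^c\setminus\{0\}$. Slice hyperholomorphic functions: for an open axially symmetric $U\subseteq\mathbb{H}$ (i.e. $s_0+J|s-s_0|\in U$ for all $J\in\mathbb{S}$ whenever $s\in U$), $f:U\to\mathbb{H}$ is left (resp. right) slice hyperholomorphic if there are continuously differentiable $\alpha,\beta:\{(u,v)\in\mathbb{R}^2:u+\mathbb{S}v\subseteq U\}\to\mathbb{H}$ with $f(u+Jv)=\alpha(u,v)+J\beta(u,v)$ (resp. $=\alpha(u,v)+\beta(u,v)J$)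 for all such $(u,v)$ and all $J\in\mathbb{S}$, $\alpha(u,-v)=\alpha(u,v)$, $\beta(u,-v)=-\beta(u,v)$, $\partial_u\alpha=\partial_v\beta$ and $\partial_v\alpha=-\partial_u\beta$. $\Psi_L^Q(S_\theta)$ (resp. $\Psi_R^Q(S_\theta)$) is the set of left (resp. right) slice hyperholomorphic $f$ on $S_\theta$ for which there exist $\alpha>0$, $C_\alpha\geq0$ with $|f(s)|\leq C_\alpha|s|^{1+\alpha}/(1+|s|^{1+2\alpha})$ for all $s\in S_\theta$. Path integrals: for $J\in\mathbb{S}$ and $\varphi\in(0,\pi)$ let $\gamma(t)=-te^{J\varphi}$ for $t<0$ and $\gamma(t)=te^{-J\varphi}$ for $t>0$, and set $\int_{\partial(S_\varphi\cap\mathbb{C}_J)}F(s)\,ds_J\,G(s):=\int_{\mathbb{R}\setminus\{0\}}F(\gamma(t))\gamma'(t)J^{-1}G(\gamma(t))\,dt$. $D=\partial_{q_0}+e_1\partial_{q_1}+e_2\partial_{q_2}+e_3\partial_{q_3}$ is the Cauchy–Fueter operator acting from the left on functions of $q=q_0+q_1e_1+q_2e_2+q_3e_3$; $fD:=\partial_{q_0}f+(\partial_{q_1}f)e_1+(\partial_{q_2}f)e_2+(\partial_{q_3}f)e_3$ is its action from the right. *)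

theory Defs imports "HOL-Analysis.Analysis" begin

datatype quat = Quat (re0: real) (im1: real) (im2: real) (im3: real)

lemma quat_eqI: "re0 x = re0 y \<Longrightarrow> im1 x = im1 y \<Longrightarrow> im2 x = im2 y \<Longrightarrow> im3 x = im3 y \<Longrightarrow> x = y"
  by (cases x; cases y) simp

instantiation quat :: ab_group_add
begin
definition "0 = Quat 0 0 0 0"
definition "x + y = Quat (re0 x + re0 y) (im1 x + im1 y) (im2 x + im2 y) (im3 x + im3 y)"
definition "x - y = Quat (re0 x - re0 y) (im1 x - im1 y) (im2 x - im2 y) (im3 x - im3 y)"
definition "- x = Quat (- re0 x) (- im1 x) (- im2 x) (- im3 x)"
instance by standard (auto intro!: quat_eqI simp: zero_quat_def plus_quat_def minus_quat_def uminus_quat_def)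
end

instantiation quat :: real_vector
begin
definition "scaleR r x = Quat (r * re0 x) (r * im1 x) (r * im2 x) (r * im3 x)"
instance by standard (auto intro!: quat_eqI simp: scaleR_quat_def plus_quat_def algebra_simps)
end

instantiation quat :: real_inner
begin
definition "inner x y = re0 x * re0 y + im1 x * im1 y + im2 x * im2 y + im3 x * im3 y"
definition "norm x = sqrt ((re0 x)\<^sup>2 + (im1 x)\<^sup>2 + (im2 x)\<^sup>2 + (im3 x)\<^sup>2)"
definition "sgn (x::quat) = scaleR (inverse (norm x)) x"
definition "dist (x::quat) y = norm (x - y)"
definition "uniformity = (INF e\<in>{0<..}. principal {(x::quat, y). dist x y < e})"
definition "open (U :: quat set) = (\<forall>x\<in>U. \<forall>\<^sub>F (x', y) in uniformity. x' = x \<longrightarrow> y \<in> U)"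
instance
proof
  fix x y z :: quat and r :: real
  show "inner x y = inner y x" by (simp add: inner_quat_def algebra_simps)
  show "inner (x + y) z = inner x z + inner y z" by (simp add: inner_quat_def plus_quat_def algebra_simps)
  show "inner (scaleR r x) y = r * inner x y" by (simp add: inner_quat_def scaleR_quat_def algebra_simps)
  show "0 \<le> inner x x" by (simp add: inner_quat_def)
  show "inner x x = 0 \<longleftrightarrow> x = 0"
  proof
    assume "inner x x = 0"
    then show "x = 0" by (auto intro!: quat_eqI simp: inner_quat_def zero_quat_def add_nonneg_eq_0_iff)
  qed (simp add: inner_quat_def zero_quat_def)
  show "norm x = sqrt (inner x x)" by (simp add: norm_quat_def inner_quat_def power2_eq_square)
qed (simp_all add: sgn_quat_def dist_quat_def uniformity_quat_def open_quat_def)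
end

instantiation quat :: "{one, times, inverse}"
begin
definition "1 = Quat 1 0 0 0"
definition "x * y = Quat
  (re0 x * re0 y - im1 x * im1 y - im2 x * im2 y - im3 x * im3 y)
  (re0 x * im1 y + im1 x * re0 y + im2 x * im3 y - im3 x * im2 y)
  (re0 x * im2 y - im1 x * im3 y + im2 x * re0 y + im3 x * im1 y)
  (re0 x * im3 y + im1 x * im2 y - im2 x * im1 y + im3 x * re0 y)"
definition "inverse x = (let n = (re0 x)\<^sup>2 + (im1 x)\<^sup>2 + (im2 x)\<^sup>2 + (im3 x)\<^sup>2 in
   Quat (re0 x / n) (- im1 x / n) (- im2 x / n) (- im3 x / n))"
definition "x div (y::quat) = x * inverse y"
instance ..
end

lemma quat_nsq_pos: "x \<noteq> 0 \<Longrightarrow> (re0 x)\<^sup>2 + (im1 x)\<^sup>2 + (im2 x)\<^sup>2 + (im3 x)\<^sup>2 > 0"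
proof -
  assume "x \<noteq> 0"
  then have "\<not> (re0 x = 0 \<and> im1 x = 0 \<and> im2 x = 0 \<and> im3 x = 0)"
    by (auto simp: zero_quat_def intro: quat_eqI)
  then show ?thesis
    by (auto simp: add_pos_nonneg add_nonneg_pos)
qed

instance quat :: real_normed_div_algebra
proof
  fix x y z :: quat and a :: real
  show "x * y * z = x * (y * z)" by (simp add: times_quat_def algebra_simps)
  show "(x + y) * z = x * z + y * z" by (simp add: times_quat_def plus_quat_def algebra_simps)
  show "x * (y + z) = x * y + x * z" by (simp add: times_quat_def plus_quat_def algebra_simps)
  show "scaleR a x * y = scaleR a (x * y)" by (simp add: times_quat_def scaleR_quat_def algebra_simps)
  show "x * scaleR a y = scaleR a (x * y)" by (simp add: times_quat_def scaleR_quat_def algebra_simps)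
  show "1 * x = x" by (simp add: times_quat_def one_quat_def)
  show "x * 1 = x" by (simp add: times_quat_def one_quat_def)
  show "(0::quat) \<noteq> 1" by (simp add: zero_quat_def one_quat_def)
  show "x / y = x * inverse y" by (simp add: divide_quat_def)
  show "inverse (0::quat) = 0" by (simp add: inverse_quat_def zero_quat_def)
  show "x \<noteq> 0 \<Longrightarrow> inverse x * x = 1"
  proof -
    assume "x \<noteq> 0"
    from quat_nsq_pos[OF this] have n: "(re0 x)\<^sup>2 + (im1 x)\<^sup>2 + (im2 x)\<^sup>2 + (im3 x)\<^sup>2 \<noteq> 0" by simp
    show ?thesis
      by (rule quat_eqI) (use n in \<open>simp_all add: inverse_quat_def times_quat_def one_quat_def Let_def divide_simps, simp_all add: power2_eq_square algebra_simps\<close>)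
  qed
  show "x \<noteq> 0 \<Longrightarrow> x * inverse x = 1"
  proof -
    assume "x \<noteq> 0"
    from quat_nsq_pos[OF this] have n: "(re0 x)\<^sup>2 + (im1 x)\<^sup>2 + (im2 x)\<^sup>2 + (im3 x)\<^sup>2 \<noteq> 0" by simp
    show ?thesis
      by (rule quat_eqI) (use n in \<open>simp_all add: inverse_quat_def times_quat_def one_quat_def Let_def divide_simps, simp_all add: power2_eq_square algebra_simps\<close>)
  qed
  show "norm (x * y) = norm x * norm y"
    unfolding norm_quat_def real_sqrt_mult[symmetric]
    by (rule arg_cong[where f=sqrt]) (simp add: times_quat_def power2_eq_square algebra_simps)
qed


definition qe :: "nat \<Rightarrow> quat" where
  "qe i = (if i = 0 then 1 else if i = 1 then Quat 0 1 0 0 else if i = 2 then Quat 0 0 1 0 else Quat 0 0 0 1)"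

definition qcnj :: "quat \<Rightarrow> quat" where
  "qcnj x = Quat (re0 x) (- im1 x) (- im2 x) (- im3 x)"

definition unitS :: "quat set" where
  "unitS = {s. re0 s = 0 \<and> norm s = 1}"

definition qexpJ :: "quat \<Rightarrow> real \<Rightarrow> quat" where
  "qexpJ J \<phi> = of_real (cos \<phi>) + J * of_real (sin \<phi>)"

definition sector :: "real \<Rightarrow> quat set" where
  "sector \<omega> = {s. \<exists>r>0. \<exists>J\<in>unitS. \<exists>\<phi>. \<bar>\<phi>\<bar> < \<omega> \<and> s = of_real r * qexpJ J \<phi>}"

definition axially_symmetric :: "quat set \<Rightarrow> bool" where
  "axially_symmetric U \<longleftrightarrow>
     (\<forall>s\<in>U. \<forall>J\<in>unitS. of_real (re0 s) + J * of_real (norm (s - of_real (re0 s))) \<in> U)"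

definition two_sided_banach :: "(quat \<Rightarrow> 'v::banach \<Rightarrow> 'v) \<Rightarrow> ('v \<Rightarrow> quat \<Rightarrow> 'v) \<Rightarrow> bool" where
  "two_sided_banach lm rm \<longleftrightarrow>
     (\<forall>a b v w.
        lm a (v + w) = lm a v + lm a w \<and> lm (a + b) v = lm a v + lm b v \<and>
        lm (a * b) v = lm a (lm b v) \<and> lm 1 v = v \<and>
        rm (v + w) a = rm v a + rm w a \<and> rm v (a + b) = rm v a + rm v b \<and>
        rm v (a * b) = rm (rm v a) b \<and> rm v 1 = v \<and>
        lm a (rm v b) = rm (lm a v) b \<and>
        (\<forall>r. lm (of_real r) v = r *\<^sub>R v \<and> rm v (of_real r) = r *\<^sub>R v) \<and>
        norm (lm a v) = norm a * norm v \<and> norm (rm v a) = norm a * norm v)"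

definition two_sided_subspace :: "(quat \<Rightarrow> 'v::banach \<Rightarrow> 'v) \<Rightarrow> ('v \<Rightarrow> quat \<Rightarrow> 'v) \<Rightarrow> 'v set \<Rightarrow> bool" where
  "two_sided_subspace lm rm D \<longleftrightarrow>
     0 \<in> D \<and> (\<forall>v\<in>D. \<forall>w\<in>D. v + w \<in> D) \<and> (\<forall>v\<in>D. \<forall>a. lm a v \<in> D \<and> rm v a \<in> D)"

definition two_sided_linear :: "(quat \<Rightarrow> 'v::banach \<Rightarrow> 'v) \<Rightarrow> ('v \<Rightarrow> quat \<Rightarrow> 'v) \<Rightarrow> 'v set \<Rightarrow> ('v \<Rightarrow> 'v) \<Rightarrow> bool" where
  "two_sided_linear lm rm D A \<longleftrightarrow>
     (\<forall>v\<in>D. \<forall>w\<in>D. A (v + w) = A v + A w) \<and>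
     (\<forall>v\<in>D. \<forall>a. A (lm a v) = lm a (A v) \<and> A (rm v a) = rm (A v) a)"

(* ===== The class KC(V) =====
   An operator T = T0 + e1 T1 + e2 T2 + e3 T3 is given by its domain D and its components
   Tc 0, Tc 1, Tc 2, Tc 3 (the components are uniquely determined by T). *)

definition opT :: "(quat \<Rightarrow> 'v::banach \<Rightarrow> 'v) \<Rightarrow> (nat \<Rightarrow> 'v \<Rightarrow> 'v) \<Rightarrow> 'v \<Rightarrow> 'v" where
  "opT lm Tc v = (\<Sum>i<4. lm (qe i) (Tc i v))"

definition conjT :: "(nat \<Rightarrow> 'v::banach \<Rightarrow> 'v) \<Rightarrow> nat \<Rightarrow> 'v \<Rightarrow> 'v" where
  "conjT Tc = (\<lambda>i. if i = 0 then Tc 0 else (\<lambda>v. - Tc i v))"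

definition dom2 :: "(quat \<Rightarrow> 'v::banach \<Rightarrow> 'v) \<Rightarrow> 'v set \<Rightarrow> (nat \<Rightarrow> 'v \<Rightarrow> 'v) \<Rightarrow> 'v set" where
  "dom2 lm D Tc = {v\<in>D. opT lm Tc v \<in> D}"

definition KC :: "(quat \<Rightarrow> 'v::banach \<Rightarrow> 'v) \<Rightarrow> ('v \<Rightarrow> quat \<Rightarrow> 'v) \<Rightarrow> 'v set \<Rightarrow> (nat \<Rightarrow> 'v \<Rightarrow> 'v) \<Rightarrow> bool" where
  "KC lm rm D Tc \<longleftrightarrow>
     two_sided_subspace lm rm D \<and>
     (\<forall>i<4. two_sided_linear lm rm D (Tc i)) \<and>
     closed ((\<lambda>v. (v, opT lm Tc v)) ` D) \<and>
     (\<forall>i<4. \<forall>j<4. \<forall>v\<in>dom2 lm D Tc. Tc j v \<in> D \<and> Tc i (Tc j v) = Tc j (Tc i v))"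

definition Qcs :: "(quat \<Rightarrow> 'v::banach \<Rightarrow> 'v) \<Rightarrow> (nat \<Rightarrow> 'v \<Rightarrow> 'v) \<Rightarrow> quat \<Rightarrow> 'v \<Rightarrow> 'v" where
  "Qcs lm Tc s v = lm (s\<^sup>2) v - lm (2 * s) (Tc 0 v) + (\<Sum>i<4. Tc i (Tc i v))"

definition rhoS :: "(quat \<Rightarrow> 'v::banach \<Rightarrow> 'v) \<Rightarrow> 'v set \<Rightarrow> (nat \<Rightarrow> 'v \<Rightarrow> 'v) \<Rightarrow> quat set" where
  "rhoS lm D Tc = {s. bij_betw (Qcs lm Tc s) (dom2 lm D Tc) UNIV}"

definition sigmaS :: "(quat \<Rightarrow> 'v::banach \<Rightarrow> 'v) \<Rightarrow> 'v set \<Rightarrow> (nat \<Rightarrow> 'v \<Rightarrow> 'v) \<Rightarrow> quat set" where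
  "sigmaS lm D Tc = - rhoS lm D Tc"

definition Qinv :: "(quat \<Rightarrow> 'v::banach \<Rightarrow> 'v) \<Rightarrow> 'v set \<Rightarrow> (nat \<Rightarrow> 'v \<Rightarrow> 'v) \<Rightarrow> quat \<Rightarrow> 'v \<Rightarrow> 'v" where
  "Qinv lm D Tc s = inv_into (dom2 lm D Tc) (Qcs lm Tc s)"

definition SLinv :: "(quat \<Rightarrow> 'v::banach \<Rightarrow> 'v) \<Rightarrow> 'v set \<Rightarrow> (nat \<Rightarrow> 'v \<Rightarrow> 'v) \<Rightarrow> quat \<Rightarrow> 'v \<Rightarrow> 'v" where
  "SLinv lm D Tc s v = lm s (Qinv lm D Tc s v) - opT lm (conjT Tc) (Qinv lm D Tc s v)"

text \<open>S_R^{-1}(s,T) = s Q_{c,s}^{-1}(T) - sum_i T_i Q_{c,s}^{-1}(T) conj(e_i), where for an operator A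
  and a quaternion a, (A a) v = A (a v) and (a A) v = a (A v).\<close>
definition SRinv :: "(quat \<Rightarrow> 'v::banach \<Rightarrow> 'v) \<Rightarrow> 'v set \<Rightarrow> (nat \<Rightarrow> 'v \<Rightarrow> 'v) \<Rightarrow> quat \<Rightarrow> 'v \<Rightarrow> 'v" where
  "SRinv lm D Tc s v = lm s (Qinv lm D Tc s v) - (\<Sum>i<4. Tc i (Qinv lm D Tc s (lm (qcnj (qe i)) v)))"

definition op_type :: "(quat \<Rightarrow> 'v::banach \<Rightarrow> 'v) \<Rightarrow> 'v set \<Rightarrow> (nat \<Rightarrow> 'v \<Rightarrow> 'v) \<Rightarrow> real \<Rightarrow> bool" where
  "op_type lm D Tc \<omega> \<longleftrightarrow>
     0 < \<omega> \<and> \<omega> < pi \<and>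
     sigmaS lm D Tc \<subseteq> closure (sector \<omega>) \<and>
     (\<forall>\<theta>. \<omega> < \<theta> \<and> \<theta> < pi \<longrightarrow>
        (\<exists>C\<ge>0. \<forall>s. s \<notin> sector \<theta> \<and> s \<noteq> 0 \<longrightarrow>
           (\<forall>v. norm (SLinv lm D Tc s v) \<le> C / norm s * norm v) \<and>
           (\<forall>v. norm (SRinv lm D Tc s v) \<le> C / norm s * norm v)))"

definition C1_on :: "(real \<times> real) set \<Rightarrow> (real \<times> real \<Rightarrow> quat) \<Rightarrow> bool" where
  "C1_on A g \<longleftrightarrow> (\<exists>g'. (\<forall>x\<in>A. (g has_derivative blinfun_apply (g' x)) (at x)) \<and> continuous_on A g')"

definition pd_u :: "(real \<times> real \<Rightarrow> quat) \<Rightarrow> real \<times> real \<Rightarrow> quat" where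
  "pd_u g x = frechet_derivative g (at x) (1, 0)"
definition pd_v :: "(real \<times> real \<Rightarrow> quat) \<Rightarrow> real \<times> real \<Rightarrow> quat" where
  "pd_v g x = frechet_derivative g (at x) (0, 1)"

definition slice_dom :: "quat set \<Rightarrow> (real \<times> real) set" where
  "slice_dom U = {(u, v). \<forall>J\<in>unitS. of_real u + J * of_real v \<in> U}"

definition slice_hol_L :: "quat set \<Rightarrow> (quat \<Rightarrow> quat) \<Rightarrow> bool" where
  "slice_hol_L U f \<longleftrightarrow> open U \<and> axially_symmetric U \<and>
     (\<exists>\<alpha> \<beta>. C1_on (slice_dom U) \<alpha> \<and> C1_on (slice_dom U) \<beta> \<and>
        (\<forall>u v. (u, v) \<in> slice_dom U \<longrightarrow>
           (\<forall>J\<in>unitS. f (of_real u + J * of_real v) = \<alpha> (u, v) + J * \<beta> (u, v)) \<and>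
           \<alpha> (u, - v) = \<alpha> (u, v) \<and> \<beta> (u, - v) = - \<beta> (u, v) \<and>
           pd_u \<alpha> (u, v) = pd_v \<beta> (u, v) \<and> pd_v \<alpha> (u, v) = - pd_u \<beta> (u, v)))"

definition slice_hol_R :: "quat set \<Rightarrow> (quat \<Rightarrow> quat) \<Rightarrow> bool" where
  "slice_hol_R U f \<longleftrightarrow> open U \<and> axially_symmetric U \<and>
     (\<exists>\<alpha> \<beta>. C1_on (slice_dom U) \<alpha> \<and> C1_on (slice_dom U) \<beta> \<and>
        (\<forall>u v. (u, v) \<in> slice_dom U \<longrightarrow>
           (\<forall>J\<in>unitS. f (of_real u + J * of_real v) = \<alpha> (u, v) + \<beta> (u, v) * J) \<and>
           \<alpha> (u, - v) = \<alpha> (u, v) \<and> \<beta> (u, - v) = - \<beta> (u, v) \<and>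
           pd_u \<alpha> (u, v) = pd_v \<beta> (u, v) \<and> pd_v \<alpha> (u, v) = - pd_u \<beta> (u, v)))"

definition decay_Q :: "real \<Rightarrow> (quat \<Rightarrow> quat) \<Rightarrow> bool" where
  "decay_Q \<theta> f \<longleftrightarrow> (\<exists>a>0. \<exists>C\<ge>0. \<forall>s\<in>sector \<theta>.
      norm (f s) \<le> C * norm s powr (1 + a) / (1 + norm s powr (1 + 2 * a)))"

definition PsiL :: "real \<Rightarrow> (quat \<Rightarrow> quat) set" where
  "PsiL \<theta> = {f. slice_hol_L (sector \<theta>) f \<and> decay_Q \<theta> f}"

definition PsiR :: "real \<Rightarrow> (quat \<Rightarrow> quat) set" where
  "PsiR \<theta> = {f. slice_hol_R (sector \<theta>) f \<and> decay_Q \<theta> f}"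

definition qpartial :: "(quat \<Rightarrow> quat) \<Rightarrow> nat \<Rightarrow> quat \<Rightarrow> quat" where
  "qpartial f i q = frechet_derivative f (at q) (qe i)"

definition CF_L :: "(quat \<Rightarrow> quat) \<Rightarrow> quat \<Rightarrow> quat" where
  "CF_L f q = (\<Sum>i<4. qe i * qpartial f i q)"

definition CF_R :: "(quat \<Rightarrow> quat) \<Rightarrow> quat \<Rightarrow> quat" where
  "CF_R f q = (\<Sum>i<4. qpartial f i q * qe i)"

definition spath :: "quat \<Rightarrow> real \<Rightarrow> real \<Rightarrow> quat" where
  "spath J \<phi> t = (if t < 0 then - of_real t * qexpJ J \<phi> else of_real t * qexpJ J (- \<phi>))"

definition spath' :: "quat \<Rightarrow> real \<Rightarrow> real \<Rightarrow> quat" where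
  "spath' J \<phi> t = (if t < 0 then - qexpJ J \<phi> else qexpJ J (- \<phi>))"

text \<open>Integrand of Df(T): t |-> Q_{c,gamma(t)}^{-1}(T) gamma'(t) J^{-1} f(gamma(t)),
   as the operator v |-> Q^{-1}(gamma'(t) J^{-1} f(gamma(t)) v).\<close>
definition kerL :: "(quat \<Rightarrow> 'v::banach \<Rightarrow> 'v) \<Rightarrow> 'v set \<Rightarrow> (nat \<Rightarrow> 'v \<Rightarrow> 'v) \<Rightarrow> (quat \<Rightarrow> quat) \<Rightarrow> quat \<Rightarrow> real \<Rightarrow> real \<Rightarrow> 'v \<Rightarrow> 'v" where
  "kerL lm D Tc f J \<phi> t v =
     Qinv lm D Tc (spath J \<phi> t) (lm (spath' J \<phi> t * inverse J * f (spath J \<phi> t)) v)"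

definition kerR :: "(quat \<Rightarrow> 'v::banach \<Rightarrow> 'v) \<Rightarrow> 'v set \<Rightarrow> (nat \<Rightarrow> 'v \<Rightarrow> 'v) \<Rightarrow> (quat \<Rightarrow> quat) \<Rightarrow> quat \<Rightarrow> real \<Rightarrow> real \<Rightarrow> 'v \<Rightarrow> 'v" where
  "kerR lm D Tc f J \<phi> t v =
     lm (f (spath J \<phi> t) * spath' J \<phi> t * inverse J) (Qinv lm D Tc (spath J \<phi> t) v)"

definition abs_conv_op :: "(real \<Rightarrow> 'v::banach \<Rightarrow> 'v) \<Rightarrow> bool" where
  "abs_conv_op K \<longleftrightarrow>
     (\<forall>t. t \<noteq> 0 \<longrightarrow> bounded_linear (K t)) \<and>
     (\<lambda>t. Blinfun (K t)) integrable_on (- {0}) \<and>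
     (\<lambda>t. norm (Blinfun (K t))) integrable_on (- {0})"

definition DfT :: "(quat \<Rightarrow> 'v::banach \<Rightarrow> 'v) \<Rightarrow> 'v set \<Rightarrow> (nat \<Rightarrow> 'v \<Rightarrow> 'v) \<Rightarrow> (quat \<Rightarrow> quat) \<Rightarrow> real \<Rightarrow> quat \<Rightarrow> 'v \<Rightarrow>\<^sub>L 'v" where
  "DfT lm D Tc f \<phi> J = (- 1 / pi) *\<^sub>R integral (- {0}) (\<lambda>t. Blinfun (kerL lm D Tc f J \<phi> t))"

definition fDT :: "(quat \<Rightarrow> 'v::banach \<Rightarrow> 'v) \<Rightarrow> 'v set \<Rightarrow> (nat \<Rightarrow> 'v \<Rightarrow> 'v) \<Rightarrow> (quat \<Rightarrow> quat) \<Rightarrow> real \<Rightarrow> quat \<Rightarrow> 'v \<Rightarrow>\<^sub>L 'v" where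
  "fDT lm D Tc f \<phi> J = (- 1 / pi) *\<^sub>R integral (- {0}) (\<lambda>t. Blinfun (kerR lm D Tc f J \<phi> t))"

end

theory Submission
  imports Defs "HOL-Real_Asymp.Real_Asymp"
begin

text \<open>
  Write \<open>R s\<close> for the pseudo-resolvent at \<open>s\<close>. For \<open>s = -1\<close> the operator \<open>Q s\<close> factors into \<open>s - T\<close> and
  \<open>s - conj T\<close>, which shows that \<open>R (-1)\<close>, and then every \<open>R s\<close>, commutes with the components \<open>T\<^sub>i\<close>; the
  bounds on the \<open>S\<close>-resolvents of \<open>T\<close> and \<open>conj T\<close> then give \<open>\<parallel>R s\<parallel> \<le> C / \<bar>s\<bar>\<^sup>2\<close>, hence absolute convergence.

  Conjugation by quaternions shows that \<open>R (u + J v) = G (u, v) + J H (u, v)\<close> with \<open>G\<close>, \<open>H\<close> independent of \<open>J\<close> and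
  commuting with all quaternions. If \<open>f (u + J v) = \<alpha> + J \<beta>\<close> (or \<open>\<alpha> + \<beta> J\<close>), the contributions of the two
  rays of the path add up to \<open>-2\<close> times the imaginary part of \<open>(G + i H) e\<^sup>i\<^sup>\<phi> (\<alpha> + i \<beta>)\<close>, which does not
  contain \<open>J\<close> and is the same expression for left and right slice functions. This product is holomorphic, so the
  \<open>\<phi>\<close>-derivative of the integral is a boundary term, which vanishes in the limit.

  Off the real axis \<open>D f = - 2 \<beta> / v\<close>. So \<open>D f = D g\<close> forces equal \<open>\<beta>\<close>, then by the Cauchy-Riemann equations
  \<open>f - g\<close> is constant along rays, and the decay at \<open>0\<close> makes it vanish.
\<close>

section \<open>Improper integrals of Banach-valued functions\<close>

text \<open>Why the commutation passes through \<open>-1\<close>: checking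
  \<open>Tc i (R s w) = R s (Tc i w)\<close> directly means applying \<open>Q s\<close> to
  \<open>Tc i (R s w)\<close>, a vector known to lie in \<open>D\<close> only, whereas
  \<open>Q s\<close> acts on \<open>D2\<close>. At a real point both factors of \<open>Q s\<close>
  are injective operators of first order and can be cancelled one at a time without leaving these
  domains; \<open>-1\<close> is such a point because \<omega> < pi keeps the negative real half-line
  out of the closed sector. The exponents of the decay class fit the quadratic resolvent bound:
  |s|^(1+a) / (1 + |s|^(1+2a)) times |s|^(-2) behaves like t^(a-1) at 0 and like t^(-2-a) at
  infinity, so both ends converge. The boundary terms of the angle argument carry one more factor
  |s| and still vanish at both ends. The two rays of the path have the same angle, in the
  half-planes of \<open>J\<close> and of \<open>- J\<close>, so everything reduces to a single ray t
  > 0 in a formal complex half-plane.\<close>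

lemma has_integral_improper_greaterThan:
  fixes F f :: "real \<Rightarrow> 'b::banach"
  assumes F: "\<And>t. t > 0 \<Longrightarrow> (F has_vector_derivative f t) (at t)"
    and l0: "(F \<longlongrightarrow> l0) (at_right 0)" and l1: "(F \<longlongrightarrow> l1) at_top"
  shows "(f has_integral (l1 - l0)) {0<..}"
  unfolding has_integral'[of f _ "{0<..}"]
proof (intro allI impI)
  fix e :: real assume "e > 0"
  then have "eventually (\<lambda>t. dist (F t) l1 < e) at_top" using l1 by (simp add: tendsto_iff)
  then obtain N where N: "\<And>t. t \<ge> N \<Longrightarrow> dist (F t) l1 < e" by (auto simp: eventually_at_top_linorder)
  define B where "B = max N 1"
  let ?g = "\<lambda>x. if x \<in> {0<..} then f x else 0"
  show "\<exists>B>0. \<forall>a b. ball 0 B \<subseteq> cbox a b \<longrightarrow> (\<exists>z. (?g has_integral z) (cbox a b) \<and> norm (z - (l1 - l0)) < e)"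
  proof (intro exI[of _ B] conjI allI impI)
    show "B > 0" by (simp add: B_def)
    fix a b :: real assume "ball 0 B \<subseteq> cbox a b"
    then have "closure (ball 0 B) \<subseteq> cbox a b" by (rule closure_minimal) simp
    then have "cball 0 B \<subseteq> {a..b}" using \<open>B > 0\<close> by simp
    then have ab: "a \<le> - B" "B \<le> b" using \<open>B > 0\<close> by (auto simp: subset_iff dist_norm dest: spec[of _ B] spec[of _ "-B"])
    \<comment> \<open>Filling in the one-sided limit makes the antiderivative continuous on the
      closed interval from 0 to b; the interior form of the fundamental theorem then asks for
      derivatives at t > 0 only.\<close>
    define F0 where "F0 t = (if t \<le> 0 then l0 else F t)" for t
    have "(F0 has_vector_derivative f t) (at t)" if "t > 0" for t
      by (rule has_vector_derivative_transform_within_open[OF F[OF that], of "{0<..}"])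
         (use that in \<open>auto simp: F0_def\<close>)
    moreover have "continuous_on {0..b} F0"
      unfolding continuous_on_eq_continuous_within
    proof
      fix t assume t: "t \<in> {0..b}"
      show "continuous (at t within {0..b}) F0"
      proof (cases "t = 0")
        case True
        have "(F0 \<longlongrightarrow> l0) (at_right 0)"
          by (rule Lim_transform_eventually[OF l0]) (simp add: eventually_at_right_less F0_def eventually_at_filter)
        then have "(F0 \<longlongrightarrow> l0) (at 0 within {0..b})"
          using ab \<open>B > 0\<close> by (simp add: at_within_Icc_at_right)
        with True show ?thesis by (simp add: continuous_within F0_def)
      next
        case False
        then have "t > 0" using t by simp
        from has_vector_derivative_continuous[OF calculation[OF this]] show ?thesis
          by (rule continuous_at_imp_continuous_within)
      qed
    qed
    ultimately have "(f has_integral (F0 b - F0 0)) {0..b}"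
      using ab \<open>B > 0\<close> by (intro fundamental_theorem_of_calculus_interior) auto
    then have "(?g has_integral (F b - l0)) {0..b}"
      using ab \<open>B > 0\<close> by (intro has_integral_spike_finite[of "{0}" _ ?g f]) (auto simp: F0_def)
    moreover have "(?g has_integral 0) {a..0}" by (rule has_integral_is_0) auto
    ultimately have "(?g has_integral (0 + (F b - l0))) {a..b}"
      using ab \<open>B > 0\<close> by (intro has_integral_combine[of a 0 b]) auto
    moreover have "norm (F b - l0 - (l1 - l0)) < e"
      using N[of b] ab by (simp add: B_def dist_norm)
    ultimately show "\<exists>z. (?g has_integral z) (cbox a b) \<and> norm (z - (l1 - l0)) < e" by auto
  qed
qed

text \<open>The sequence \<open>x\<close> only produces a candidate \<open>l\<close> by
  completeness. Letting the second argument of the increment bound run along \<open>x\<close> gives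
  norm (F t - l) \<le> |\<Gamma> t - c|, which transfers convergence from the sequence to the whole
  filter.\<close>

lemma tendsto_if_increments_dominated:
  fixes F :: "'a \<Rightarrow> 'b::banach" and \<Gamma> :: "'a \<Rightarrow> real"
  assumes G: "(\<Gamma> \<longlongrightarrow> c) G" and S: "eventually (\<lambda>t. t \<in> S) G"
    and x: "filterlim x G sequentially" "\<And>n. x n \<in> S"
    and le: "\<And>s t. s \<in> S \<Longrightarrow> t \<in> S \<Longrightarrow> norm (F s - F t) \<le> \<bar>\<Gamma> s - \<Gamma> t\<bar>"
  obtains l where "(F \<longlongrightarrow> l) G"
proof -
  have xc: "(\<lambda>n. \<Gamma> (x n)) \<longlonglongrightarrow> c" using filterlim_compose[OF G x(1)] .
  have "Cauchy (\<lambda>n. F (x n))"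
    unfolding Cauchy_def
  proof (intro allI impI)
    fix e :: real assume "e > 0"
    then obtain M where M: "\<And>m n. m \<ge> M \<Longrightarrow> n \<ge> M \<Longrightarrow> dist (\<Gamma> (x m)) (\<Gamma> (x n)) < e"
      using LIMSEQ_imp_Cauchy[OF xc] unfolding Cauchy_def by blast
    then show "\<exists>M. \<forall>m\<ge>M. \<forall>n\<ge>M. dist (F (x m)) (F (x n)) < e"
      using le_less_trans[OF le[OF x(2) x(2)]] by (intro exI[of _ M]) (simp add: dist_norm)
  qed
  then obtain l where l: "(\<lambda>n. F (x n)) \<longlonglongrightarrow> l" using Cauchy_convergent_iff convergent_def by blast
  have *: "norm (F t - l) \<le> \<bar>\<Gamma> t - c\<bar>" if "t \<in> S" for t
  proof (rule tendsto_le[OF sequentially_bot])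
    show "(\<lambda>n. \<bar>\<Gamma> t - \<Gamma> (x n)\<bar>) \<longlonglongrightarrow> \<bar>\<Gamma> t - c\<bar>" by (intro tendsto_intros xc)
    show "(\<lambda>n. norm (F t - F (x n))) \<longlonglongrightarrow> norm (F t - l)" by (intro tendsto_intros l)
  qed (use le[OF that x(2)] in auto)
  have "((\<lambda>t. \<bar>\<Gamma> t - c\<bar>) \<longlongrightarrow> \<bar>c - c\<bar>) G" by (intro tendsto_intros G)
  then have "((\<lambda>t. F t - l) \<longlongrightarrow> 0) G"
    by (intro Lim_null_comparison[OF eventually_mono[OF S *]]) auto
  then show thesis using that Lim_null by blast
qed

lemma continuous_antiderivative_greaterThan:
  fixes f :: "real \<Rightarrow> 'b::banach"
  assumes f: "continuous_on {0<..} f"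
  obtains F where "\<And>t. t > 0 \<Longrightarrow> (F has_vector_derivative f t) (at t)"
proof
  \<comment> \<open>An integral over an interval with reversed endpoints is 0, so at most one of the
    two terms is nonzero and the difference is the oriented integral from 1 to t.\<close>
  let ?F = "\<lambda>t. integral {1..t} f - integral {t..1} f"
  fix t :: real assume t: "t > 0"
  define a where "a = min t 1 / 2"
  define b where "b = max t 1 + 1"
  have ab: "0 < a" "a < t" "a < 1" "t < b" using t by (auto simp: a_def b_def min_def max_def)
  have c: "continuous_on {a..b} f" by (rule continuous_on_subset[OF f]) (use ab in auto)
  have int: "f integrable_on {u..v}" if "u \<ge> a" for u v
    by (rule integrable_continuous_interval, rule continuous_on_subset[OF f]) (use ab that in auto)
  have eq: "?F x = integral {a..x} f - integral {a..1} f" if "x \<in> {a<..<b}" for x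
  proof (cases "x \<ge> 1")
    case True
    then have "integral {x..1} f = 0" by (cases "x = 1") auto
    with True ab int[of a] show ?thesis by (simp add: Henstock_Kurzweil_Integration.integral_combine[of a 1 x f, symmetric])
  next
    case False
    with that ab int[of a] show ?thesis by (simp add: Henstock_Kurzweil_Integration.integral_combine[of a x 1 f, symmetric])
  qed
  have "((\<lambda>x. integral {a..x} f) has_vector_derivative f t) (at t within {a..b})"
    by (rule integral_has_vector_derivative[OF c]) (use ab in auto)
  then have "((\<lambda>x. integral {a..x} f) has_vector_derivative f t) (at t within {a<..<b})"
    by (rule has_vector_derivative_within_subset) auto
  then have "((\<lambda>x. integral {a..x} f) has_vector_derivative f t) (at t)"
    using at_within_open[of t "{a<..<b}"] ab by simp
  then have "((\<lambda>x. integral {a..x} f - integral {a..1} f) has_vector_derivative f t) (at t)"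
    by (auto intro!: derivative_eq_intros)
  then show "(?F has_vector_derivative f t) (at t)"
    by (rule has_vector_derivative_transform_within_open[of _ _ _ "{a<..<b}"]) (use ab eq in auto)
qed

text \<open>An antiderivative of \<open>f\<close> has increments bounded by those of
  \<open>\<Gamma>\<close>, hence limits at both ends. The truncations to [1/(n+1), n+1] are recorded
  because the angle argument differentiates truncated integrals and passes to the limit
  afterwards.\<close>

lemma dominated_has_integral_greaterThan:
  fixes f :: "real \<Rightarrow> 'b::banach"
  assumes f: "continuous_on {0<..} f"
    and \<Gamma>: "\<And>t. t > 0 \<Longrightarrow> (\<Gamma> has_vector_derivative g t) (at t)"
      "(\<Gamma> \<longlongrightarrow> c0) (at_right 0)" "(\<Gamma> \<longlongrightarrow> c1) at_top"
    and le: "\<And>t. t > 0 \<Longrightarrow> norm (f t) \<le> g t"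
  shows "f integrable_on {0<..}"
    and "(\<lambda>n. integral {1 / real (Suc n)..real (Suc n)} f) \<longlonglongrightarrow> integral {0<..} f"
proof -
  obtain F where F: "\<And>t. t > 0 \<Longrightarrow> (F has_vector_derivative f t) (at t)"
    using continuous_antiderivative_greaterThan[OF f] by blast
  have FI: "(f has_integral (F b - F a)) {a..b}" if "0 < a" "a \<le> b" for a b
    by (rule fundamental_theorem_of_calculus[OF that(2) has_vector_derivative_at_within[OF F]]) (use that in auto)
  have GI: "(g has_integral (\<Gamma> b - \<Gamma> a)) {a..b}" if "0 < a" "a \<le> b" for a b
    by (rule fundamental_theorem_of_calculus[OF that(2) has_vector_derivative_at_within[OF \<Gamma>(1)]]) (use that in auto)
  have mono: "norm (F b - F a) \<le> \<bar>\<Gamma> b - \<Gamma> a\<bar>" if "0 < a" "a \<le> b" for a b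
  proof -
    have "norm (integral {a..b} f) \<le> integral {a..b} g"
      using FI[OF that] GI[OF that] that le
      by (intro Henstock_Kurzweil_Integration.integral_norm_bound_integral) auto
    then show ?thesis
      using integral_unique[OF FI[OF that]] integral_unique[OF GI[OF that]] by simp
  qed
  have incr: "norm (F s - F t) \<le> \<bar>\<Gamma> s - \<Gamma> t\<bar>" if "s \<in> {0<..}" "t \<in> {0<..}" for s t
    using mono[of s t] mono[of t s] that by (cases "s \<le> t") (auto simp: norm_minus_commute abs_minus_commute)
  have x0: "filterlim (\<lambda>n. 1 / real (Suc n)) (at_right 0) sequentially"
    by real_asymp
  have x1: "filterlim (\<lambda>n. real (Suc n)) at_top sequentially"
    by real_asymp
  obtain l0 where l0: "(F \<longlongrightarrow> l0) (at_right 0)"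
    by (rule tendsto_if_increments_dominated[OF \<Gamma>(2) _ x0, of "{0<..}" F])
       (use incr in \<open>auto simp: eventually_at_right_less\<close>)
  obtain l1 where l1: "(F \<longlongrightarrow> l1) at_top"
    by (rule tendsto_if_increments_dominated[OF \<Gamma>(3) _ x1, of "{0<..}" F])
       (use incr in \<open>auto simp: eventually_gt_at_top\<close>)
  have I: "(f has_integral (l1 - l0)) {0<..}"
    by (rule has_integral_improper_greaterThan[OF F l0 l1])
  then show "f integrable_on {0<..}" by blast
  have "integral {1 / real (Suc n)..real (Suc n)} f = F (real (Suc n)) - F (1 / real (Suc n))" for n
    by (rule integral_unique[OF FI]) (auto simp: field_simps)
  moreover have "(\<lambda>n. F (real (Suc n)) - F (1 / real (Suc n))) \<longlonglongrightarrow> l1 - l0"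
    by (intro tendsto_diff filterlim_compose[OF l1 x1] filterlim_compose[OF l0 x0])
  ultimately show "(\<lambda>n. integral {1 / real (Suc n)..real (Suc n)} f) \<longlonglongrightarrow> integral {0<..} f"
    using integral_unique[OF I] by simp
qed

text \<open>Since \<open>(1 + t powr a)\<^sup>2 \<le> 4 * (1 + t powr (1 + 2 * a))\<close>, the bound is at most a multiple of the
  derivative of \<open>- 1 / (1 + t powr a)\<close>.\<close>

lemma powr_dominated_has_integral_greaterThan:
  fixes f :: "real \<Rightarrow> 'b::banach"
  assumes f: "continuous_on {0<..} f" and a: "a > 0"
    and le: "\<And>t. t > 0 \<Longrightarrow> norm (f t) \<le> K * (t powr (a - 1) / (1 + t powr (1 + 2 * a)))"
  shows "f integrable_on {0<..}"
    and "(\<lambda>t. norm (f t)) integrable_on {0<..}"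
    and "(\<lambda>n. integral {1 / real (Suc n)..real (Suc n)} f) \<longlonglongrightarrow> integral {0<..} f"
proof -
  \<comment> \<open>The factor 4 comes from the comparison of squares stated above;
    \<open>max K 0\<close> makes the constant nonnegative whatever the sign of
    \<open>K\<close>.\<close>
  define K' where "K' = max K 0 * 4"
  have le': "norm (f t) \<le> K' * (t powr (a - 1) / (1 + t powr a)\<^sup>2)" if t: "t > 0" for t
  proof -
    have ta: "t powr (2 * a) \<le> 1 + t powr (1 + 2 * a)"
    proof (cases "t \<le> 1")
      case True
      then have "t powr (2 * a) \<le> 1" using t a by (intro powr_le1) auto
      then show ?thesis by (simp add: add_increasing2)
    next
      case False
      then have "t powr (2 * a) \<le> t powr (1 + 2 * a)" by (intro powr_mono) auto
      then show ?thesis by simp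
    qed
    have "(1 + t powr a)\<^sup>2 \<le> 2 * (1 + (t powr a)\<^sup>2)"
      using sum_squares_bound[of 1 "t powr a"] by (simp add: power2_sum)
    also have "(t powr a)\<^sup>2 = t powr (2 * a)" by (simp add: power2_eq_square flip: powr_add)
    finally have "(1 + t powr a)\<^sup>2 \<le> 4 * (1 + t powr (1 + 2 * a))"
      using ta powr_ge_zero[of t "1 + 2 * a"] by (smt (verit))
    moreover have "1 + t powr (1 + 2 * a) > 0" "(1 + t powr a)\<^sup>2 > 0"
      by (intro add_pos_nonneg zero_less_power; simp)+
    moreover have "1 / x \<le> 4 / y" if "y \<le> 4 * x" "x > 0" "y > 0" for x y :: real
      using that by (simp add: field_simps)
    ultimately have "1 / (1 + t powr (1 + 2 * a)) \<le> 4 / (1 + t powr a)\<^sup>2"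
      by blast
    then have "t powr (a - 1) * (1 / (1 + t powr (1 + 2 * a))) \<le> t powr (a - 1) * (4 / (1 + t powr a)\<^sup>2)"
      by (intro mult_left_mono) auto
    then have "t powr (a - 1) / (1 + t powr (1 + 2 * a)) \<le> 4 * (t powr (a - 1) / (1 + t powr a)\<^sup>2)"
      by (simp add: mult.commute)
    then have "max K 0 * (t powr (a - 1) / (1 + t powr (1 + 2 * a))) \<le> max K 0 * (4 * (t powr (a - 1) / (1 + t powr a)\<^sup>2))"
      by (intro mult_left_mono) auto
    moreover have "K * (t powr (a - 1) / (1 + t powr (1 + 2 * a))) \<le> max K 0 * (t powr (a - 1) / (1 + t powr (1 + 2 * a)))"
      by (intro mult_right_mono) auto
    ultimately have "norm (f t) \<le> max K 0 * (4 * (t powr (a - 1) / (1 + t powr a)\<^sup>2))"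
      using le[OF t] by linarith
    then show ?thesis by (simp only: K'_def mult.assoc)
  qed
  define \<Gamma> where "\<Gamma> t = - (K' / a) / (1 + t powr a)" for t
  have G1: "(\<Gamma> has_vector_derivative K' * (t powr (a - 1) / (1 + t powr a)\<^sup>2)) (at t)" if t: "t > 0" for t
  proof -
    have "1 + t powr a > 0" by (intro add_pos_nonneg) auto
    then have "1 + t powr a \<noteq> 0" by simp
    then have "((\<lambda>t. - 1 / (1 + t powr a)) has_real_derivative a * t powr (a - 1) / (1 + t powr a)\<^sup>2) (at t)"
      using t by (auto intro!: derivative_eq_intros simp: power2_eq_square)
    from DERIV_cmult[OF this, of "K' / a"] show ?thesis
      unfolding \<Gamma>_def has_real_derivative_iff_has_vector_derivative[symmetric] using a by simp
  qed
  have G2: "(\<Gamma> \<longlongrightarrow> - (K' / a) / (1 + 0)) (at_right 0)"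
    unfolding \<Gamma>_def using a by (intro tendsto_intros) (real_asymp, simp)
  have "((\<lambda>t. 1 / (1 + t powr a)) \<longlongrightarrow> 0) at_top" using a by real_asymp
  then have G3: "(\<Gamma> \<longlongrightarrow> - (K' / a) * 0) at_top"
    unfolding \<Gamma>_def by (subst divide_inverse, intro tendsto_intros) (simp add: inverse_eq_divide)
  note * = dominated_has_integral_greaterThan[OF _ G1 G2 G3]
  show "f integrable_on {0<..}" by (rule *(1)[OF f _ le'])
  show "(\<lambda>n. integral {1 / real (Suc n)..real (Suc n)} f) \<longlonglongrightarrow> integral {0<..} f"
    by (rule *(2)[OF f _ le'])
  show "(\<lambda>t. norm (f t)) integrable_on {0<..}"
    by (rule *(1)[OF continuous_on_norm[OF f]]) (use le' in auto)
qed

text \<open>Reflecting the negative half-line turns the two rays of the path into two integrals over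
  t > 0, which can then be added pointwise.\<close>

lemma has_integral_punctured_line:
  fixes k :: "real \<Rightarrow> 'b::banach"
  assumes k1: "(k has_integral I1) {0<..}" and k2: "((\<lambda>t. k (- t)) has_integral I2) {0<..}"
  shows "(k has_integral (I1 + I2)) (- {0})"
proof -
  have "(k has_integral I2) {..<0}"
    unfolding has_integral'[of k _ "{..<0}"]
  proof (intro allI impI)
    fix e :: real assume "e > 0"
    then obtain B where B: "B > 0" "\<And>a b. ball 0 B \<subseteq> cbox a b \<Longrightarrow>
        (\<exists>z. ((\<lambda>x. if x \<in> {0<..} then k (- x) else 0) has_integral z) (cbox a b) \<and> norm (z - I2) < e)"
      using k2 unfolding has_integral'[of _ _ "{0<..}"] by blast
    show "\<exists>B>0. \<forall>a b. ball 0 B \<subseteq> cbox a b \<longrightarrow>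
        (\<exists>z. ((\<lambda>x. if x \<in> {..<0} then k x else 0) has_integral z) (cbox a b) \<and> norm (z - I2) < e)"
    proof (intro exI[of _ B] conjI B(1) allI impI)
      fix a b :: real assume ab: "ball 0 B \<subseteq> cbox a b"
      have "ball 0 B \<subseteq> cbox (-b) (-a)"
      proof
        fix x :: real assume "x \<in> ball 0 B"
        then have "- x \<in> cbox a b" using ab by (auto simp: subset_iff)
        then show "x \<in> cbox (-b) (-a)" by auto
      qed
      from B(2)[OF this] obtain z where z: "((\<lambda>x. if x \<in> {0<..} then k (- x) else 0) has_integral z) (cbox (-b) (-a))" "norm (z - I2) < e"
        by blast
      have "((\<lambda>x. (\<lambda>x. if x \<in> {..<0} then k x else 0) (- x)) has_integral z) (cbox (-b) (-a))"
        using z(1) by simp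
      then have "((\<lambda>x. if x \<in> {..<0} then k x else 0) has_integral z) (cbox a b)"
        by (subst (asm) has_integral_reflect)
      with z(2) show "\<exists>z. ((\<lambda>x. if x \<in> {..<0} then k x else 0) has_integral z) (cbox a b) \<and> norm (z - I2) < e"
        by blast
    qed
  qed
  then have "(k has_integral (I2 + I1)) ({..<0} \<union> {0<..})"
    
  proof (rule has_integral_Un[OF _ k1])
    have "{..<0} \<inter> {0<..} = ({} :: real set)" by auto
    then show "negligible ({..<0} \<inter> {0 :: real<..})" by simp
  qed
  moreover have "{..<0} \<union> {0<..} = - {0::real}" by auto
  ultimately show ?thesis by (simp add: add.commute)
qed

text \<open>In polar coordinates the Cauchy-Riemann equations for p + i q contain d/d\<phi> q = t *
  d/dt p, and \<open>pt\<close> is that common t-derivative. Differentiating the truncated integral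
  of q / t in \<phi> therefore leaves p b \<phi> - p a \<phi>, of norm at most m a + m b, which
  vanishes as a tends to 0 and b to infinity. This plays the part of Cauchy's theorem for the
  contour.\<close>

lemma integral_independent_of_angle:
  fixes p q pt :: "real \<Rightarrow> real \<Rightarrow> 'b::banach"
  assumes \<phi>: "\<phi>1 \<le> \<phi>2"
    and q: "\<And>t \<phi>. t > 0 \<Longrightarrow> \<phi> \<in> {\<phi>1..\<phi>2} \<Longrightarrow>
      ((\<lambda>\<phi>. q t \<phi>) has_vector_derivative t *\<^sub>R pt t \<phi>) (at \<phi> within {\<phi>1..\<phi>2})"
    and p: "\<And>t \<phi>. t > 0 \<Longrightarrow> \<phi> \<in> {\<phi>1..\<phi>2} \<Longrightarrow> ((\<lambda>t. p t \<phi>) has_vector_derivative pt t \<phi>) (at t)"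
    and cont: "continuous_on ({0<..} \<times> {\<phi>1..\<phi>2}) (\<lambda>(t, \<phi>). pt t \<phi>)"
    and qc: "\<And>\<phi>. \<phi> \<in> {\<phi>1..\<phi>2} \<Longrightarrow> continuous_on {0<..} (\<lambda>t. q t \<phi>)"
    and m: "\<And>t \<phi>. t > 0 \<Longrightarrow> \<phi> \<in> {\<phi>1..\<phi>2} \<Longrightarrow> norm (p t \<phi>) \<le> m t"
      "(m \<longlongrightarrow> 0) (at_right 0)" "(m \<longlongrightarrow> 0) at_top"
    and lim: "\<And>\<phi>. \<phi> \<in> {\<phi>1..\<phi>2} \<Longrightarrow>
      (\<lambda>n. integral {1 / real (Suc n)..real (Suc n)} (\<lambda>t. q t \<phi> /\<^sub>R t)) \<longlonglongrightarrow> I \<phi>"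
  shows "I \<phi>1 = I \<phi>2"
proof -
  have bound: "norm (integral {a..b} (\<lambda>t. q t \<phi>2 /\<^sub>R t) - integral {a..b} (\<lambda>t. q t \<phi>1 /\<^sub>R t)) \<le> (m a + m b) * (\<phi>2 - \<phi>1)"
    if ab: "0 < a" "a \<le> b" for a b
  proof -
    have der: "((\<lambda>\<phi>. integral (cbox a b) (\<lambda>t. q t \<phi> /\<^sub>R t)) has_vector_derivative integral (cbox a b) (\<lambda>t. pt t \<phi>)) (at \<phi> within {\<phi>1..\<phi>2})"
      if \<phi>: "\<phi> \<in> {\<phi>1..\<phi>2}" for \<phi>
    proof (rule leibniz_rule_vector_derivative)
      fix x t assume x: "x \<in> {\<phi>1..\<phi>2}" and t: "t \<in> cbox a b"
      then have "((\<lambda>x. q t x /\<^sub>R t) has_vector_derivative (t *\<^sub>R pt t x) /\<^sub>R t) (at x within {\<phi>1..\<phi>2})"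
        using ab by (auto intro!: derivative_eq_intros q)
      then show "((\<lambda>x. q t x /\<^sub>R t) has_vector_derivative pt t x) (at x within {\<phi>1..\<phi>2})"
        using t ab by auto
    next
      fix x assume x: "x \<in> {\<phi>1..\<phi>2}"
      show "(\<lambda>t. q t x /\<^sub>R t) integrable_on cbox a b"
        by (intro integrable_continuous continuous_intros continuous_on_subset[OF qc[OF x]])
           (use ab in auto)
    next
      have "continuous_on ({\<phi>1..\<phi>2} \<times> cbox a b) (\<lambda>z. (\<lambda>(t, \<phi>). pt t \<phi>) (snd z, fst z))"
        by (rule continuous_on_compose2[OF cont]) (use ab in \<open>auto intro!: continuous_intros\<close>)
      then show "continuous_on ({\<phi>1..\<phi>2} \<times> cbox a b) (\<lambda>(x, t). pt t x)"
        by (simp add: case_prod_beta)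
    qed (use \<phi> in auto)
    have pint: "integral (cbox a b) (\<lambda>t. pt t \<phi>) = p b \<phi> - p a \<phi>" if \<phi>: "\<phi> \<in> {\<phi>1..\<phi>2}" for \<phi>
      unfolding cbox_interval
      by (rule integral_unique, rule fundamental_theorem_of_calculus[OF ab(2) has_vector_derivative_at_within[OF p[OF _ \<phi>]]])
         (use ab in auto)
    have "((\<lambda>\<phi>. p b \<phi> - p a \<phi>) has_integral (integral {a..b} (\<lambda>t. q t \<phi>2 /\<^sub>R t) - integral {a..b} (\<lambda>t. q t \<phi>1 /\<^sub>R t))) {\<phi>1..\<phi>2}"
      using der pint \<phi> by (intro fundamental_theorem_of_calculus) auto
    then have "norm (integral {a..b} (\<lambda>t. q t \<phi>2 /\<^sub>R t) - integral {a..b} (\<lambda>t. q t \<phi>1 /\<^sub>R t)) \<le> (m a + m b) * measure lborel (cbox \<phi>1 \<phi>2)"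
      unfolding cbox_interval[symmetric, of \<phi>1 \<phi>2]
    proof (rule has_integral_bound[rotated])
      show "0 \<le> m a + m b"
        using ab \<phi> by (intro add_nonneg_nonneg order.trans[OF norm_ge_zero m(1)]) auto
      show "norm (p b x - p a x) \<le> m a + m b" if "x \<in> cbox \<phi>1 \<phi>2" for x
        using norm_triangle_ineq4[of "p b x" "p a x"] m(1)[of a x] m(1)[of b x] that ab by auto
    qed
    then show ?thesis using \<phi> by simp
  qed
  have "(\<lambda>n. (m (1 / real (Suc n)) + m (real (Suc n))) * (\<phi>2 - \<phi>1)) \<longlonglongrightarrow> (0 + 0) * (\<phi>2 - \<phi>1)"
    by (intro tendsto_intros filterlim_compose[OF m(2)] filterlim_compose[OF m(3)]) real_asymp+
  moreover have "(\<lambda>n. norm (integral {1 / real (Suc n)..real (Suc n)} (\<lambda>t. q t \<phi>2 /\<^sub>R t)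
        - integral {1 / real (Suc n)..real (Suc n)} (\<lambda>t. q t \<phi>1 /\<^sub>R t))) \<longlonglongrightarrow> norm (I \<phi>2 - I \<phi>1)"
    using \<phi> by (intro tendsto_intros lim) auto
  ultimately have "norm (I \<phi>2 - I \<phi>1) \<le> (0 + 0) * (\<phi>2 - \<phi>1)"
    by (rule tendsto_le[OF sequentially_bot])
       (intro always_eventually allI bound, auto simp: field_simps)
  then have "norm (I \<phi>2 - I \<phi>1) \<le> 0" by simp
  then have "I \<phi>2 - I \<phi>1 = 0"
    by (simp only: norm_le_zero_iff)
  then have "I \<phi>1 = I \<phi>2"
    by (simp only: right_minus_eq)
  then show ?thesis
    .
qed

text \<open>In the application \<open>X1\<close> and \<open>X2\<close> depend on the imaginary unit
  and only their sum does not. Absolute convergence is therefore read off from the two rays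
  separately, the value from \<open>E\<close> alone.\<close>

lemma integral_punctured_line:
  fixes k E X1 X2 :: "real \<Rightarrow> 'b::banach"
  assumes k: "\<And>t. t > 0 \<Longrightarrow> k t = X1 t" "\<And>t. t > 0 \<Longrightarrow> k (- t) = X2 t"
    and X: "continuous_on {0<..} X1" "continuous_on {0<..} X2" and a: "a > 0"
    and le: "\<And>t. t > 0 \<Longrightarrow> norm (X1 t) \<le> K * (t powr (a - 1) / (1 + t powr (1 + 2 * a)))"
      "\<And>t. t > 0 \<Longrightarrow> norm (X2 t) \<le> K * (t powr (a - 1) / (1 + t powr (1 + 2 * a)))"
    and E: "\<And>t. t > 0 \<Longrightarrow> X1 t + X2 t = - 2 *\<^sub>R E t"
  shows "k integrable_on - {0}" "(\<lambda>t. norm (k t)) integrable_on - {0}"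
    and "integral (- {0}) k = - 2 *\<^sub>R integral {0<..} E"
    and "(\<lambda>n. integral {1 / real (Suc n)..real (Suc n)} E) \<longlonglongrightarrow> integral {0<..} E"
proof -
  note d1 = powr_dominated_has_integral_greaterThan[OF X(1) a le(1)]
  note d2 = powr_dominated_has_integral_greaterThan[OF X(2) a le(2)]
  have k1: "(k has_integral integral {0<..} X1) {0<..}"
    by (rule has_integral_eq[OF _ integrable_integral[OF d1(1)]]) (simp add: k)
  have k2: "((\<lambda>t. k (- t)) has_integral integral {0<..} X2) {0<..}"
    by (rule has_integral_eq[OF _ integrable_integral[OF d2(1)]]) (simp add: k)
  note I = has_integral_punctured_line[OF k1 k2]
  show "k integrable_on - {0}" using I by blast
  have n1: "((\<lambda>t. norm (k t)) has_integral integral {0<..} (\<lambda>t. norm (X1 t))) {0<..}"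
    by (rule has_integral_eq[OF _ integrable_integral[OF d1(2)]]) (simp add: k)
  have n2: "((\<lambda>t. norm (k (- t))) has_integral integral {0<..} (\<lambda>t. norm (X2 t))) {0<..}"
    by (rule has_integral_eq[OF _ integrable_integral[OF d2(2)]]) (simp add: k)
  show "(\<lambda>t. norm (k t)) integrable_on - {0}"
    using has_integral_punctured_line[OF n1 n2] by blast
  have E': "E t = - (1 / 2) *\<^sub>R (X1 t + X2 t)" if "t > 0" for t
    using E[OF that] by simp
  have "integral {0<..} E = integral {0<..} (\<lambda>t. - (1 / 2) *\<^sub>R (X1 t + X2 t))"
    by (rule Henstock_Kurzweil_Integration.integral_cong) (simp add: E')
  also have "\<dots> = - (1 / 2) *\<^sub>R (integral {0<..} X1 + integral {0<..} X2)"
    by (simp add: Henstock_Kurzweil_Integration.integral_add d1 d2)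
  finally show "integral (- {0}) k = - 2 *\<^sub>R integral {0<..} E"
    using integral_unique[OF I] by simp
  show "(\<lambda>n. integral {1 / real (Suc n)..real (Suc n)} E) \<longlonglongrightarrow> integral {0<..} E"
  proof (rule powr_dominated_has_integral_greaterThan(3)[OF _ a])
    have "continuous_on {0<..} (\<lambda>t. - (1 / 2) *\<^sub>R (X1 t + X2 t))"
      by (intro continuous_intros X)
    then show "continuous_on {0<..} E"
      by (rule continuous_on_eq) (simp add: E')
    fix t :: real assume t: "t > 0"
    have "norm (E t) = norm (X1 t + X2 t) / 2" by (simp add: E'[OF t])
    also have "\<dots> \<le> (norm (X1 t) + norm (X2 t)) / 2" by (intro divide_right_mono norm_triangle_ineq) simp
    also have "\<dots> \<le> K * (t powr (a - 1) / (1 + t powr (1 + 2 * a)))"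
    proof -
      have "(x + y) / 2 \<le> b" if "x \<le> b" "y \<le> b" for x y b :: real
        using that by simp
      from this[OF le(1)[OF t] le(2)[OF t]] show ?thesis .
    qed
    finally show "norm (E t) \<le> K * (t powr (a - 1) / (1 + t powr (1 + 2 * a)))" .
  qed
qed

section \<open>Quaternions and the quaternionic functional calculus\<close>

lemma sum_lessThan_4: "(\<Sum>i<4. f i) = f 0 + f 1 + f 2 + f (3::nat)"
  for f :: "nat \<Rightarrow> 'a::comm_monoid_add"
proof -
  have "{..<4} = {0, 1, 2, 3::nat}" by auto
  then show ?thesis by (simp add: add.assoc)
qed

lemma all_lessThan_4: "(\<forall>i<4. P i) \<longleftrightarrow> P 0 \<and> P 1 \<and> P 2 \<and> P (3::nat)"
proof -
  have "i < 4 \<longleftrightarrow> i = 0 \<or> i = 1 \<or> i = 2 \<or> i = 3" for i :: nat by auto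
  then show ?thesis by auto
qed

lemma of_real_quat: "of_real r = Quat r 0 0 0"
  by (simp add: of_real_def scaleR_quat_def one_quat_def)

lemma re0_add [simp]: "re0 (x + y) = re0 x + re0 y" by (simp add: plus_quat_def)
lemma re0_of_real [simp]: "re0 (of_real r) = r" by (simp add: of_real_quat)
lemma re0_of_real_mult [simp]: "re0 (of_real r * x) = r * re0 x"
  by (simp add: of_real_quat times_quat_def)
lemma re0_mult_of_real [simp]: "re0 (x * of_real r) = re0 x * r"
  by (simp add: of_real_quat times_quat_def)

lemma of_real_commute_quat: "of_real r * q = q * (of_real r :: quat)"
  by (simp add: of_real_def)

lemma qe_simps [simp]: "qe 0 = 1" "qe 1 = Quat 0 1 0 0" "qe (Suc 0) = Quat 0 1 0 0"
   "qe 2 = Quat 0 0 1 0" "qe 3 = Quat 0 0 0 1"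
  by (simp_all add: qe_def)

lemma qe_mult [simp]:
  "Quat 0 1 0 0 * Quat 0 1 0 0 = -1" "Quat 0 0 1 0 * Quat 0 0 1 0 = -1" "Quat 0 0 0 1 * Quat 0 0 0 1 = -1"
  "Quat 0 1 0 0 * Quat 0 0 1 0 = Quat 0 0 0 1" "Quat 0 0 1 0 * Quat 0 1 0 0 = - Quat 0 0 0 1"
  "Quat 0 0 1 0 * Quat 0 0 0 1 = Quat 0 1 0 0" "Quat 0 0 0 1 * Quat 0 0 1 0 = - Quat 0 1 0 0"
  "Quat 0 0 0 1 * Quat 0 1 0 0 = Quat 0 0 1 0" "Quat 0 1 0 0 * Quat 0 0 0 1 = - Quat 0 0 1 0"
  by (simp_all add: times_quat_def one_quat_def uminus_quat_def)

lemma qcnj_simps: "qcnj 1 = 1" "qcnj (Quat 0 1 0 0) = - Quat 0 1 0 0"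
  "qcnj (Quat 0 0 1 0) = - Quat 0 0 1 0" "qcnj (Quat 0 0 0 1) = - Quat 0 0 0 1"
  by (simp_all add: qcnj_def one_quat_def uminus_quat_def)

locale quat_module =
  fixes lm :: "quat \<Rightarrow> 'v::banach \<Rightarrow> 'v" and rm :: "'v \<Rightarrow> quat \<Rightarrow> 'v"
  assumes V: "two_sided_banach lm rm"
begin

lemma lm_add [simp]: "lm a (v + w) = lm a v + lm a w"
  and lm_add_left: "lm (a + b) v = lm a v + lm b v"
  and lm_lm: "lm a (lm b v) = lm (a * b) v"
  and lm_1 [simp]: "lm 1 v = v"
  and lm_of_real [simp]: "lm (of_real r) v = r *\<^sub>R v"
  and norm_lm: "norm (lm a v) = norm a * norm v"
  using V unfolding two_sided_banach_def by metis+

lemma lm_scaleR_left [simp]: "lm (r *\<^sub>R a) v = r *\<^sub>R lm a v"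
  by (metis lm_lm lm_of_real scaleR_conv_of_real)

lemma lm_scaleR [simp]: "lm a (r *\<^sub>R v) = r *\<^sub>R lm a v"
  by (metis lm_lm lm_of_real of_real_commute_quat)

lemma bounded_linear_lm: "bounded_linear (lm a)"
  by (rule bounded_linear_intro[where K = "norm a"]) (auto simp: norm_lm)

lemma bounded_bilinear_lm: "bounded_bilinear lm"
  by (rule bounded_bilinear.intro) (auto simp: norm_lm lm_add_left intro!: exI[of _ 1])

lemmas lm_diff [simp] = bounded_bilinear.diff_right[OF bounded_bilinear_lm]
  and lm_minus [simp] = bounded_bilinear.minus_right[OF bounded_bilinear_lm]
  and lm_0 [simp] = bounded_bilinear.zero_right[OF bounded_bilinear_lm]
  and lm_diff_left = bounded_bilinear.diff_left[OF bounded_bilinear_lm]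
  and lm_minus_left [simp] = bounded_bilinear.minus_left[OF bounded_bilinear_lm]
  and lm_0_left [simp] = bounded_bilinear.zero_left[OF bounded_bilinear_lm]

end

section \<open>Imaginary units and the geometry of sectors\<close>

lemma re0_qexpJ: "J \<in> unitS \<Longrightarrow> re0 (qexpJ J x) = cos x"
  by (simp add: qexpJ_def unitS_def)

lemma unitS_iff: "J \<in> unitS \<longleftrightarrow> re0 J = 0 \<and> (im1 J)\<^sup>2 + (im2 J)\<^sup>2 + (im3 J)\<^sup>2 = 1"
  by (auto simp: unitS_def norm_quat_def)

lemma norm_unitS: "J \<in> unitS \<Longrightarrow> norm J = 1"
  by (simp add: unitS_def)

lemma unitS_square: "J \<in> unitS \<Longrightarrow> J * J = -1"
  by (auto simp: unitS_iff times_quat_def one_quat_def uminus_quat_def power2_eq_square intro!: quat_eqI)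

lemma norm_complex_unitS: "J \<in> unitS \<Longrightarrow> norm (of_real u + J * of_real v) = sqrt (u\<^sup>2 + v\<^sup>2)"
  unfolding norm_quat_def unitS_iff
  by (rule arg_cong[where f = sqrt])
    (simp add: of_real_quat plus_quat_def times_quat_def power_mult_distrib flip: distrib_right)

lemma norm_qexpJ: "J \<in> unitS \<Longrightarrow> norm (qexpJ J x) = 1"
  by (simp add: qexpJ_def norm_complex_unitS)

text \<open>Since cos decreases on [0, pi], a bound on the argument becomes an inequality for
  \<open>re0 s\<close>. Its weak form is a closed condition and survives passage to the closure, and
  its negation serves as the criterion for lying outside the sector.\<close>

lemma sector_re0:
  assumes "s \<in> sector \<phi>" "\<phi> \<le> pi"
  shows "re0 s > norm s * cos \<phi>"
proof -
  obtain r J x where s: "r > 0" "J \<in> unitS" "\<bar>x\<bar> < \<phi>" "s = of_real r * qexpJ J x"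
    using assms(1) unfolding sector_def by auto
  have "cos \<phi> < cos \<bar>x\<bar>"
    using s assms by (intro cos_monotone_0_pi) auto
  with s show ?thesis by (simp add: re0_qexpJ norm_mult norm_qexpJ)
qed

lemma bounded_linear_re0: "bounded_linear re0"
proof -
  have "re0 = (\<lambda>x. x \<bullet> 1)" by (auto simp: inner_quat_def one_quat_def)
  show ?thesis unfolding \<open>re0 = _\<close> by (rule bounded_linear_inner_left)
qed

lemma closure_sector_re0:
  assumes "\<phi> \<le> pi" "s \<in> closure (sector \<phi>)"
  shows "re0 s \<ge> norm s * cos \<phi>"
proof -
  have "closed {s. norm s * cos \<phi> \<le> re0 s}"
    by (intro closed_Collect_le continuous_intros bounded_linear.continuous_on[OF bounded_linear_re0])
  moreover have "sector \<phi> \<subseteq> {s. norm s * cos \<phi> \<le> re0 s}"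
    using sector_re0[OF _ assms(1)] by (auto intro: less_imp_le)
  ultimately show ?thesis using closure_minimal assms(2) by blast
qed

section \<open>Commutation and resolvent bounds\<close>

locale quat_operator = quat_module lm rm
  for lm :: "quat \<Rightarrow> 'v::banach \<Rightarrow> 'v" and rm :: "'v \<Rightarrow> quat \<Rightarrow> 'v" +
  fixes D :: "'v set" and Tc :: "nat \<Rightarrow> 'v \<Rightarrow> 'v"
  assumes KC: "KC lm rm D Tc"
begin

abbreviation "D2 \<equiv> dom2 lm D Tc"
abbreviation "Q \<equiv> Qcs lm Tc"
abbreviation "R \<equiv> Qinv lm D Tc"

lemma D_0: "0 \<in> D" and D_add: "v \<in> D \<Longrightarrow> w \<in> D \<Longrightarrow> v + w \<in> D" and D_lm: "v \<in> D \<Longrightarrow> lm a v \<in> D"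
  using KC unfolding KC_def two_sided_subspace_def by blast+

lemma D_minus: "v \<in> D \<Longrightarrow> - v \<in> D"
  using D_lm[of v "-1"] by simp

lemma D_diff: "v \<in> D \<Longrightarrow> w \<in> D \<Longrightarrow> v - w \<in> D"
  using D_add[OF _ D_minus, of v w] by simp

lemma D_scaleR: "v \<in> D \<Longrightarrow> r *\<^sub>R v \<in> D"
  using D_lm[of v "of_real r"] by simp

lemmas D_intros = D_0 D_add D_minus D_diff D_lm D_scaleR

lemma T_add: "i < 4 \<Longrightarrow> v \<in> D \<Longrightarrow> w \<in> D \<Longrightarrow> Tc i (v + w) = Tc i v + Tc i w"
  and T_lm: "i < 4 \<Longrightarrow> v \<in> D \<Longrightarrow> Tc i (lm a v) = lm a (Tc i v)"
  using KC unfolding KC_def two_sided_linear_def by blast+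

lemma T_minus: "i < 4 \<Longrightarrow> v \<in> D \<Longrightarrow> Tc i (- v) = - Tc i v"
  using T_lm[of i v "-1"] by simp

lemma T_diff: "i < 4 \<Longrightarrow> v \<in> D \<Longrightarrow> w \<in> D \<Longrightarrow> Tc i (v - w) = Tc i v - Tc i w"
  using T_add[of i v "-w"] T_minus[of i w] D_minus[of w] by simp

lemma T_scaleR: "i < 4 \<Longrightarrow> v \<in> D \<Longrightarrow> Tc i (r *\<^sub>R v) = r *\<^sub>R Tc i v"
  using T_lm[of i v "of_real r"] by simp

lemma T_0: "i < 4 \<Longrightarrow> Tc i 0 = 0"
  using T_scaleR[of i 0 0] D_0 by simp

lemmas T_simps = T_add T_minus T_diff T_lm T_scaleR T_0

lemma D2_D: "v \<in> D2 \<Longrightarrow> v \<in> D"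
  by (simp add: dom2_def)

lemma T_D2: "i < 4 \<Longrightarrow> v \<in> D2 \<Longrightarrow> Tc i v \<in> D"
  using KC unfolding KC_def by blast

lemma T_commute: "i < 4 \<Longrightarrow> j < 4 \<Longrightarrow> v \<in> D2 \<Longrightarrow> Tc i (Tc j v) = Tc j (Tc i v)"
  using KC unfolding KC_def by blast

text \<open>\<open>D2\<close> is defined through the single vector T v. The componentwise form makes
  its linearity, and its inclusion in the corresponding domain for the conjugate operator, simple
  checks.\<close>

lemma D2_iff: "v \<in> D2 \<longleftrightarrow> v \<in> D \<and> (\<forall>i<4. Tc i v \<in> D)"
proof
  assume "v \<in> D \<and> (\<forall>i<4. Tc i v \<in> D)"
  then show "v \<in> D2"
    by (auto simp: dom2_def opT_def all_lessThan_4 sum_lessThan_4 intro!: D_intros)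
qed (auto simp: T_D2 D2_D)

lemma D2_intros: "v \<in> D2 \<Longrightarrow> w \<in> D2 \<Longrightarrow> v + w \<in> D2" "v \<in> D2 \<Longrightarrow> w \<in> D2 \<Longrightarrow> v - w \<in> D2"
   "v \<in> D2 \<Longrightarrow> lm a v \<in> D2" "v \<in> D2 \<Longrightarrow> r *\<^sub>R v \<in> D2" "v \<in> D2 \<Longrightarrow> - v \<in> D2" "0 \<in> D2"
  by (auto simp: D2_iff T_simps intro!: D_intros)

lemma T_T_simps:
  assumes "i < 4" "j < 4"
  shows "v \<in> D2 \<Longrightarrow> w \<in> D2 \<Longrightarrow> Tc i (Tc j (v + w)) = Tc i (Tc j v) + Tc i (Tc j w)"
    "v \<in> D2 \<Longrightarrow> Tc i (Tc j (lm a v)) = lm a (Tc i (Tc j v))"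
  using assms by (auto simp: T_simps D2_D T_D2)

lemma Q_eq: "Q s v = lm (s\<^sup>2) v - 2 *\<^sub>R lm s (Tc 0 v) + (\<Sum>i<4. Tc i (Tc i v))"
  by (simp add: Qcs_def mult_2 lm_add_left scaleR_2)

lemma Q_add: "v \<in> D2 \<Longrightarrow> w \<in> D2 \<Longrightarrow> Q s (v + w) = Q s v + Q s w"
  by (simp add: Q_eq sum_lessThan_4 T_T_simps T_simps D2_D T_D2 algebra_simps)

text \<open>The components commute with left multiplication, so \<open>s\<close> is the only
  ingredient of \<open>Q s\<close> that fails to be central; intertwining s with s' by e intertwines
  the operators. This is the source of the slice structure of the pseudo-resolvent.\<close>

lemma Q_lm_conj:
  assumes "v \<in> D2" "e * s = s' * e"
  shows "lm e (Q s v) = Q s' (lm e v)"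
proof -
  have "e * s\<^sup>2 = s'\<^sup>2 * e"
    by (metis assms(2) mult.assoc power2_eq_square)
  then show ?thesis
    using assms by (simp add: Q_eq sum_lessThan_4 T_T_simps T_simps D2_D T_D2 lm_lm)
qed

lemma Q_inj: "s \<in> rhoS lm D Tc \<Longrightarrow> v \<in> D2 \<Longrightarrow> w \<in> D2 \<Longrightarrow> Q s v = Q s w \<Longrightarrow> v = w"
  by (auto simp: rhoS_def bij_betw_def inj_on_def)

lemma R_D2: "s \<in> rhoS lm D Tc \<Longrightarrow> R s v \<in> D2"
  unfolding Qinv_def by (rule inv_into_into) (auto simp: rhoS_def bij_betw_def)

lemma Q_R: "s \<in> rhoS lm D Tc \<Longrightarrow> Q s (R s v) = v"
  unfolding Qinv_def by (rule f_inv_into_f) (auto simp: rhoS_def bij_betw_def)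

lemma R_eqI: "s \<in> rhoS lm D Tc \<Longrightarrow> w \<in> D2 \<Longrightarrow> Q s w = v \<Longrightarrow> R s v = w"
  using Q_inj[OF _ R_D2 _ Q_R] by blast

lemma R_Q: "s \<in> rhoS lm D Tc \<Longrightarrow> v \<in> D2 \<Longrightarrow> R s (Q s v) = v"
  by (rule R_eqI) auto

lemma R_add: "s \<in> rhoS lm D Tc \<Longrightarrow> R s (v + w) = R s v + R s w"
  by (rule R_eqI) (auto simp: R_D2 D2_intros Q_add Q_R)

lemma R_lm_conj:
  assumes "s \<in> rhoS lm D Tc" "s' \<in> rhoS lm D Tc" "e * s = s' * e"
  shows "lm e (R s v) = R s' (lm e v)"
  by (rule R_eqI[symmetric]) (use assms in \<open>auto simp: R_D2 D2_intros Q_R simp flip: Q_lm_conj\<close>)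

lemma R_lm: "s \<in> rhoS lm D Tc \<Longrightarrow> e * s = s * e \<Longrightarrow> R s (lm e v) = lm e (R s v)"
  using R_lm_conj by metis

lemma R_scaleR: "s \<in> rhoS lm D Tc \<Longrightarrow> R s (r *\<^sub>R v) = r *\<^sub>R R s v"
  using R_lm[of s "of_real r" v] by (simp add: of_real_commute_quat)

lemma R_minus: "s \<in> rhoS lm D Tc \<Longrightarrow> R s (- v) = - R s v"
  using R_scaleR[of s "-1" v] by simp

lemma R_diff: "s \<in> rhoS lm D Tc \<Longrightarrow> R s (v - w) = R s v - R s w"
  using R_add[of s v "-w"] by (simp add: R_minus)

lemma R_0: "s \<in> rhoS lm D Tc \<Longrightarrow> R s 0 = 0"
  using R_scaleR[of s 0 0] by simp

lemmas R_simps = R_add R_minus R_diff R_scaleR R_0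

lemma opT_eq: "opT lm Tc v = Tc 0 v + lm (qe 1) (Tc 1 v) + lm (qe 2) (Tc 2 v) + lm (qe 3) (Tc 3 v)"
  by (simp add: opT_def sum_lessThan_4)

lemma opT_conjT_eq:
  "opT lm (conjT Tc) v = Tc 0 v - lm (qe 1) (Tc 1 v) - lm (qe 2) (Tc 2 v) - lm (qe 3) (Tc 3 v)"
  by (simp add: opT_def sum_lessThan_4 conjT_def)

lemma Qcs_conjT: "v \<in> D2 \<Longrightarrow> Qcs lm (conjT Tc) s v = Q s v"
  by (simp add: Qcs_def sum_lessThan_4 conjT_def T_minus T_D2)

lemma D2_subset_conjT: "D2 \<subseteq> dom2 lm D (conjT Tc)"
  by (auto simp: dom2_def[of _ _ "conjT Tc"] opT_conjT_eq D2_iff intro!: D_intros)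

text \<open>An injective map that extends a surjective one has the same domain: \<open>Q s\<close>
  already maps \<open>D2\<close> onto the space, and its extension belonging to the conjugate
  operator is injective.\<close>

lemma dom2_conjT:
  assumes "s \<in> rhoS lm D Tc" "s \<in> rhoS lm D (conjT Tc)"
  shows "dom2 lm D (conjT Tc) = D2"
proof -
  have "v \<in> D2" if "v \<in> dom2 lm D (conjT Tc)" for v
  proof -
    let ?w = "R s (Qcs lm (conjT Tc) s v)"
    have "?w \<in> D2" "Qcs lm (conjT Tc) s ?w = Qcs lm (conjT Tc) s v"
      using assms by (auto simp: R_D2 Qcs_conjT Q_R)
    then have "?w = v"
      using assms(2) that D2_subset_conjT
      by (auto simp: rhoS_def bij_betw_def dest!: inj_onD)
    with \<open>?w \<in> D2\<close> show ?thesis by simp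
  qed
  with D2_subset_conjT show ?thesis by auto
qed

lemma Qinv_conjT:
  assumes "s \<in> rhoS lm D Tc" "s \<in> rhoS lm D (conjT Tc)"
  shows "Qinv lm D (conjT Tc) s v = R s v"
  unfolding Qinv_def[of _ _ "conjT Tc"]
  by (rule inv_into_f_eq)
     (use assms in \<open>auto simp: rhoS_def[of _ _ "conjT Tc"] bij_betw_def dom2_conjT[OF assms] R_D2 Qcs_conjT Q_R\<close>)

text \<open>For real \<open>s\<close> the operator \<open>Q\<close> factors as \<open>(s - T)(s - conj T) = (s - conj T)(s - T)\<close>.\<close>

lemma Q_factor:
  fixes r :: real
  assumes "v \<in> D2"
  shows "(let w = r *\<^sub>R v - opT lm (conjT Tc) v in r *\<^sub>R w - opT lm Tc w) = Q (of_real r) v"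
    and "(let w = r *\<^sub>R v - opT lm Tc v in r *\<^sub>R w - opT lm (conjT Tc) w) = Q (of_real r) v"
proof -
  have TT: "Tc 0 v \<in> D" "Tc 1 v \<in> D" "Tc 2 v \<in> D" "Tc 3 v \<in> D" "v \<in> D" "Tc (Suc 0) v \<in> D"
    using assms T_D2[of _ v] D2_D by auto
  have c: "Tc 1 (Tc 0 v) = Tc 0 (Tc 1 v)" "Tc 2 (Tc 0 v) = Tc 0 (Tc 2 v)" "Tc 3 (Tc 0 v) = Tc 0 (Tc 3 v)"
     "Tc 2 (Tc 1 v) = Tc 1 (Tc 2 v)" "Tc 3 (Tc 1 v) = Tc 1 (Tc 3 v)" "Tc 3 (Tc 2 v) = Tc 2 (Tc 3 v)"
    using assms by (auto intro!: T_commute)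
  have r2: "lm ((of_real r)\<^sup>2) v = (r * r) *\<^sub>R v"
    by (metis lm_of_real of_real_mult power2_eq_square)
  show "(let w = r *\<^sub>R v - opT lm (conjT Tc) v in r *\<^sub>R w - opT lm Tc w) = Q (of_real r) v"
    "(let w = r *\<^sub>R v - opT lm Tc v in r *\<^sub>R w - opT lm (conjT Tc) w) = Q (of_real r) v"
    using c unfolding Let_def Q_eq r2 opT_eq opT_conjT_eq
    by (simp_all add: sum_lessThan_4 T_simps TT D_intros lm_lm algebra_simps scaleR_2 flip: scaleR_add_left)
qed

end

section \<open>Commutation of the pseudo-resolvent with the components\<close>

context quat_operator
begin

lemma conjT_simps: "conjT Tc 0 = Tc 0" "i \<noteq> 0 \<Longrightarrow> conjT Tc i v = - Tc i v"
  by (simp_all add: conjT_def)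

lemma opT_conjT_conjT: "opT lm (conjT (conjT Tc)) v = opT lm Tc v"
  by (simp add: opT_def conjT_def sum_lessThan_4)

lemma opT_diff:
  assumes "v \<in> D" "w \<in> D"
  shows "opT lm Tc (v - w) = opT lm Tc v - opT lm Tc w"
    and "opT lm (conjT Tc) (v - w) = opT lm (conjT Tc) v - opT lm (conjT Tc) w"
  using assms by (simp_all add: opT_eq opT_conjT_eq T_simps)

lemma opT_0: "opT lm Tc 0 = 0" "opT lm (conjT Tc) 0 = 0"
  by (simp_all add: opT_eq opT_conjT_eq T_0)

lemma opT_D2: "v \<in> D2 \<Longrightarrow> opT lm Tc v \<in> D" "v \<in> D2 \<Longrightarrow> opT lm (conjT Tc) v \<in> D"
  using D2_subset_conjT by (auto simp: dom2_def)

text \<open>T is commuted as a whole. Put S = R r, u = S (r w - T w) and w' = (r - conj T) u. Then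
  (r - T) w' = (r - T) w, and injectivity of r - T gives w' = w. Now (r - conj T) takes the same
  value w on u and on (r - T) S w, and injectivity of r - conj T gives (r - T) S w = u, which is the
  commutation.\<close>

lemma R_real_opT:
  fixes r :: real
  assumes s: "of_real r \<in> rhoS lm D Tc" "of_real r \<in> rhoS lm D (conjT Tc)" and w: "w \<in> D"
  shows "opT lm Tc (R (of_real r) w) = R (of_real r) (opT lm Tc w)"
proof -
  define T where "T = opT lm Tc"
  define T' where "T' = opT lm (conjT Tc)"
  define S where "S = R (of_real r)"
  have T_diff: "T (a - b) = T a - T b" "T' (a - b) = T' a - T' b" if "a \<in> D" "b \<in> D" for a b
    unfolding T_def T'_def using opT_diff that by auto
  have Q1: "r *\<^sub>R (r *\<^sub>R v - T' v) - T (r *\<^sub>R v - T' v) = Q (of_real r) v"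
    and Q2: "r *\<^sub>R (r *\<^sub>R v - T v) - T' (r *\<^sub>R v - T v) = Q (of_real r) v" if "v \<in> D2" for v
    using Q_factor[OF that, of r] unfolding Let_def T_def T'_def by auto
  have SD: "S v \<in> D2" "S v \<in> D" for v
    unfolding S_def using R_D2 s D2_D by auto
  have SQ: "Q (of_real r) (S v) = v" for v
    unfolding S_def using Q_R s by auto
  have zero: "p = 0" if "p \<in> D2" "Q (of_real r) p = 0" for p
    using R_eqI[OF s(1) that] R_0[OF s(1)] by simp
  \<comment> \<open>If T p = r p with p in the domain, then T p lies in the domain again, so p is in
    \<open>D2\<close> and the factorisation shows that \<open>Q\<close> kills it.\<close>
  have inj: "p = 0" if "p \<in> D" "r *\<^sub>R p - T p = 0" for p
  proof (rule zero)
    have "T p = r *\<^sub>R p" using that by simp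
    then show p: "p \<in> D2" using that by (auto simp: dom2_def T_def intro: D_scaleR)
    from Q2[OF p] that show "Q (of_real r) p = 0" by (simp add: T'_def opT_0)
  qed
  \<comment> \<open>The same argument puts p into the squared domain of the conjugate operator; that
    this domain equals \<open>D2\<close> uses that the point is in the resolvent sets of both
    operators.\<close>
  have inj': "p = 0" if "p \<in> D" "r *\<^sub>R p - T' p = 0" for p
  proof (rule zero)
    have "T' p = r *\<^sub>R p" using that by simp
    then show p: "p \<in> D2" unfolding dom2_conjT[OF s, symmetric] using that
      by (auto simp: dom2_def T'_def intro: D_scaleR)
    from Q1[OF p] that show "Q (of_real r) p = 0" by (simp add: T_def opT_0)
  qed
  define u where "u = S (r *\<^sub>R w - T w)"
  define w' where "w' = r *\<^sub>R u - T' u"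
  have xD: "r *\<^sub>R S w - T (S w) \<in> D"
    by (auto simp: T_def intro!: D_intros opT_D2 SD)
  have uD: "u \<in> D2" "u \<in> D" unfolding u_def by (auto intro!: SD)
  have w'D: "w' \<in> D" unfolding w'_def T'_def using uD by (auto intro!: D_intros opT_D2)
  have "r *\<^sub>R w' - T w' = r *\<^sub>R w - T w"
    unfolding w'_def Q1[OF uD(1)] by (simp add: u_def SQ)
  then have "r *\<^sub>R (w - w') - T (w - w') = 0"
    using w w'D by (simp add: T_diff algebra_simps)
  then have ww: "w - w' = 0" by (rule inj[rotated]) (use w w'D in \<open>auto intro: D_intros\<close>)
  define p where "p = (r *\<^sub>R S w - T (S w)) - u"
  have "r *\<^sub>R p - T' p = (r *\<^sub>R (r *\<^sub>R S w - T (S w)) - T' (r *\<^sub>R S w - T (S w))) - w'"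
    unfolding p_def T_diff(2)[OF xD uD(2)] w'_def scaleR_diff_right by simp
  also have "\<dots> = 0"
    unfolding Q2[OF SD(1)] SQ by (rule ww)
  finally have "p = 0"
    by (rule inj'[rotated]) (use xD uD in \<open>auto simp: p_def intro: D_intros\<close>)
  then have "T (S w) = r *\<^sub>R S w - u" by (simp add: p_def algebra_simps)
  then show ?thesis
    unfolding u_def T_def S_def using s by (simp add: R_simps)
qed

text \<open>At a real point R commutes with all quaternions, so the commutator of R with T may be
  conjugated by e1, e2 and e3. Each conjugation keeps the sign of one imaginary component and flips
  the other two; the four resulting sign patterns separate the commutators
  \<open>z i\<close>.\<close>

lemma R_real_T:
  fixes r :: real
  assumes s: "of_real r \<in> rhoS lm D Tc" "of_real r \<in> rhoS lm D (conjT Tc)" and w: "w \<in> D" and i: "i < 4"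
  shows "Tc i (R (of_real r) w) = R (of_real r) (Tc i w)"
proof -
  define S where "S = R (of_real r)"
  have S_lm: "S (lm e v) = lm e (S v)" for e v
    unfolding S_def by (rule R_lm[OF s(1)]) (simp add: of_real_commute_quat)
  have S_add: "S (v + w) = S v + S w" for v w
    unfolding S_def by (rule R_add[OF s(1)])
  have SD: "S v \<in> D" for v unfolding S_def by (rule D2_D[OF R_D2[OF s(1)]])
  define z where "z i = Tc i (S w) - S (Tc i w)" for i
  have *: "lm e (z 0) + lm (qe 1 * e) (z 1) + lm (qe 2 * e) (z 2) + lm (qe 3 * e) (z 3) = 0" for e
  proof -
    have "opT lm Tc (S (lm e w)) = S (opT lm Tc (lm e w))"
      unfolding S_def by (rule R_real_opT[OF s]) (rule D_lm[OF w])
    then show ?thesis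
      using w SD by (simp add: opT_eq z_def S_lm S_add T_lm lm_lm algebra_simps)
  qed
  have e: "z 0 + lm (qe 1) (z 1) + lm (qe 2) (z 2) + lm (qe 3) (z 3) = 0"
     "z 0 + lm (qe 1) (z 1) - lm (qe 2) (z 2) - lm (qe 3) (z 3) = 0"
     "z 0 - lm (qe 1) (z 1) + lm (qe 2) (z 2) - lm (qe 3) (z 3) = 0"
     "z 0 - lm (qe 1) (z 1) - lm (qe 2) (z 2) + lm (qe 3) (z 3) = 0"
    using *[of 1] arg_cong[OF *[of "qe 1"], of "lm (- qe 1)"] arg_cong[OF *[of "qe 2"], of "lm (- qe 2)"]
      arg_cong[OF *[of "qe 3"], of "lm (- qe 3)"]
    by (simp_all add: lm_lm)
  have "4 *\<^sub>R z 0 = (z 0 + lm (qe 1) (z 1) + lm (qe 2) (z 2) + lm (qe 3) (z 3))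
     + (z 0 + lm (qe 1) (z 1) - lm (qe 2) (z 2) - lm (qe 3) (z 3))
     + (z 0 - lm (qe 1) (z 1) + lm (qe 2) (z 2) - lm (qe 3) (z 3))
     + (z 0 - lm (qe 1) (z 1) - lm (qe 2) (z 2) + lm (qe 3) (z 3))"
    by (simp add: scaleR_left.add[of 2 2, simplified] scaleR_2)
  then have z0: "z 0 = 0" unfolding e by simp
  have "2 *\<^sub>R lm (qe 1) (z 1) = (z 0 + lm (qe 1) (z 1) + lm (qe 2) (z 2) + lm (qe 3) (z 3))
     + (z 0 + lm (qe 1) (z 1) - lm (qe 2) (z 2) - lm (qe 3) (z 3))"
    "2 *\<^sub>R lm (qe 2) (z 2) = (z 0 + lm (qe 1) (z 1) + lm (qe 2) (z 2) + lm (qe 3) (z 3))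
     + (z 0 - lm (qe 1) (z 1) + lm (qe 2) (z 2) - lm (qe 3) (z 3))"
    "2 *\<^sub>R lm (qe 3) (z 3) = (z 0 + lm (qe 1) (z 1) + lm (qe 2) (z 2) + lm (qe 3) (z 3))
     + (z 0 - lm (qe 1) (z 1) - lm (qe 2) (z 2) + lm (qe 3) (z 3))"
    by (simp_all add: scaleR_2 z0)
  then have "lm (qe 1) (z 1) = 0" "lm (qe 2) (z 2) = 0" "lm (qe 3) (z 3) = 0"
    unfolding e by simp_all
  from this[THEN arg_cong, of norm] have "z 1 = 0" "z 2 = 0" "z 3 = 0"
    by (simp_all add: norm_lm norm_quat_def)
  then have "z i = 0" using z0 i by (auto simp: eval_nat_numeral less_Suc_eq)
  then show ?thesis by (simp add: z_def S_def)
qed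

text \<open>The commutation passes from \<open>- 1\<close> to an arbitrary point of the resolvent set because
  \<open>Q s\<close> composed with \<open>R (- 1)\<close> is a polynomial in \<open>R (- 1)\<close> and \<open>T\<^sub>0 R (- 1)\<close>.\<close>

lemma R_T:
  assumes s0: "-1 \<in> rhoS lm D Tc" "-1 \<in> rhoS lm D (conjT Tc)"
    and s: "s \<in> rhoS lm D Tc" and w: "w \<in> D" and i: "i < 4"
  shows "Tc i (R s w) = R s (Tc i w)"
proof -
  define S where "S = R (-1)"
  have ST: "Tc j (S v) = S (Tc j v)" if "v \<in> D" "j < 4" for v j
    unfolding S_def using R_real_T[of "-1" v j] s0 that by simp
  have SD: "S v \<in> D2" "S v \<in> D" for v
    unfolding S_def by (auto simp: R_D2[OF s0(1)] D2_D)
  have S_lm: "S (lm e v) = lm e (S v)" for e v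
    unfolding S_def by (rule R_lm[OF s0(1)]) simp
  have S_lin: "S (v + w) = S v + S w" "S (v - w) = S v - S w" "S (c *\<^sub>R v) = c *\<^sub>R S v" for v w c
    unfolding S_def using s0 by (auto simp: R_simps)
  have S_inj: "v = w" if "S v = S w" for v w
    using that Q_R[OF s0(1)] unfolding S_def by metis
  have SQ: "S (Q s v) = Q s (S v)" if "v \<in> D2" for v
    using that by (simp add: Q_eq sum_lessThan_4 S_lin S_lm ST T_D2 D2_D)
  have SR: "R s (S v) = S (R s v)" for v
    by (rule R_eqI[OF s SD(1)]) (simp add: Q_R[OF s] R_D2[OF s] flip: SQ)
  \<comment> \<open>The equation Q (-1) (S v) = v eliminates the sum of the squares of the
    components, so only first-order terms in S v remain.\<close>
  have QS: "Q s (S v) = v + lm (s\<^sup>2 - 1) (S v) - 2 *\<^sub>R lm (s + 1) (Tc 0 (S v))" for v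
  proof -
    have "Q (-1) (S v) = v" unfolding S_def by (rule Q_R[OF s0(1)])
    then have "(\<Sum>i<4. Tc i (Tc i (S v))) = v - S v - 2 *\<^sub>R Tc 0 (S v)"
      by (simp add: Q_eq algebra_simps)
    then show ?thesis by (simp add: Q_eq lm_diff_left lm_add_left algebra_simps)
  qed
  \<comment> \<open>\<open>Tc i z\<close> is known to lie in \<open>D\<close> only, but S maps it
    into \<open>D2\<close>, where \<open>Q s\<close> may be applied. Injectivity of S removes this
    smoothing at the end.\<close>
  define z where "z = R s w"
  have zD: "z \<in> D2" "z \<in> D" by (auto simp: z_def R_D2[OF s] D2_D)
  have "Q s (S (Tc i z)) = Tc i z + lm (s\<^sup>2 - 1) (S (Tc i z)) - 2 *\<^sub>R lm (s + 1) (Tc 0 (S (Tc i z)))"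
    by (rule QS)
  also have "\<dots> = Tc i (z + lm (s\<^sup>2 - 1) (S z) - 2 *\<^sub>R lm (s + 1) (Tc 0 (S z)))"
    using zD i SD
    by (simp add: T_simps D_intros T_D2 T_commute[OF i _ SD(1), of 0] flip: ST)
  also have "\<dots> = Tc i (Q s (S z))" by (simp add: QS)
  also have "\<dots> = Tc i (S w)" by (simp add: z_def Q_R[OF s] R_D2[OF s] flip: SQ)
  also have "\<dots> = S (Tc i w)" by (rule ST[OF w i])
  finally have "R s (S (Tc i w)) = S (Tc i z)" by (rule R_eqI[OF s SD(1)])
  then have "S (R s (Tc i w)) = S (Tc i z)" by (simp add: SR)
  then show ?thesis using S_inj unfolding z_def by metis
qed

end

section \<open>Quadratic decay of the pseudo-resolvent\<close>

locale sectorial = quat_operator lm rm D Tc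
  for lm :: "quat \<Rightarrow> 'v::banach \<Rightarrow> 'v" and rm :: "'v \<Rightarrow> quat \<Rightarrow> 'v"
    and D :: "'v set" and Tc :: "nat \<Rightarrow> 'v \<Rightarrow> 'v" +
  fixes \<omega> :: real
  assumes T_type: "op_type lm D Tc \<omega>" and conjT_type: "op_type lm D (conjT Tc) \<omega>"
begin

lemma omega: "0 < \<omega>" "\<omega> < pi"
  using T_type by (auto simp: op_type_def)

lemma rho:
  assumes "re0 s < norm s * cos \<omega>"
  shows "s \<in> rhoS lm D Tc" "s \<in> rhoS lm D (conjT Tc)"
proof -
  have "s \<notin> closure (sector \<omega>)"
    using closure_sector_re0[of \<omega> s] omega assms by force
  then show "s \<in> rhoS lm D Tc" "s \<in> rhoS lm D (conjT Tc)"
    using T_type conjT_type by (auto simp: op_type_def sigmaS_def)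
qed

lemma minus_1_rho: "-1 \<in> rhoS lm D Tc" "-1 \<in> rhoS lm D (conjT Tc)"
proof -
  have "-1 < cos \<omega>" using cos_monotone_0_pi[of \<omega> pi] omega by simp
  then have "re0 (-1) < norm (-1 :: quat) * cos \<omega>" by (simp add: one_quat_def uminus_quat_def norm_quat_def)
  then show "-1 \<in> rhoS lm D Tc" "-1 \<in> rhoS lm D (conjT Tc)" using rho by auto
qed

lemma R_commute_T: "s \<in> rhoS lm D Tc \<Longrightarrow> w \<in> D \<Longrightarrow> i < 4 \<Longrightarrow> Tc i (R s w) = R s (Tc i w)"
  using R_T minus_1_rho by blast

text \<open>With \<open>B = e\<^sub>1 T\<^sub>1 + e\<^sub>2 T\<^sub>2 + e\<^sub>3 T\<^sub>3\<close> one has \<open>Q s = (s - T\<^sub>0)\<^sup>2 - B\<^sup>2\<close>. Half sums and half differences of the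
  \<open>S\<close>-resolvents of \<open>T\<close> and of its conjugate bound \<open>(s - T\<^sub>0) R s\<close>, \<open>B R s\<close> and \<open>R s B\<close> by \<open>C / norm s\<close>.\<close>

lemma resolvent_bounds:
  assumes phi: "\<omega> < \<phi>" "\<phi> < pi"
  obtains C where "C \<ge> 0"
    "\<And>s v. s \<noteq> 0 \<Longrightarrow> re0 s \<le> norm s * cos \<phi> \<Longrightarrow> norm (R s v) \<le> C / (norm s)\<^sup>2 * norm v"
    "\<And>s v. s \<noteq> 0 \<Longrightarrow> re0 s \<le> norm s * cos \<phi> \<Longrightarrow> norm (lm s (R s v) - Tc 0 (R s v)) \<le> C / norm s * norm v"
proof -
  obtain C1 where C1: "C1 \<ge> 0" "\<And>s v. s \<notin> sector \<phi> \<Longrightarrow> s \<noteq> 0 \<Longrightarrow> norm (SLinv lm D Tc s v) \<le> C1 / norm s * norm v"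
    "\<And>s v. s \<notin> sector \<phi> \<Longrightarrow> s \<noteq> 0 \<Longrightarrow> norm (SRinv lm D Tc s v) \<le> C1 / norm s * norm v"
    using T_type phi unfolding op_type_def by meson
  obtain C2 where C2: "C2 \<ge> 0" "\<And>s v. s \<notin> sector \<phi> \<Longrightarrow> s \<noteq> 0 \<Longrightarrow> norm (SLinv lm D (conjT Tc) s v) \<le> C2 / norm s * norm v"
    "\<And>s v. s \<notin> sector \<phi> \<Longrightarrow> s \<noteq> 0 \<Longrightarrow> norm (SRinv lm D (conjT Tc) s v) \<le> C2 / norm s * norm v"
    using conjT_type phi unfolding op_type_def by meson
  define C where "C = (C1 + C2) / 2"
  have C: "C \<ge> 0" using C1(1) C2(1) by (simp add: C_def)
  have half: "norm x \<le> C / n * m" if "2 *\<^sub>R x = a + b \<or> 2 *\<^sub>R x = a - b" "norm a \<le> C1 / n * m" "norm b \<le> C2 / n * m"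
    for a b x :: 'v and n m
  proof -
    have "2 * norm x = norm (2 *\<^sub>R x)" by simp
    also have "\<dots> \<le> norm a + norm b" using that(1) norm_triangle_ineq norm_triangle_ineq4 by metis
    finally have "norm x \<le> (C1 / n * m + C2 / n * m) / 2" using that(2,3) by simp
    also have "\<dots> = C / n * m" by (simp add: C_def add_divide_distrib distrib_right)
    finally show ?thesis .
  qed
  define B where "B v = lm (qe 1) (Tc 1 v) + lm (qe 2) (Tc 2 v) + lm (qe 3) (Tc 3 v)" for v
  have main: "norm (lm s (R s v) - Tc 0 (R s v)) \<le> C / norm s * norm v"
    "norm (R s v) \<le> 2 * C\<^sup>2 / (norm s)\<^sup>2 * norm v"
    if s: "s \<noteq> 0" "re0 s \<le> norm s * cos \<phi>" for s v
  proof -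
    have "cos \<phi> < cos \<omega>" using cos_monotone_0_pi[of \<omega> \<phi>] omega phi by simp
    then have "norm s * cos \<phi> < norm s * cos \<omega>" using s by simp
    then have "re0 s < norm s * cos \<omega>" using s(2) by linarith
    then have rs: "s \<in> rhoS lm D Tc" "s \<in> rhoS lm D (conjT Tc)" by (fact rho)+
    have ns: "s \<notin> sector \<phi>" using sector_re0[of s \<phi>] s phi by auto
    have RD: "R s v \<in> D2" "R s v \<in> D" for v by (auto simp: R_D2[OF rs(1)] D2_D)
    have conj: "Qinv lm D (conjT Tc) s v = R s v" for v by (rule Qinv_conjT[OF rs])
    define A' where "A' v = lm s (R s v) - Tc 0 (R s v)" for v
    have bA: "norm (A' v) \<le> C / norm s * norm v" for v
      by (rule half[OF _ C1(2)[OF ns s(1)] C2(2)[OF ns s(1)]])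
        (auto simp: A'_def SLinv_def conj opT_conjT_eq opT_conjT_conjT opT_eq scaleR_2)
    have bB: "norm (B (R s v)) \<le> C / norm s * norm v" for v
      by (rule half[OF _ C1(2)[OF ns s(1)] C2(2)[OF ns s(1)]])
        (auto simp: B_def SLinv_def conj opT_conjT_eq opT_conjT_conjT opT_eq scaleR_2)
    \<comment> \<open>\<open>R s\<close> does not commute with e1, e2, e3 in general, so R s B has
      to be distinguished from B R s. This expression equals R s B on \<open>D\<close> and is the
      form in which the right S-resolvent controls it.\<close>
    define B' where "B' v = Tc 1 (R s (lm (qe 1) v)) + Tc 2 (R s (lm (qe 2) v)) + Tc 3 (R s (lm (qe 3) v))" for v
    have bB': "norm (B' v) \<le> C / norm s * norm v" for v
      by (rule half[OF _ C1(3)[OF ns s(1)] C2(3)[OF ns s(1)]])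
        (auto simp: B'_def SRinv_def conj scaleR_2 conjT_simps sum_lessThan_4 qcnj_simps R_minus[OF rs(1)] T_minus RD)
    \<comment> \<open>This is R = R Q R with Q = (s - T_0)^2 - B^2: \<open>A'\<close> is (s - T_0) R
      s, which also equals R s (s - T_0) on \<open>D\<close>. Each of the two products contains two
      factors of size C / |s|, whence the quadratic decay.\<close>
    have "R s v = A' (A' v) - B' (B (R s v))"
    proof -
      define y where "y = R s v"
      have y: "y \<in> D2" "y \<in> D" by (auto simp: y_def RD)
      have Ty: "Tc i y \<in> D" if "i < 4" for i using T_D2[OF that y(1)] .
      define w where "w = A' v"
      have w: "w = lm s y - Tc 0 y" "w \<in> D" by (auto simp: w_def A'_def y_def[symmetric] intro!: D_intros y Ty)
      have "A' w = R s (lm s w - Tc 0 w)"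
        unfolding A'_def R_commute_T[OF rs(1) w(2), of 0, simplified] R_diff[OF rs(1)] R_lm[OF rs(1) refl] ..
      then have 1: "A' w = R s (lm s (lm s y) - 2 *\<^sub>R lm s (Tc 0 y) + Tc 0 (Tc 0 y))"
        using y Ty by (simp add: w(1) T_simps D_intros scaleR_2 algebra_simps)
      have BD: "B y \<in> D" by (auto simp: B_def intro!: D_intros Ty)
      have "B' (B y) = R s (B (B y))"
        unfolding B'_def B_def[of "B y"]
        using BD by (simp add: R_commute_T[OF rs(1)] D_lm T_lm R_add[OF rs(1)])
      also have "B (B y) = - (Tc 1 (Tc 1 y) + Tc 2 (Tc 2 y) + Tc 3 (Tc 3 y))"
        using Ty T_commute[OF _ _ y(1), of 2 1] T_commute[OF _ _ y(1), of 3 1] T_commute[OF _ _ y(1), of 3 2]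
        by (simp add: B_def T_simps D_intros lm_lm)
      finally have BB: "B' (B y) = R s (- (Tc 1 (Tc 1 y) + Tc 2 (Tc 2 y) + Tc 3 (Tc 3 y)))" .
      have "A' w - B' (B y) = R s (lm s (lm s y) - 2 *\<^sub>R lm s (Tc 0 y) + (Tc 0 (Tc 0 y) + Tc 1 (Tc 1 y) + Tc 2 (Tc 2 y) + Tc 3 (Tc 3 y)))"
        unfolding 1 BB R_diff[OF rs(1), symmetric] by (rule arg_cong[where f = "R s"]) simp
      also have "\<dots> = R s (Q s y)" by (simp add: Q_eq sum_lessThan_4 power2_eq_square lm_lm)
      also have "\<dots> = y" by (rule R_Q[OF rs(1) y(1)])
      finally show ?thesis by (simp add: y_def w_def)
    qed
    then have "norm (R s v) \<le> norm (A' (A' v)) + norm (B' (B (R s v)))" by (metis norm_triangle_ineq4)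
    also have "\<dots> \<le> C / norm s * (C / norm s * norm v) + C / norm s * (C / norm s * norm v)"
      using C by (intro add_mono order.trans[OF bA] order.trans[OF bB'] mult_left_mono bA bB) auto
    also have "\<dots> = 2 * C\<^sup>2 / (norm s)\<^sup>2 * norm v" by (simp add: power2_eq_square)
    finally show "norm (R s v) \<le> 2 * C\<^sup>2 / (norm s)\<^sup>2 * norm v" .
    show "norm (lm s (R s v) - Tc 0 (R s v)) \<le> C / norm s * norm v" using bA by (simp add: A'_def)
  qed
  show thesis
  proof (rule that[of "C + 2 * C\<^sup>2"])
    show "norm (R s v) \<le> (C + 2 * C\<^sup>2) / (norm s)\<^sup>2 * norm v" if "s \<noteq> 0" "re0 s \<le> norm s * cos \<phi>" for s v
      by (rule order.trans[OF main(2)[OF that]]) (use C in \<open>auto intro!: mult_right_mono divide_right_mono\<close>)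
    show "norm (lm s (R s v) - Tc 0 (R s v)) \<le> (C + 2 * C\<^sup>2) / norm s * norm v" if "s \<noteq> 0" "re0 s \<le> norm s * cos \<phi>" for s v
      by (rule order.trans[OF main(1)[OF that]]) (use C in \<open>auto intro!: mult_right_mono divide_right_mono\<close>)
  qed (use C in auto)
qed

end

section \<open>Slice functions and the Cauchy-Fueter operator\<close>

definition quat_im :: "quat \<Rightarrow> quat" where
  "quat_im s = s - of_real (re0 s)"

lemma bounded_linear_quat_im: "bounded_linear quat_im"
  unfolding quat_im_def
  by (intro bounded_linear_sub bounded_linear_ident bounded_linear_compose[OF bounded_linear_of_real bounded_linear_re0])

lemma quat_im_eq: "quat_im s = Quat 0 (im1 s) (im2 s) (im3 s)"
  by (simp add: quat_im_def of_real_quat minus_quat_def)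

lemma quat_im_plus_re0: "of_real (re0 s) + quat_im s = s"
  by (simp add: quat_im_def)

lemma re0_quat_im: "re0 (quat_im s) = 0"
  by (simp add: quat_im_eq)

lemma re0_scaleR: "re0 (r *\<^sub>R s) = r * re0 s"
  by (simp add: scaleR_quat_def)

lemma unitS_quat_im: "quat_im s \<noteq> 0 \<Longrightarrow> quat_im s /\<^sub>R norm (quat_im s) \<in> unitS"
  by (simp add: unitS_def re0_scaleR re0_quat_im)

lemma quat_im_polar: "of_real (re0 s) + (quat_im s /\<^sub>R norm (quat_im s)) * of_real (norm (quat_im s)) = s"
  using quat_im_plus_re0[of s] by (cases "quat_im s = 0") (simp_all add: of_real_def)

lemma qe_unitS: "qe 1 \<in> unitS"
  by (simp add: unitS_iff)

definition slice_rep :: "(quat \<Rightarrow> quat \<Rightarrow> quat) \<Rightarrow> quat set \<Rightarrow> (quat \<Rightarrow> quat) \<Rightarrow>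
    (real \<times> real \<Rightarrow> quat) \<Rightarrow> (real \<times> real \<Rightarrow> quat) \<Rightarrow> bool" where
  "slice_rep m U f \<alpha> \<beta> \<longleftrightarrow> C1_on (slice_dom U) \<alpha> \<and> C1_on (slice_dom U) \<beta> \<and>
        (\<forall>u v. (u, v) \<in> slice_dom U \<longrightarrow>
           (\<forall>J\<in>unitS. f (of_real u + J * of_real v) = \<alpha> (u, v) + m J (\<beta> (u, v))) \<and>
           \<alpha> (u, - v) = \<alpha> (u, v) \<and> \<beta> (u, - v) = - \<beta> (u, v) \<and>
           pd_u \<alpha> (u, v) = pd_v \<beta> (u, v) \<and> pd_v \<alpha> (u, v) = - pd_u \<beta> (u, v))"

lemma slice_hol_L_iff:
  "slice_hol_L U f \<longleftrightarrow> open U \<and> axially_symmetric U \<and> (\<exists>\<alpha> \<beta>. slice_rep (*) U f \<alpha> \<beta>)"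
  unfolding slice_hol_L_def slice_rep_def ..

lemma slice_hol_R_iff:
  "slice_hol_R U f \<longleftrightarrow> open U \<and> axially_symmetric U \<and> (\<exists>\<alpha> \<beta>. slice_rep (\<lambda>x y. y * x) U f \<alpha> \<beta>)"
  unfolding slice_hol_R_def slice_rep_def ..

text \<open>The Cauchy-Riemann equations are used to eliminate the v-partials, so that
  \<open>pd_u \<alpha>\<close> and \<open>pd_u \<beta>\<close> can serve as the two parts of the
  complex derivative of \<alpha> + i \<beta>.\<close>

lemma slice_rep_has_derivative:
  assumes "slice_rep m U f \<alpha> \<beta>" "(u, v) \<in> slice_dom U"
  shows "(\<alpha> has_derivative (\<lambda>(x, y). x *\<^sub>R pd_u \<alpha> (u, v) - y *\<^sub>R pd_u \<beta> (u, v))) (at (u, v))"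
    and "(\<beta> has_derivative (\<lambda>(x, y). x *\<^sub>R pd_u \<beta> (u, v) + y *\<^sub>R pd_u \<alpha> (u, v))) (at (u, v))"
proof -
  have expand: "g' = (\<lambda>(x, y). x *\<^sub>R g' (1, 0) + y *\<^sub>R g' (0, 1))"
    if "linear g'" for g' :: "real \<times> real \<Rightarrow> quat"
  proof
    fix z :: "real \<times> real"
    have "z = fst z *\<^sub>R (1, 0) + snd z *\<^sub>R (0, 1)" by (simp add: prod_eq_iff)
    then have "g' z = fst z *\<^sub>R g' (1, 0) + snd z *\<^sub>R g' (0, 1)"
      by (metis linear_add[OF that] linear_cmul[OF that])
    then show "g' z = (case z of (x, y) \<Rightarrow> x *\<^sub>R g' (1, 0) + y *\<^sub>R g' (0, 1))"
      by (simp add: case_prod_beta)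
  qed
  have *: "(g has_derivative (\<lambda>(x, y). x *\<^sub>R pd_u g (u, v) + y *\<^sub>R pd_v g (u, v))) (at (u, v))"
    if "C1_on (slice_dom U) g" for g
  proof -
    obtain g' where g': "(g has_derivative blinfun_apply (g' (u, v))) (at (u, v))"
      using \<open>C1_on _ g\<close> assms(2) unfolding C1_on_def by blast
    have "frechet_derivative g (at (u, v)) = blinfun_apply (g' (u, v))"
      using frechet_derivative_at[OF g'] by simp
    then show ?thesis
      unfolding pd_u_def pd_v_def
      using g' expand[OF bounded_linear.linear[OF blinfun.bounded_linear_right]] by metis
  qed
  have "C1_on (slice_dom U) \<alpha>" "C1_on (slice_dom U) \<beta>"
    "pd_u \<alpha> (u, v) = pd_v \<beta> (u, v)" "pd_v \<alpha> (u, v) = - pd_u \<beta> (u, v)"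
    using assms unfolding slice_rep_def by blast+
  with *[of \<alpha>] *[of \<beta>]
  show "(\<alpha> has_derivative (\<lambda>(x, y). x *\<^sub>R pd_u \<alpha> (u, v) - y *\<^sub>R pd_u \<beta> (u, v))) (at (u, v))"
    and "(\<beta> has_derivative (\<lambda>(x, y). x *\<^sub>R pd_u \<beta> (u, v) + y *\<^sub>R pd_u \<alpha> (u, v))) (at (u, v))"
    by simp_all
qed

lemma slice_rep_continuous_pd:
  assumes "slice_rep m U f \<alpha> \<beta>"
  shows "continuous_on (slice_dom U) (pd_u \<alpha>)" "continuous_on (slice_dom U) (pd_u \<beta>)"
proof -
  have *: "continuous_on (slice_dom U) (pd_u g)" if g: "C1_on (slice_dom U) g" for g
  proof -
    obtain g' where g': "\<And>x. x \<in> slice_dom U \<Longrightarrow> (g has_derivative blinfun_apply (g' x)) (at x)"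
      "continuous_on (slice_dom U) g'"
      using g unfolding C1_on_def by blast
    have "continuous_on (slice_dom U) (\<lambda>x. blinfun_apply (g' x) (1, 0))"
      by (intro continuous_intros g')
    moreover have "pd_u g x = blinfun_apply (g' x) (1, 0)" if "x \<in> slice_dom U" for x
      unfolding pd_u_def using frechet_derivative_at[OF g'(1)[OF that]] by simp
    ultimately show ?thesis by simp
  qed
  show "continuous_on (slice_dom U) (pd_u \<alpha>)" "continuous_on (slice_dom U) (pd_u \<beta>)"
    using assms unfolding slice_rep_def by (blast intro: *)+
qed

lemma slice_dom_quat_im:
  "axially_symmetric U \<Longrightarrow> s \<in> U \<Longrightarrow> (re0 s, norm (quat_im s)) \<in> slice_dom U"
  by (auto simp: axially_symmetric_def slice_dom_def quat_im_def)

text \<open>The two sides of the multiplication are treated at once: \<open>m\<close> is either the quaternionic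
  product or the opposite product.\<close>

locale quat_side =
  fixes m :: "quat \<Rightarrow> quat \<Rightarrow> quat"
  assumes bilinear: "bounded_bilinear m"
    and m_m: "m x (m x b) = m (x * x) b"
    and m_one: "m 1 b = b"
    and norm_m: "norm (m x b) = norm x * norm b"
begin

sublocale bounded_bilinear m by (rule bilinear)

lemma m_neg_one: "m (-1) b = - b"
  by (simp add: minus_left m_one)

lemma m_unitS: "J \<in> unitS \<Longrightarrow> m J (m J b) = - b"
  by (simp add: m_m unitS_square m_neg_one)

text \<open>The directions 1 and J together contribute the Cauchy-Riemann operator of the slice,
  which kills f. The two directions tangent to the sphere of imaginary units move only J, and each
  contributes - \<beta> / v.\<close>

lemma Cauchy_Fueter_slice:
  assumes rep: "slice_rep m U f \<alpha> \<beta>" and U: "open U" "axially_symmetric U" and q: "q \<in> U" "quat_im q \<noteq> 0"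
  shows "(\<Sum>i<4. m (qe i) (frechet_derivative f (at q) (qe i))) = - (2 / norm (quat_im q)) *\<^sub>R \<beta> (re0 q, norm (quat_im q))"
proof -
  define v where "v = norm (quat_im q)"
  define J where "J = quat_im q /\<^sub>R v"
  have v: "v > 0" using q by (simp add: v_def)
  have J: "J \<in> unitS" unfolding J_def v_def by (rule unitS_quat_im[OF q(2)])
  have Jv: "quat_im q = v *\<^sub>R J" using v by (simp add: J_def)
  have dom: "(re0 q, v) \<in> slice_dom U" unfolding v_def by (rule slice_dom_quat_im[OF U(2) q(1)])
  define a where "a = pd_u \<alpha> (re0 q, v)"
  define b where "b = pd_u \<beta> (re0 q, v)"
  define n' where "n' h = quat_im h \<bullet> J" for h
  have n: "((\<lambda>s. norm (quat_im s)) has_derivative n') (at q)"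
    unfolding n'_def
    by (rule has_derivative_eq_rhs[OF has_derivative_compose[OF bounded_linear_imp_has_derivative[OF bounded_linear_quat_im] has_derivative_norm]])
       (use q in \<open>auto simp: J_def v_def sgn_div_norm\<close>)
  have uv: "((\<lambda>s. (re0 s, norm (quat_im s))) has_derivative (\<lambda>h. (re0 h, n' h))) (at q)"
    by (rule has_derivative_Pair[OF bounded_linear_imp_has_derivative[OF bounded_linear_re0] n])
  note d\<alpha> = slice_rep_has_derivative(1)[OF rep dom, folded a_def b_def]
  note d\<beta> = slice_rep_has_derivative(2)[OF rep dom, folded a_def b_def]
  have A: "((\<lambda>s. \<alpha> (re0 s, norm (quat_im s))) has_derivative (\<lambda>h. re0 h *\<^sub>R a - n' h *\<^sub>R b)) (at q)"
    using has_derivative_compose[OF uv d\<alpha>[unfolded v_def]] by simp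
  have B: "((\<lambda>s. \<beta> (re0 s, norm (quat_im s))) has_derivative (\<lambda>h. re0 h *\<^sub>R b + n' h *\<^sub>R a)) (at q)"
    using has_derivative_compose[OF uv d\<beta>[unfolded v_def]] by simp
  have I: "((\<lambda>s. quat_im s /\<^sub>R norm (quat_im s)) has_derivative (\<lambda>h. (quat_im h - n' h *\<^sub>R J) /\<^sub>R v)) (at q)"
    by (rule has_derivative_eq_rhs[OF has_derivative_scaleR[OF Deriv.has_derivative_inverse[OF _ n] bounded_linear_imp_has_derivative[OF bounded_linear_quat_im]]])
       (use v q in \<open>auto simp: v_def[symmetric] Jv norm_unitS[OF J] algebra_simps divide_simps\<close>)
  have "((\<lambda>s. \<alpha> (re0 s, norm (quat_im s)) + m (quat_im s /\<^sub>R norm (quat_im s)) (\<beta> (re0 s, norm (quat_im s))))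
      has_derivative (\<lambda>h. (re0 h *\<^sub>R a - n' h *\<^sub>R b) + (m J (re0 h *\<^sub>R b + n' h *\<^sub>R a)
        + m ((quat_im h - n' h *\<^sub>R J) /\<^sub>R v) (\<beta> (re0 q, v))))) (at q)"
    using has_derivative_add[OF A FDERIV[OF I B]] by (simp add: v_def[symmetric] J_def[symmetric])
  then have "(f has_derivative (\<lambda>h. (re0 h *\<^sub>R a - n' h *\<^sub>R b) + (m J (re0 h *\<^sub>R b + n' h *\<^sub>R a)
        + m ((quat_im h - n' h *\<^sub>R J) /\<^sub>R v) (\<beta> (re0 q, v))))) (at q)"
  proof (rule has_derivative_transform_within_open)
    show "open (U \<inter> {s. 0 < norm (quat_im s)})"
      by (intro open_Int U open_Collect_less continuous_intros linear_continuous_on bounded_linear_quat_im)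
    show "q \<in> U \<inter> {s. 0 < norm (quat_im s)}" using q by simp
    fix s assume s: "s \<in> U \<inter> {s. 0 < norm (quat_im s)}"
    then have "(re0 s, norm (quat_im s)) \<in> slice_dom U" "quat_im s /\<^sub>R norm (quat_im s) \<in> unitS"
      using slice_dom_quat_im[OF U(2)] unitS_quat_im by auto
    then show "\<alpha> (re0 s, norm (quat_im s)) + m (quat_im s /\<^sub>R norm (quat_im s)) (\<beta> (re0 s, norm (quat_im s))) = f s"
      using rep quat_im_polar[of s] unfolding slice_rep_def by metis
  qed
  then have fr: "frechet_derivative f (at q) = (\<lambda>h. (re0 h *\<^sub>R a - n' h *\<^sub>R b) + (m J (re0 h *\<^sub>R b + n' h *\<^sub>R a)
        + m ((quat_im h - n' h *\<^sub>R J) /\<^sub>R v) (\<beta> (re0 q, v))))"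
    by (rule frechet_derivative_at[symmetric])
  define \<beta>0 where "\<beta>0 = \<beta> (re0 q, v)"
  define c where "c i = n' (qe i)" for i
  have Jc: "c 1 *\<^sub>R qe 1 + c 2 *\<^sub>R qe 2 + c 3 *\<^sub>R qe 3 = J"
    using J by (auto intro!: quat_eqI simp: c_def n'_def quat_im_eq inner_quat_def plus_quat_def scaleR_quat_def unitS_def)
  have 0: "frechet_derivative f (at q) (qe 0) = a + m J b"
  proof -
    have "quat_im 1 = 0" "re0 1 = 1" by (auto simp: one_quat_def quat_im_eq zero_quat_def)
    then show ?thesis unfolding fr by (simp add: n'_def zero_left)
  qed
  have i: "m (qe i) (frechet_derivative f (at q) (qe i)) = - m (c i *\<^sub>R qe i) b + m (c i *\<^sub>R qe i) (m J a)
      - \<beta>0 /\<^sub>R v - m (c i *\<^sub>R qe i) (m J \<beta>0) /\<^sub>R v" if "i \<in> {1, 2, 3}" for i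
  proof -
    have "re0 (qe i) = 0" "quat_im (qe i) = qe i" "qe i * qe i = -1"
      using that by (auto simp: quat_im_eq)
    then show ?thesis
      unfolding fr
      by (simp add: c_def[symmetric] \<beta>0_def[symmetric] add_right diff_right diff_left scaleR_left scaleR_right minus_right m_m m_neg_one algebra_simps)
  qed
  have i1: "1 \<in> {1, 2, 3::nat}" and i2: "2 \<in> {1, 2, 3::nat}" and i3: "3 \<in> {1, 2, 3::nat}" by auto
  note i1 = i[OF i1] and i2 = i[OF i2] and i3 = i[OF i3]
  have sumJ: "m (c 1 *\<^sub>R qe 1) x + m (c 2 *\<^sub>R qe 2) x + m (c 3 *\<^sub>R qe 3) x = m J x" for x
    unfolding Jc[symmetric] by (simp only: add_left)
  \<comment> \<open>The three imaginary units give -3 \<beta>0 / v; the last bracket sums to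
    \<open>m J (m J \<beta>0)\<close> = - \<beta>0 and gives one of them back. The terms with a and
    b cancel because J squares to -1.\<close>
  have "(\<Sum>i<4. m (qe i) (frechet_derivative f (at q) (qe i)))
    = a + m J b - (m (c 1 *\<^sub>R qe 1) b + m (c 2 *\<^sub>R qe 2) b + m (c 3 *\<^sub>R qe 3) b)
      + (m (c 1 *\<^sub>R qe 1) (m J a) + m (c 2 *\<^sub>R qe 2) (m J a) + m (c 3 *\<^sub>R qe 3) (m J a))
      - 3 *\<^sub>R (\<beta>0 /\<^sub>R v) - (m (c 1 *\<^sub>R qe 1) (m J \<beta>0) + m (c 2 *\<^sub>R qe 2) (m J \<beta>0) + m (c 3 *\<^sub>R qe 3) (m J \<beta>0)) /\<^sub>R v"
  proof -
    have three: "3 *\<^sub>R x = x + x + x" for x :: quat by (metis scaleR_2 scaleR_left_distrib scaleR_one one_plus_numeral add.commute numeral_plus_one semiring_norm(5))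
    show ?thesis
      unfolding sum_lessThan_4 i1 i2 i3 qe_simps(1) m_one 0[unfolded qe_simps(1)] three
      by (simp add: scaleR_add_right)
  qed
  also have "\<dots> = - (2 / v) *\<^sub>R \<beta>0"
    unfolding sumJ by (simp add: m_unitS[OF J] divide_inverse flip: scaleR_left_diff_distrib scaleR_minus_left)
  finally show ?thesis by (simp add: v_def \<beta>0_def)
qed

end

lemma quat_side_left: "quat_side (*)"
  by (rule quat_side.intro) (auto simp: bounded_bilinear_mult mult.assoc norm_mult)

lemma quat_side_right: "quat_side (\<lambda>x y. y * x)"
  by (rule quat_side.intro) (auto simp: bounded_bilinear.flip[OF bounded_bilinear_mult] mult.assoc norm_mult)

section \<open>Cauchy-Riemann pairs\<close>

text \<open>\<open>P + i Q\<close> has the continuous complex derivative \<open>P' + i Q'\<close> relative to \<open>S\<close>.\<close>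

definition CR_pair :: "(real \<times> real) set \<Rightarrow> (real \<times> real \<Rightarrow> 'b::real_normed_vector) \<Rightarrow> (real \<times> real \<Rightarrow> 'b) \<Rightarrow>
    (real \<times> real \<Rightarrow> 'b) \<Rightarrow> (real \<times> real \<Rightarrow> 'b) \<Rightarrow> bool" where
  "CR_pair S P Q P' Q' \<longleftrightarrow> continuous_on S P' \<and> continuous_on S Q' \<and>
    (\<forall>z\<in>S. (P has_derivative (\<lambda>h. fst h *\<^sub>R P' z - snd h *\<^sub>R Q' z)) (at z within S) \<and>
           (Q has_derivative (\<lambda>h. fst h *\<^sub>R Q' z + snd h *\<^sub>R P' z)) (at z within S))"

lemma CR_pair_continuous_on:
  assumes "CR_pair S P Q P' Q'"
  shows "continuous_on S P" "continuous_on S Q"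
  using assms unfolding CR_pair_def continuous_on_eq_continuous_within
  by (blast intro: has_derivative_continuous)+

lemma CR_pair_id: "CR_pair S fst snd (\<lambda>_. 1) (\<lambda>_. 0)"
  by (auto simp: CR_pair_def intro!: derivative_eq_intros)

text \<open>The product rule for holomorphic functions with noncommuting values: \<open>pr\<close>
  is only bilinear, so the order of the two factors is kept throughout.\<close>

lemma CR_pair_mult:
  assumes "bounded_bilinear pr" and PQ: "CR_pair S P Q P' Q'" and AB: "CR_pair S A B A' B'"
  shows "CR_pair S (\<lambda>z. pr (P z) (A z) - pr (Q z) (B z)) (\<lambda>z. pr (P z) (B z) + pr (Q z) (A z))
    (\<lambda>z. pr (P' z) (A z) + pr (P z) (A' z) - pr (Q' z) (B z) - pr (Q z) (B' z))
    (\<lambda>z. pr (P' z) (B z) + pr (P z) (B' z) + pr (Q' z) (A z) + pr (Q z) (A' z))"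
proof -
  interpret bounded_bilinear pr by fact
  have c: "continuous_on S P" "continuous_on S Q" "continuous_on S A" "continuous_on S B"
    "continuous_on S P'" "continuous_on S Q'" "continuous_on S A'" "continuous_on S B'"
    using CR_pair_continuous_on[OF PQ] CR_pair_continuous_on[OF AB] PQ AB by (auto simp: CR_pair_def)
  show ?thesis unfolding CR_pair_def
  proof (intro conjI ballI)
    fix z assume z: "z \<in> S"
    have P: "(P has_derivative (\<lambda>h. fst h *\<^sub>R P' z - snd h *\<^sub>R Q' z)) (at z within S)"
      and Q: "(Q has_derivative (\<lambda>h. fst h *\<^sub>R Q' z + snd h *\<^sub>R P' z)) (at z within S)"
      and A: "(A has_derivative (\<lambda>h. fst h *\<^sub>R A' z - snd h *\<^sub>R B' z)) (at z within S)"
      and B: "(B has_derivative (\<lambda>h. fst h *\<^sub>R B' z + snd h *\<^sub>R A' z)) (at z within S)"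
      using PQ AB z unfolding CR_pair_def by auto
    note simps = add_left add_right diff_left diff_right scaleR_left scaleR_right
      scaleR_add_right scaleR_diff_right algebra_simps
    show "((\<lambda>z. pr (P z) (A z) - pr (Q z) (B z)) has_derivative
        (\<lambda>h. fst h *\<^sub>R (pr (P' z) (A z) + pr (P z) (A' z) - pr (Q' z) (B z) - pr (Q z) (B' z)) -
           snd h *\<^sub>R (pr (P' z) (B z) + pr (P z) (B' z) + pr (Q' z) (A z) + pr (Q z) (A' z)))) (at z within S)"
      by (rule has_derivative_eq_rhs[OF has_derivative_diff[OF FDERIV[OF P A] FDERIV[OF Q B]]])
        (simp add: fun_eq_iff simps)
    show "((\<lambda>z. pr (P z) (B z) + pr (Q z) (A z)) has_derivative
        (\<lambda>h. fst h *\<^sub>R (pr (P' z) (B z) + pr (P z) (B' z) + pr (Q' z) (A z) + pr (Q z) (A' z)) +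
           snd h *\<^sub>R (pr (P' z) (A z) + pr (P z) (A' z) - pr (Q' z) (B z) - pr (Q z) (B' z)))) (at z within S)"
      by (rule has_derivative_eq_rhs[OF has_derivative_add[OF FDERIV[OF P B] FDERIV[OF Q A]]])
        (simp add: fun_eq_iff simps)
  qed (intro continuous_intros continuous_on c)+
qed

text \<open>Differentiability in the form of a factorised increment whose cofactor converges at z0.
  The resolvent identity delivers the increment in this form, with the linear factor on the
  left.\<close>

lemma has_derivative_Caratheodory:
  assumes "bounded_bilinear pr" "bounded_linear l" "z0 \<in> S"
    and F: "\<And>z. z \<in> S \<Longrightarrow> F z - F z0 = pr (l (z - z0)) (K z)"
    and K: "(K \<longlongrightarrow> k) (at z0 within S)"
  shows "(F has_derivative (\<lambda>h. pr (l h) k)) (at z0 within S)"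
proof -
  interpret bounded_bilinear pr by fact
  interpret l: bounded_linear l by fact
  obtain C where C: "C > 0" "\<And>a b. norm (pr a b) \<le> norm a * norm b * C" using pos_bounded by blast
  obtain c where c: "c > 0" "\<And>x. norm (l x) \<le> norm x * c" using l.pos_bounded by blast
  show ?thesis
  proof (rule has_derivativeI_sandwich[of 1])
    show "bounded_linear (\<lambda>h. pr (l h) k)"
      by (rule bounded_linear_compose[OF bounded_linear_left assms(2)])
    show "((\<lambda>z. c * norm (K z - k) * C) \<longlongrightarrow> 0) (at z0 within S)"
      using tendsto_mult[OF tendsto_mult[OF tendsto_const[of c] tendsto_norm[OF LIM_zero[OF K]]] tendsto_const[of C]] by simp
    fix z assume z: "z \<in> S" "z \<noteq> z0" "dist z z0 < 1"
    have "F z - F z0 - pr (l (z - z0)) k = pr (l (z - z0)) (K z - k)"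
      using F[OF z(1)] by (simp add: diff_right)
    then have "norm (F z - F z0 - pr (l (z - z0)) k) \<le> norm (l (z - z0)) * norm (K z - k) * C"
      using C(2) by simp
    also have "\<dots> \<le> (norm (z - z0) * c) * norm (K z - k) * C"
      using c(2) C(1) by (intro mult_right_mono) auto
    finally show "norm (F z - F z0 - pr (l (z - z0)) k) / norm (z - z0) \<le> c * norm (K z - k) * C"
      using z by (simp add: divide_le_eq mult.commute mult.left_commute)
  qed (simp)
qed

section \<open>Polar coordinates in the formal complex plane\<close>

definition polar :: "real \<Rightarrow> real \<Rightarrow> real \<times> real" where
  "polar t \<phi> = (t * cos \<phi>, t * sin \<phi>)"

text \<open>The bounding rays belong to the set, since the path angle itself is one of them; this is
  why Cauchy-Riemann pairs use derivatives relative to a set.\<close>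

definition polar_sector :: "real \<Rightarrow> real \<Rightarrow> (real \<times> real) set" where
  "polar_sector \<phi>1 \<phi>2 = (\<lambda>(t, \<phi>). polar t \<phi>) ` ({0<..} \<times> {\<phi>1..\<phi>2})"

lemma polar_in_polar_sector: "t > 0 \<Longrightarrow> \<phi> \<in> {\<phi>1..\<phi>2} \<Longrightarrow> polar t \<phi> \<in> polar_sector \<phi>1 \<phi>2"
  by (auto simp: polar_sector_def)

lemma continuous_on_polar: "continuous_on A (\<lambda>z. polar (fst z) (snd z))"
  unfolding polar_def by (intro continuous_intros)

lemma continuous_on_polar_ray: "continuous_on A (\<lambda>t. polar t \<phi>)"
  unfolding polar_def by (intro continuous_intros)

text \<open>Both derivatives are expressed by the same \<open>d\<close>, the radial derivative of P;
  it becomes the \<open>pt\<close> of \<open>integral_independent_of_angle\<close>.\<close>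

lemma CR_pair_polar:
  assumes "CR_pair (polar_sector \<phi>1 \<phi>2) P Q P' Q'" and t: "t > 0" and \<phi>: "\<phi> \<in> {\<phi>1..\<phi>2}"
  defines "d \<equiv> cos \<phi> *\<^sub>R P' (polar t \<phi>) - sin \<phi> *\<^sub>R Q' (polar t \<phi>)"
  shows "((\<lambda>\<phi>. Q (polar t \<phi>)) has_vector_derivative t *\<^sub>R d) (at \<phi> within {\<phi>1..\<phi>2})"
    and "((\<lambda>t. P (polar t \<phi>)) has_vector_derivative d) (at t)"
proof -
  let ?S = "polar_sector \<phi>1 \<phi>2"
  have z: "polar t \<phi> \<in> ?S" using t \<phi> by (rule polar_in_polar_sector)
  have P: "(P has_derivative (\<lambda>h. fst h *\<^sub>R P' (polar t \<phi>) - snd h *\<^sub>R Q' (polar t \<phi>))) (at (polar t \<phi>) within ?S)"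
    and Q: "(Q has_derivative (\<lambda>h. fst h *\<^sub>R Q' (polar t \<phi>) + snd h *\<^sub>R P' (polar t \<phi>))) (at (polar t \<phi>) within ?S)"
    using assms(1) z unfolding CR_pair_def by auto
  have "(polar t has_derivative (\<lambda>h. (t * (- sin \<phi> * h), t * (cos \<phi> * h)))) (at \<phi> within {\<phi>1..\<phi>2})"
    unfolding polar_def by (auto intro!: derivative_eq_intros)
  moreover have "(Q has_derivative (\<lambda>h. fst h *\<^sub>R Q' (polar t \<phi>) + snd h *\<^sub>R P' (polar t \<phi>)))
      (at (polar t \<phi>) within polar t ` {\<phi>1..\<phi>2})"
    by (rule has_derivative_subset[OF Q]) (use polar_in_polar_sector[OF t] in auto)
  ultimately have "((\<lambda>\<phi>. Q (polar t \<phi>)) has_derivative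
      (\<lambda>h. (t * (- sin \<phi> * h)) *\<^sub>R Q' (polar t \<phi>) + (t * (cos \<phi> * h)) *\<^sub>R P' (polar t \<phi>))) (at \<phi> within {\<phi>1..\<phi>2})"
    by (auto dest: has_derivative_in_compose)
  then show "((\<lambda>\<phi>. Q (polar t \<phi>)) has_vector_derivative t *\<^sub>R d) (at \<phi> within {\<phi>1..\<phi>2})"
    unfolding has_vector_derivative_def d_def
    by (rule has_derivative_eq_rhs) (simp add: fun_eq_iff algebra_simps)
  have "((\<lambda>t. polar t \<phi>) has_derivative (\<lambda>h. (h * cos \<phi>, h * sin \<phi>))) (at t within {0<..})"
    unfolding polar_def by (auto intro!: derivative_eq_intros)
  moreover have "(P has_derivative (\<lambda>h. fst h *\<^sub>R P' (polar t \<phi>) - snd h *\<^sub>R Q' (polar t \<phi>)))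
      (at (polar t \<phi>) within (\<lambda>t. polar t \<phi>) ` {0<..})"
    by (rule has_derivative_subset[OF P]) (use polar_in_polar_sector[OF _ \<phi>] in auto)
  ultimately have "((\<lambda>t. P (polar t \<phi>)) has_derivative
      (\<lambda>h. (h * cos \<phi>) *\<^sub>R P' (polar t \<phi>) - (h * sin \<phi>) *\<^sub>R Q' (polar t \<phi>))) (at t within {0<..})"
    by (auto dest: has_derivative_in_compose)
  then have "((\<lambda>t. P (polar t \<phi>)) has_vector_derivative d) (at t within {0<..})"
    unfolding has_vector_derivative_def d_def
    by (rule has_derivative_eq_rhs) (simp add: fun_eq_iff algebra_simps)
  then show "((\<lambda>t. P (polar t \<phi>)) has_vector_derivative d) (at t)"
    using t at_within_open[of t "{0<..}"] by simp
qed

definition slice_emb :: "quat \<Rightarrow> real \<times> real \<Rightarrow> quat" where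
  "slice_emb J z = of_real (fst z) + J * of_real (snd z)"

lemma bounded_linear_slice_emb: "bounded_linear (slice_emb J)"
  unfolding slice_emb_def
  by (intro bounded_linear_add bounded_linear_compose[OF bounded_linear_of_real] bounded_linear_fst
    bounded_linear_compose[OF bounded_linear_mult_right] bounded_linear_snd)

lemma slice_emb_diff: "slice_emb J (z - w) = slice_emb J z - slice_emb J w"
  by (rule linear_diff[OF bounded_linear.linear[OF bounded_linear_slice_emb]])

lemma slice_emb_commute: "slice_emb J z * slice_emb J w = slice_emb J w * slice_emb J z"
  by (simp add: slice_emb_def algebra_simps of_real_def)

lemma slice_emb_eq: "slice_emb J z = of_real (fst z) + snd z *\<^sub>R J"
  by (simp add: slice_emb_def of_real_def)

lemma unitS_minus: "J \<in> unitS \<Longrightarrow> - J \<in> unitS"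
  by (simp add: unitS_iff uminus_quat_def)

lemma re0_slice_emb: "J \<in> unitS \<Longrightarrow> re0 (slice_emb J z) = fst z"
  by (simp add: slice_emb_def unitS_def)

lemma norm_slice_emb_polar: "J \<in> unitS \<Longrightarrow> t \<ge> 0 \<Longrightarrow> norm (slice_emb J (polar t \<phi>)) = t"
  unfolding slice_emb_def polar_def fst_conv snd_conv
  by (subst norm_complex_unitS) (simp_all add: power_mult_distrib flip: distrib_left)

lemma slice_emb_polar: "slice_emb J (polar t \<phi>) = of_real t * qexpJ J \<phi>"
  by (simp add: slice_emb_def polar_def qexpJ_def of_real_def algebra_simps)

section \<open>The pseudo-resolvent as a slice function\<close>

context sectorial
begin

definition lm_op :: "quat \<Rightarrow> 'v \<Rightarrow>\<^sub>L 'v" where "lm_op q = Blinfun (lm q)"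
text \<open>\<open>Blinfun\<close> specifies a value only for bounded linear maps; for
  \<open>R_op\<close> and \<open>TR_op\<close> this is guaranteed at points satisfying
  \<open>outside_sector\<close>.\<close>

definition R_op :: "quat \<Rightarrow> 'v \<Rightarrow>\<^sub>L 'v" where "R_op s = Blinfun (R s)"
definition TR_op :: "quat \<Rightarrow> 'v \<Rightarrow>\<^sub>L 'v" where "TR_op s = Blinfun (\<lambda>v. Tc 0 (R s v))"

lemma lm_op_apply [simp]: "blinfun_apply (lm_op q) v = lm q v"
  unfolding lm_op_def by (simp add: bounded_linear_Blinfun_apply bounded_linear_lm)

lemma norm_lm_op: "norm (lm_op q) \<le> norm q"
  by (rule norm_blinfun_bound) (auto simp: norm_lm)

lemma bounded_linear_lm_op: "bounded_linear lm_op"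
  by (rule bounded_linear_intro[where K = 1])
     (auto intro!: blinfun_eqI simp: blinfun.bilinear_simps lm_add_left norm_lm_op)

end

text \<open>The angle is a parameter so that the locale can be instantiated at each path angle. The
  estimates cover every angle from \<phi>0 up to pi, hence a whole closed sector between two path
  angles.\<close>

locale sectorial_bounds = sectorial lm rm D Tc \<omega>
  for lm :: "quat \<Rightarrow> 'v::banach \<Rightarrow> 'v" and rm :: "'v \<Rightarrow> quat \<Rightarrow> 'v"
    and D :: "'v set" and Tc :: "nat \<Rightarrow> 'v \<Rightarrow> 'v" and \<omega> :: real +
  fixes \<phi>0 C :: real
  assumes \<phi>0: "\<omega> < \<phi>0" "\<phi>0 < pi" and C: "C \<ge> 0"
    and R_bound: "\<And>s v. s \<noteq> 0 \<Longrightarrow> re0 s \<le> norm s * cos \<phi>0 \<Longrightarrow> norm (R s v) \<le> C / (norm s)\<^sup>2 * norm v"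
    and ST_bound: "\<And>s v. s \<noteq> 0 \<Longrightarrow> re0 s \<le> norm s * cos \<phi>0 \<Longrightarrow> norm (lm s (R s v) - Tc 0 (R s v)) \<le> C / norm s * norm v"
begin

definition outside_sector :: "quat \<Rightarrow> bool" where
  "outside_sector s \<longleftrightarrow> s \<noteq> 0 \<and> re0 s \<le> norm s * cos \<phi>0"

lemma outside_sector_rho: "outside_sector s \<Longrightarrow> s \<in> rhoS lm D Tc"
proof -
  assume s: "outside_sector s"
  have "cos \<phi>0 < cos \<omega>" using cos_monotone_0_pi[of \<omega> \<phi>0] omega \<phi>0 by simp
  then have "norm s * cos \<phi>0 < norm s * cos \<omega>" using s by (simp add: outside_sector_def)
  then show ?thesis using s rho(1)[of s] by (simp add: outside_sector_def)
qed

lemma outside_sector_slice_emb: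
  assumes "z \<in> polar_sector \<phi>0 \<phi>2" "\<phi>2 < pi" "J \<in> unitS"
  shows "outside_sector (slice_emb J z)"
proof -
  obtain t \<phi> where z: "t > 0" "\<phi> \<in> {\<phi>0..\<phi>2}" "z = polar t \<phi>" using assms(1) by (auto simp: polar_sector_def)
  have "norm (slice_emb J z) = t" using z assms(3) by (simp add: norm_slice_emb_polar)
  moreover have "cos \<phi> \<le> cos \<phi>0" using z \<phi>0 omega assms(2) by (intro cos_monotone_0_pi_le) auto
  ultimately show ?thesis using z assms(3) unfolding outside_sector_def by (auto simp: re0_slice_emb polar_def)
qed

lemma R_bounded_linear: "outside_sector s \<Longrightarrow> bounded_linear (R s)"
  by (rule bounded_linear_intro[where K = "C / (norm s)\<^sup>2"])
    (use R_bound[of s] in \<open>auto simp: outside_sector_def outside_sector_rho R_add R_scaleR mult.commute\<close>)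

lemma R_op_apply [simp]: "outside_sector s \<Longrightarrow> blinfun_apply (R_op s) v = R s v"
  unfolding R_op_def by (simp add: bounded_linear_Blinfun_apply R_bounded_linear)

lemma norm_R_op: "outside_sector s \<Longrightarrow> norm (R_op s) \<le> C / (norm s)\<^sup>2"
  by (rule norm_blinfun_bound) (use C R_bound in \<open>auto simp: outside_sector_def\<close>)

lemma T_bound: "outside_sector s \<Longrightarrow> norm (Tc 0 (R s v)) \<le> 2 * C / norm s * norm v"
proof -
  assume s: "outside_sector s"
  have "norm (Tc 0 (R s v)) \<le> norm (lm s (R s v)) + norm (lm s (R s v) - Tc 0 (R s v))"
    by (metis diff_diff_eq2 add_diff_cancel_left' norm_triangle_ineq4)
  also have "\<dots> \<le> norm s * (C / (norm s)\<^sup>2 * norm v) + C / norm s * norm v"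
    unfolding norm_lm using s by (intro add_mono mult_left_mono R_bound ST_bound) (auto simp: outside_sector_def)
  also have "\<dots> = 2 * C / norm s * norm v"
    using s by (simp add: outside_sector_def power2_eq_square field_simps)
  finally show ?thesis .
qed

lemma T_bounded_linear: "outside_sector s \<Longrightarrow> bounded_linear (\<lambda>v. Tc 0 (R s v))"
  by (rule bounded_linear_intro[where K = "2 * C / norm s"])
    (use T_bound[of s] in \<open>auto simp: outside_sector_rho R_add R_scaleR T_add T_scaleR D2_D R_D2 mult.commute\<close>)

lemma TR_op_apply [simp]: "outside_sector s \<Longrightarrow> blinfun_apply (TR_op s) v = Tc 0 (R s v)"
  unfolding TR_op_def by (simp add: bounded_linear_Blinfun_apply T_bounded_linear)

lemma norm_TR_op: "outside_sector s \<Longrightarrow> norm (TR_op s) \<le> 2 * C / norm s"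
  by (rule norm_blinfun_bound) (use C T_bound in \<open>auto simp: outside_sector_def\<close>)

text \<open>For commuting s and s0 one has Q s0 - Q s = - (s - s0) ((s - s0) + 2 (s0 - T_0)). The
  factor is what follows s - s0 here, with its sign, composed with R s0; it enters through R s - R
  s0 = R s (Q s0 - Q s) R s0.\<close>

definition resolvent_factor :: "quat \<Rightarrow> quat \<Rightarrow> 'v \<Rightarrow>\<^sub>L 'v" where
  "resolvent_factor s s0 = - ((lm_op (s - s0) o\<^sub>L R_op s0) + 2 *\<^sub>R ((lm_op s0 o\<^sub>L R_op s0) - TR_op s0))"

lemma resolvent_identity:
  assumes "outside_sector s" "outside_sector s0" "s * s0 = s0 * s"
  shows "R s v - R s0 v = R s (lm (s - s0) (blinfun_apply (resolvent_factor s s0) v))"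
proof -
  define y where "y = R s0 v"
  have y: "y \<in> D2" unfolding y_def using assms by (simp add: outside_sector_rho R_D2)
  have rs: "s \<in> rhoS lm D Tc" "s0 \<in> rhoS lm D Tc" using assms outside_sector_rho by auto
  define d where "d = s - s0"
  have sq: "s0\<^sup>2 - s\<^sup>2 = - (d * d) - 2 *\<^sub>R (d * s0)"
    using assms(3) by (simp add: d_def power2_eq_square algebra_simps scaleR_2)
  have "Q s0 y - Q s y = lm (s0\<^sup>2 - s\<^sup>2) y + 2 *\<^sub>R lm d (Tc 0 y)"
    by (simp add: Q_eq lm_diff_left d_def scaleR_diff_right)
  also have "\<dots> = lm d (blinfun_apply (resolvent_factor s s0) v)"
    using assms(1,2) unfolding sq
    by (simp add: resolvent_factor_def blinfun.bilinear_simps y_def[symmetric] d_def[symmetric] lm_lm lm_diff_left scaleR_diff_right)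
  finally have "Q s0 y - Q s y = lm d (blinfun_apply (resolvent_factor s s0) v)" .
  moreover have "R s v - R s0 v = R s (Q s0 y - Q s y)"
    using y rs by (simp add: R_diff R_Q y_def Q_R)
  ultimately show ?thesis by (simp add: d_def)
qed

text \<open>R s commutes with s - s0, so this factor can stand on either side of it. The forms with
  it on the right give continuity, the form with it on the left gives the derivative; the identity
  for \<open>TR_op\<close> is there because \<open>resolvent_factor\<close> contains T_0 R.\<close>

lemma R_op_diff:
  assumes "outside_sector s" "outside_sector s0" "s * s0 = s0 * s"
  shows "R_op s - R_op s0 = R_op s o\<^sub>L (lm_op (s - s0) o\<^sub>L resolvent_factor s s0)"
    and "R_op s - R_op s0 = lm_op (s - s0) o\<^sub>L (R_op s o\<^sub>L resolvent_factor s s0)"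
    and "TR_op s - TR_op s0 = TR_op s o\<^sub>L (lm_op (s - s0) o\<^sub>L resolvent_factor s s0)"
proof -
  have rs: "s \<in> rhoS lm D Tc" "s0 \<in> rhoS lm D Tc" using assms outside_sector_rho by auto
  show "R_op s - R_op s0 = R_op s o\<^sub>L (lm_op (s - s0) o\<^sub>L resolvent_factor s s0)"
    by (rule blinfun_eqI) (use assms in \<open>simp add: blinfun.bilinear_simps resolvent_identity\<close>)
  show "R_op s - R_op s0 = lm_op (s - s0) o\<^sub>L (R_op s o\<^sub>L resolvent_factor s s0)"
    by (rule blinfun_eqI)
       (use assms rs in \<open>simp add: blinfun.bilinear_simps resolvent_identity R_lm algebra_simps\<close>)
  show "TR_op s - TR_op s0 = TR_op s o\<^sub>L (lm_op (s - s0) o\<^sub>L resolvent_factor s s0)"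
  proof (rule blinfun_eqI)
    fix v
    have "Tc 0 (R s v) - Tc 0 (R s0 v) = Tc 0 (R s v - R s0 v)"
      using rs by (simp add: T_diff R_D2 D2_D)
    then show "blinfun_apply (TR_op s - TR_op s0) v = blinfun_apply (TR_op s o\<^sub>L (lm_op (s - s0) o\<^sub>L resolvent_factor s s0)) v"
      using assms by (simp add: blinfun.bilinear_simps resolvent_identity)
  qed
qed

end

context sectorial
begin

text \<open>\<open>R (u + J v) = R_re (u, v) + J R_im (u, v)\<close> for every imaginary unit \<open>J\<close>; the coefficients are
  read off at \<open>J = e\<^sub>1\<close>.\<close>

definition R_re :: "real \<times> real \<Rightarrow> 'v \<Rightarrow>\<^sub>L 'v" where
  "R_re z = (1 / 2) *\<^sub>R (R_op (slice_emb (qe 1) z) + R_op (slice_emb (- qe 1) z))"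

definition R_im :: "real \<times> real \<Rightarrow> 'v \<Rightarrow>\<^sub>L 'v" where
  "R_im z = - (1 / 2) *\<^sub>R (lm_op (qe 1) o\<^sub>L (R_op (slice_emb (qe 1) z) - R_op (slice_emb (- qe 1) z)))"

lemma lm_op_slice_emb: "lm_op (slice_emb J h) = fst h *\<^sub>R id_blinfun + snd h *\<^sub>R lm_op J"
  by (rule blinfun_eqI) (simp add: slice_emb_eq blinfun.bilinear_simps lm_add_left)

lemma lm_op_0 [simp]: "lm_op 0 = 0"
  by (rule blinfun_eqI) simp

end

section \<open>Differentiability of the pseudo-resolvent along slices\<close>

context sectorial_bounds
begin

text \<open>Formally -2 R s (s - T_0) R s, the derivative of the inverse of \<open>Q s\<close>
  within a slice.\<close>

definition R_op_deriv :: "quat \<Rightarrow> 'v \<Rightarrow>\<^sub>L 'v" where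
  "R_op_deriv s = (R_op s o\<^sub>L resolvent_factor s s)"

context
  fixes \<phi>2 :: real and J :: quat
  assumes \<phi>2: "\<phi>2 < pi" and J: "J \<in> unitS"
begin

interpretation compose: bounded_bilinear "(o\<^sub>L)" by (rule bounded_bilinear_blinfun_compose)

lemma slice_emb_tendsto: "(slice_emb J \<longlongrightarrow> slice_emb J z0) (at z0 within A)"
  by (rule bounded_linear.tendsto[OF bounded_linear_slice_emb tendsto_ident_at])

lemma lm_op_slice_emb_diff_tendsto: "((\<lambda>z. lm_op (slice_emb J z - slice_emb J z0)) \<longlongrightarrow> 0) (at z0 within A)"
  using bounded_linear.tendsto[OF bounded_linear_lm_op LIM_zero[OF slice_emb_tendsto]] by simp

lemma resolvent_factor_slice_emb_tendsto:
  "((\<lambda>z. resolvent_factor (slice_emb J z) (slice_emb J z0)) \<longlongrightarrow> resolvent_factor (slice_emb J z0) (slice_emb J z0)) (at z0 within A)"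
  unfolding resolvent_factor_def diff_self lm_op_0
  by (intro tendsto_intros compose.tendsto lm_op_slice_emb_diff_tendsto)

lemma slice_emb_neq_0: "z0 \<in> polar_sector \<phi>0 \<phi>2 \<Longrightarrow> norm (slice_emb J z0) \<noteq> 0"
  using outside_sector_slice_emb[OF _ \<phi>2 J, of z0] by (simp add: outside_sector_def)

lemma continuous_on_R_op_TR_op:
  shows "continuous_on (polar_sector \<phi>0 \<phi>2) (\<lambda>z. R_op (slice_emb J z))"
    and "continuous_on (polar_sector \<phi>0 \<phi>2) (\<lambda>z. TR_op (slice_emb J z))"
proof -
  let ?S = "polar_sector \<phi>0 \<phi>2"
  \<comment> \<open>\<open>X z\<close> occurs on the right-hand side as well, so its continuity
    cannot be used there. Local boundedness suffices, supplied by the continuous majorant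
    \<open>B\<close>, because the remaining factor tends to 0.\<close>
  have *: "continuous_on ?S X"
    if X: "\<And>z z0. z \<in> ?S \<Longrightarrow> z0 \<in> ?S \<Longrightarrow>
      X z - X z0 = (X z o\<^sub>L (lm_op (slice_emb J z - slice_emb J z0) o\<^sub>L resolvent_factor (slice_emb J z) (slice_emb J z0)))"
      and B: "\<And>z. z \<in> ?S \<Longrightarrow> norm (X z) \<le> B (slice_emb J z)"
        "\<And>z. z \<in> ?S \<Longrightarrow> isCont B (slice_emb J z)"
    for X :: "real \<times> real \<Rightarrow> 'v \<Rightarrow>\<^sub>L 'v" and B :: "quat \<Rightarrow> real"
    unfolding continuous_on_def
  proof
    fix z0 assume z0: "z0 \<in> ?S"
    let ?Y = "\<lambda>z. lm_op (slice_emb J z - slice_emb J z0) o\<^sub>L resolvent_factor (slice_emb J z) (slice_emb J z0)"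
    have "(?Y \<longlongrightarrow> (0 o\<^sub>L resolvent_factor (slice_emb J z0) (slice_emb J z0))) (at z0 within ?S)"
      by (intro compose.tendsto lm_op_slice_emb_diff_tendsto resolvent_factor_slice_emb_tendsto)
    then have Y: "((\<lambda>z. norm (?Y z)) \<longlongrightarrow> 0) (at z0 within ?S)"
      by (simp add: compose.zero_left tendsto_norm_zero)
    have "((\<lambda>z. B (slice_emb J z)) \<longlongrightarrow> B (slice_emb J z0)) (at z0 within ?S)"
      using isCont_tendsto_compose[OF B(2)[OF z0] slice_emb_tendsto] .
    from tendsto_mult[OF this Y] have "((\<lambda>z. B (slice_emb J z) * norm (?Y z)) \<longlongrightarrow> 0) (at z0 within ?S)"
      by simp
    then have "((\<lambda>z. X z - X z0) \<longlongrightarrow> 0) (at z0 within ?S)"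
    proof (rule Lim_null_comparison[rotated])
      have "norm (X z - X z0) \<le> B (slice_emb J z) * norm (?Y z)" if "z \<in> ?S" for z
      proof -
        have "norm (X z - X z0) \<le> norm (X z) * norm (?Y z)"
          unfolding X[OF that z0] by (rule norm_blinfun_compose)
        also have "\<dots> \<le> B (slice_emb J z) * norm (?Y z)"
          by (rule mult_right_mono[OF B(1)[OF that]]) simp
        finally show ?thesis .
      qed
      then show "\<forall>\<^sub>F z in at z0 within ?S. norm (X z - X z0) \<le> B (slice_emb J z) * norm (?Y z)"
        by (simp add: eventually_at_filter)
    qed
    then show "(X \<longlongrightarrow> X z0) (at z0 within ?S)" by (rule LIM_zero_cancel)
  qed
  note g = outside_sector_slice_emb[OF _ \<phi>2 J]
  show "continuous_on ?S (\<lambda>z. R_op (slice_emb J z))"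
    by (rule *[of _ "\<lambda>s. C / (norm s)\<^sup>2"])
       (use slice_emb_neq_0 in \<open>auto intro!: norm_R_op R_op_diff slice_emb_commute g continuous_intros\<close>)
  show "continuous_on ?S (\<lambda>z. TR_op (slice_emb J z))"
    by (rule *[of _ "\<lambda>s. 2 * C / norm s"])
       (use slice_emb_neq_0 in \<open>auto intro!: norm_TR_op R_op_diff slice_emb_commute g continuous_intros\<close>)
qed

lemma continuous_on_R_op_deriv: "continuous_on (polar_sector \<phi>0 \<phi>2) (\<lambda>z. R_op_deriv (slice_emb J z))"
  unfolding R_op_deriv_def resolvent_factor_def diff_self lm_op_0 compose.zero_left
  by (intro continuous_intros compose.continuous_on continuous_on_R_op_TR_op
    bounded_linear.continuous_on[OF bounded_linear_lm_op] bounded_linear.continuous_on[OF bounded_linear_slice_emb])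

lemma has_derivative_R_op:
  assumes z0: "z0 \<in> polar_sector \<phi>0 \<phi>2"
  shows "((\<lambda>z. R_op (slice_emb J z)) has_derivative
     (\<lambda>h. fst h *\<^sub>R R_op_deriv (slice_emb J z0) + snd h *\<^sub>R (lm_op J o\<^sub>L R_op_deriv (slice_emb J z0)))) (at z0 within polar_sector \<phi>0 \<phi>2)"
proof -
  note g = outside_sector_slice_emb[OF _ \<phi>2 J]
  have "((\<lambda>z. R_op (slice_emb J z)) has_derivative (\<lambda>h. lm_op (slice_emb J h) o\<^sub>L R_op_deriv (slice_emb J z0)))
    (at z0 within polar_sector \<phi>0 \<phi>2)"
  proof (rule has_derivative_Caratheodory[OF compose.bounded_bilinear_axioms bounded_linear_compose[OF bounded_linear_lm_op bounded_linear_slice_emb] z0])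
    fix z assume "z \<in> polar_sector \<phi>0 \<phi>2"
    then show "R_op (slice_emb J z) - R_op (slice_emb J z0) =
       (lm_op (slice_emb J (z - z0)) o\<^sub>L (R_op (slice_emb J z) o\<^sub>L resolvent_factor (slice_emb J z) (slice_emb J z0)))"
      unfolding slice_emb_diff using z0 by (intro R_op_diff g slice_emb_commute)
  next
    show "((\<lambda>z. R_op (slice_emb J z) o\<^sub>L resolvent_factor (slice_emb J z) (slice_emb J z0)) \<longlongrightarrow> R_op_deriv (slice_emb J z0))
      (at z0 within polar_sector \<phi>0 \<phi>2)"
      unfolding R_op_deriv_def using continuous_on_R_op_TR_op(1) z0
      by (intro compose.tendsto resolvent_factor_slice_emb_tendsto) (simp add: continuous_on_def)
  qed
  moreover have "(id_blinfun o\<^sub>L X) = X" for X :: "'v \<Rightarrow>\<^sub>L 'v"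
    by (rule blinfun_eqI) simp
  ultimately show ?thesis
    by (simp add: lm_op_slice_emb compose.add_left compose.scaleR_left)
qed

end

definition R_re_deriv :: "real \<times> real \<Rightarrow> 'v \<Rightarrow>\<^sub>L 'v" where
  "R_re_deriv z = (1 / 2) *\<^sub>R (R_op_deriv (slice_emb (qe 1) z) + R_op_deriv (slice_emb (- qe 1) z))"

definition R_im_deriv :: "real \<times> real \<Rightarrow> 'v \<Rightarrow>\<^sub>L 'v" where
  "R_im_deriv z = - (1 / 2) *\<^sub>R (lm_op (qe 1) o\<^sub>L (R_op_deriv (slice_emb (qe 1) z) - R_op_deriv (slice_emb (- qe 1) z)))"

text \<open>The derivatives in the slices of e1 and - e1 contain left multiplication by e1 and - e1.
  Half sum and half difference turn this into multiplication by the formal imaginary unit.\<close>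

lemma CR_pair_resolvent:
  assumes "\<phi>2 < pi"
  shows "CR_pair (polar_sector \<phi>0 \<phi>2) R_re R_im R_re_deriv R_im_deriv"
proof -
  interpret compose: bounded_bilinear "(o\<^sub>L)" by (rule bounded_bilinear_blinfun_compose)
  note e = qe_unitS unitS_minus[OF qe_unitS]
  note l = bounded_linear.has_derivative[OF compose.bounded_linear_right]
  note simps = blinfun.bilinear_simps lm_lm scaleR_add_right scaleR_diff_right
  show ?thesis unfolding CR_pair_def
  proof (intro conjI ballI)
    show "continuous_on (polar_sector \<phi>0 \<phi>2) R_re_deriv" "continuous_on (polar_sector \<phi>0 \<phi>2) R_im_deriv"
      unfolding R_re_deriv_def R_im_deriv_def
      by (intro continuous_intros compose.continuous_on continuous_on_R_op_deriv assms e)+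
  next
    fix z assume z: "z \<in> polar_sector \<phi>0 \<phi>2"
    note d = has_derivative_R_op[OF assms e(1) z] has_derivative_R_op[OF assms e(2) z]
    show "(R_re has_derivative (\<lambda>h. fst h *\<^sub>R R_re_deriv z - snd h *\<^sub>R R_im_deriv z)) (at z within polar_sector \<phi>0 \<phi>2)"
      unfolding R_re_def[abs_def]
      by (rule has_derivative_eq_rhs[OF has_derivative_scaleR_right[OF has_derivative_add[OF d]]])
        (auto simp: fun_eq_iff R_re_deriv_def R_im_deriv_def simps intro!: blinfun_eqI)
    show "(R_im has_derivative (\<lambda>h. fst h *\<^sub>R R_im_deriv z + snd h *\<^sub>R R_re_deriv z)) (at z within polar_sector \<phi>0 \<phi>2)"
      unfolding R_im_def[abs_def]
      by (rule has_derivative_eq_rhs[OF has_derivative_scaleR_right[OF l[OF has_derivative_diff[OF d]]]])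
        (auto simp: fun_eq_iff R_re_deriv_def R_im_deriv_def simps intro!: blinfun_eqI)
  qed
qed

section \<open>Representation formula for the pseudo-resolvent\<close>

context
  fixes \<phi>2 :: real and z :: "real \<times> real"
  assumes \<phi>2: "\<phi>2 < pi" and z: "z \<in> polar_sector \<phi>0 \<phi>2"
begin

lemma outside_sector_z: "J \<in> unitS \<Longrightarrow> outside_sector (slice_emb J z)"
  by (rule outside_sector_slice_emb[OF z \<phi>2])

lemma R_op_conj:
  assumes "J \<in> unitS" "J' \<in> unitS" "e * J = J' * e"
  shows "lm e (blinfun_apply (R_op (slice_emb J z)) v) = blinfun_apply (R_op (slice_emb J' z)) (lm e v)"
proof -
  have "e * slice_emb J z = slice_emb J' z * e"
    using assms(3) by (simp add: slice_emb_eq algebra_simps of_real_commute_quat)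
  then show ?thesis
    using outside_sector_z[OF assms(1)] outside_sector_z[OF assms(2)] by (simp add: R_lm_conj outside_sector_rho)
qed

text \<open>Left multiplication by e1 commutes with the values at both slices. Multiplication by e2
  exchanges the slices of e1 and - e1: the half sum is unchanged, and in the half difference the
  sign is compensated by e2 e1 = - e1 e2. The remaining unit is e3 = e1 e2.\<close>

lemma R_re_R_im_central:
  "lm q (blinfun_apply (R_re z) v) = blinfun_apply (R_re z) (lm q v)"
  "lm q (blinfun_apply (R_im z) v) = blinfun_apply (R_im z) (lm q v)"
proof -
  note e = qe_unitS unitS_minus[OF qe_unitS]
  have c1: "lm (qe 1) (blinfun_apply (R_op (slice_emb (qe 1) z)) v) = blinfun_apply (R_op (slice_emb (qe 1) z)) (lm (qe 1) v)"
    "lm (qe 1) (blinfun_apply (R_op (slice_emb (- qe 1) z)) v) = blinfun_apply (R_op (slice_emb (- qe 1) z)) (lm (qe 1) v)" for v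
    by (intro R_op_conj e; simp)+
  have c2: "lm (qe 2) (blinfun_apply (R_op (slice_emb (qe 1) z)) v) = blinfun_apply (R_op (slice_emb (- qe 1) z)) (lm (qe 2) v)"
    "lm (qe 2) (blinfun_apply (R_op (slice_emb (- qe 1) z)) v) = blinfun_apply (R_op (slice_emb (qe 1) z)) (lm (qe 2) v)" for v
    by (intro R_op_conj e; simp)+
  have G1: "lm (qe 1) (blinfun_apply (R_re z) v) = blinfun_apply (R_re z) (lm (qe 1) v)"
    and G2: "lm (qe 2) (blinfun_apply (R_re z) v) = blinfun_apply (R_re z) (lm (qe 2) v)" for v
    by (simp_all add: R_re_def blinfun.bilinear_simps c1 c2 add.commute del: qe_simps One_nat_def)
  have H1: "lm (qe 1) (blinfun_apply (R_im z) v) = blinfun_apply (R_im z) (lm (qe 1) v)" for v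
    by (simp add: R_im_def blinfun.bilinear_simps c1 del: qe_simps One_nat_def)
  have H2: "lm (qe 2) (blinfun_apply (R_im z) v) = blinfun_apply (R_im z) (lm (qe 2) v)" for v
  proof -
    have "qe 2 * qe 1 = - (qe 1 * qe 2)" by simp
    then have "lm (qe 2) (lm (qe 1) w) = - lm (qe 1) (lm (qe 2) w)" for w
      by (simp only: lm_lm lm_minus_left)
    then show ?thesis
      by (simp add: R_im_def blinfun.bilinear_simps c2 del: qe_simps One_nat_def)
  qed
  have gen: "lm q (blinfun_apply X v) = blinfun_apply X (lm q v)"
    if "\<And>v. lm (qe 1) (blinfun_apply X v) = blinfun_apply X (lm (qe 1) v)"
       "\<And>v. lm (qe 2) (blinfun_apply X v) = blinfun_apply X (lm (qe 2) v)" for X :: "'v \<Rightarrow>\<^sub>L 'v" and v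
  proof -
    have "lm (qe 3) (blinfun_apply X v) = blinfun_apply X (lm (qe 3) v)"
    proof -
      have "qe 3 = qe 1 * qe 2" by simp
      then show ?thesis by (metis lm_lm that)
    qed
    moreover have q: "q = of_real (re0 q) + im1 q *\<^sub>R qe 1 + im2 q *\<^sub>R qe 2 + im3 q *\<^sub>R qe 3"
      by (simp add: quat_eqI of_real_quat plus_quat_def scaleR_quat_def)
    show ?thesis
      by (subst (1 2) q) (simp add: lm_add_left blinfun.bilinear_simps that calculation del: qe_simps One_nat_def)
  qed
  show "lm q (blinfun_apply (R_re z) v) = blinfun_apply (R_re z) (lm q v)" by (rule gen[OF G1 G2])
  show "lm q (blinfun_apply (R_im z) v) = blinfun_apply (R_im z) (lm q v)" by (rule gen[OF H1 H2])
qed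

lemma R_op_slice_emb:
  assumes J: "J \<in> unitS"
  shows "R_op (slice_emb J z) = R_re z + (lm_op J o\<^sub>L R_im z)"
proof (cases "J = - qe 1")
  case True
  show ?thesis unfolding True
    by (rule blinfun_eqI) (simp add: R_re_def R_im_def blinfun.bilinear_simps lm_lm scaleR_add_right scaleR_diff_right flip: scaleR_left_distrib)
next
  case False
  \<comment> \<open>Since (J + e1) e1 = J (J + e1), conjugation by this quaternion carries e1 to J.
    It vanishes exactly for J = - e1, the case treated before.\<close>
  define e where "e = J + qe 1"
  have "e \<noteq> 0" using False by (auto simp: e_def eq_neg_iff_add_eq_0)
  have eJ: "e * qe 1 = J * e"
    using unitS_square[OF J] unitS_square[OF qe_unitS] by (simp add: e_def algebra_simps del: qe_simps One_nat_def)
  have base: "R_op (slice_emb (qe 1) z) = R_re z + (lm_op (qe 1) o\<^sub>L R_im z)"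
    by (rule blinfun_eqI) (simp add: R_re_def R_im_def blinfun.bilinear_simps lm_lm scaleR_add_right scaleR_diff_right flip: scaleR_left_distrib)
  show ?thesis
  proof (rule blinfun_eqI)
    fix v
    define w where "w = lm (inverse e) v"
    have v: "v = lm e w" using \<open>e \<noteq> 0\<close> by (simp add: w_def lm_lm)
    have "blinfun_apply (R_op (slice_emb J z)) v = lm e (blinfun_apply (R_op (slice_emb (qe 1) z)) w)"
      unfolding v by (rule R_op_conj[OF qe_unitS J eJ, symmetric])
    also have "\<dots> = lm e (blinfun_apply (R_re z) w) + lm (e * qe 1) (blinfun_apply (R_im z) w)"
      unfolding base by (simp add: blinfun.bilinear_simps lm_lm del: qe_simps One_nat_def)
    also have "\<dots> = blinfun_apply (R_re z + (lm_op J o\<^sub>L R_im z)) v"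
      unfolding eJ v by (simp add: blinfun.bilinear_simps R_re_R_im_central lm_lm[symmetric])
    finally show "blinfun_apply (R_op (slice_emb J z)) v = blinfun_apply (R_re z + (lm_op J o\<^sub>L R_im z)) v" .
  qed
qed

end

end

section \<open>Slice functions with the same Cauchy-Fueter image\<close>

lemma slice_emb_polar_sector: "t > 0 \<Longrightarrow> \<bar>\<phi>\<bar> < \<theta> \<Longrightarrow> J \<in> unitS \<Longrightarrow> slice_emb J (polar t \<phi>) \<in> sector \<theta>"
  unfolding sector_def slice_emb_polar by blast

lemma polar_slice_dom: "t > 0 \<Longrightarrow> \<bar>\<phi>\<bar> < \<theta> \<Longrightarrow> polar t \<phi> \<in> slice_dom (sector \<theta>)"
  using slice_emb_polar_sector[of t \<phi> \<theta>] by (auto simp: slice_dom_def slice_emb_def polar_def)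

lemma slice_rep_eq:
  "slice_rep m U f \<alpha> \<beta> \<Longrightarrow> z \<in> slice_dom U \<Longrightarrow> J \<in> unitS \<Longrightarrow> f (slice_emb J z) = \<alpha> z + m J (\<beta> z)"
  unfolding slice_rep_def slice_emb_def by (cases z) auto

lemma decay_Q_tendsto_0:
  assumes "decay_Q \<theta> f" "\<bar>\<phi>\<bar> < \<theta>" "J \<in> unitS"
  shows "((\<lambda>t. f (slice_emb J (polar t \<phi>))) \<longlongrightarrow> 0) (at_right 0)"
proof -
  obtain a C where a: "a > 0" and
    le: "\<And>s. s \<in> sector \<theta> \<Longrightarrow> norm (f s) \<le> C * norm s powr (1 + a) / (1 + norm s powr (1 + 2 * a))"
    using assms(1) unfolding decay_Q_def by blast
  have "((\<lambda>t. C * (t powr (1 + a) / (1 + t powr (1 + 2 * a)))) \<longlongrightarrow> C * 0) (at_right 0)"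
    using a by (intro tendsto_intros) real_asymp
  then have lim: "((\<lambda>t. C * (t powr (1 + a) / (1 + t powr (1 + 2 * a)))) \<longlongrightarrow> 0) (at_right 0)"
    by simp
  show ?thesis
  proof (rule Lim_null_comparison[OF _ lim])
    show "\<forall>\<^sub>F t in at_right 0. norm (f (slice_emb J (polar t \<phi>))) \<le> C * (t powr (1 + a) / (1 + t powr (1 + 2 * a)))"
      using eventually_at_right_less[of "0::real"]
    proof eventually_elim
      case (elim t)
      then show ?case
        using le[OF slice_emb_polar_sector[OF elim assms(2,3)]] assms(3) by (simp add: norm_slice_emb_polar)
    qed
  qed
qed

context quat_side
begin

text \<open>Off the real axis the Cauchy-Fueter operator recovers \<open>\<beta>\<close>; then \<open>\<alpha>\<close> is determined along each ray
  up to a constant by the Cauchy-Riemann equations, and the decay at \<open>0\<close> fixes the constant.\<close>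

lemma slice_functions_agree:
  assumes f: "slice_rep m (sector \<theta>) f \<alpha> \<beta>" and g: "slice_rep m (sector \<theta>) g \<alpha>' \<beta>'"
    and U: "open (sector \<theta>)" "axially_symmetric (sector \<theta>)"
    and decay: "decay_Q \<theta> f" "decay_Q \<theta> g"
    and CF: "\<And>q. q \<in> sector \<theta> \<Longrightarrow> (\<Sum>i<4. m (qe i) (frechet_derivative f (at q) (qe i)))
      = (\<Sum>i<4. m (qe i) (frechet_derivative g (at q) (qe i)))"
    and \<phi>: "0 < \<phi>" "\<phi> < \<theta>" and \<theta>: "\<theta> \<le> pi" and t: "t > 0" and J: "J \<in> unitS"
  shows "f (slice_emb J (polar t \<phi>)) = g (slice_emb J (polar t \<phi>))"
proof -
  have \<beta>: "\<beta> (polar t \<phi>) = \<beta>' (polar t \<phi>)" if t: "t > 0" and \<phi>: "0 < \<phi>" "\<phi> < \<theta>" for t \<phi>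
  proof -
    have v: "t * sin \<phi> > 0" using t \<phi> \<theta> sin_gt_zero[of \<phi>] by simp
    define q where "q = slice_emb (qe 1) (polar t \<phi>)"
    have q: "q \<in> sector \<theta>" unfolding q_def by (rule slice_emb_polar_sector[OF t _ qe_unitS]) (use \<phi> in simp)
    have re: "re0 q = t * cos \<phi>" unfolding q_def re0_slice_emb[OF qe_unitS] by (simp add: polar_def)
    have "quat_im q = (t * sin \<phi>) *\<^sub>R qe 1"
      unfolding quat_im_def re unfolding q_def slice_emb_eq by (simp add: polar_def)
    then have n: "norm (quat_im q) = t * sin \<phi>"
      using v norm_unitS[OF qe_unitS] by (simp del: qe_simps)
    then have "quat_im q \<noteq> 0" using v by auto
    note C = Cauchy_Fueter_slice[OF _ U q this]
    have "(2 / (t * sin \<phi>)) *\<^sub>R \<beta> (polar t \<phi>) = (2 / (t * sin \<phi>)) *\<^sub>R \<beta>' (polar t \<phi>)"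
      using CF[OF q] unfolding C[OF f] C[OF g] re n polar_def by simp
    then show ?thesis using v t by auto
  qed
  have pd: "polar t \<phi> \<in> slice_dom (sector \<theta>)" if "t > 0" for t
    using polar_slice_dom[OF that, of \<phi> \<theta>] \<phi> by simp
  define d where "d z = \<alpha> z - \<alpha>' z" for z
  have "((\<lambda>t. d (polar t \<phi>)) has_vector_derivative 0) (at t)" if t: "t > 0" for t
  proof -
    let ?z = "(t * cos \<phi>, t * sin \<phi>)"
    have z: "?z \<in> slice_dom (sector \<theta>)" using pd[OF t] by (simp add: polar_def)
    note df = slice_rep_has_derivative[OF f z]
    note dg = slice_rep_has_derivative[OF g z]
    define a where "a = pd_u \<alpha> ?z - pd_u \<alpha>' ?z"
    define b where "b = pd_u \<beta> ?z - pd_u \<beta>' ?z"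
    have "(d has_derivative (\<lambda>h. fst h *\<^sub>R a - snd h *\<^sub>R b)) (at ?z)"
      unfolding d_def[abs_def]
      by (rule has_derivative_eq_rhs[OF has_derivative_diff[OF df(1) dg(1)]])
        (simp add: fun_eq_iff a_def b_def algebra_simps)
    then have "(d has_derivative (\<lambda>h. fst h *\<^sub>R a - snd h *\<^sub>R b)) (at (polar t \<phi>))"
      by (simp add: polar_def)
    moreover have "((\<lambda>t. polar t \<phi>) has_derivative (\<lambda>h. (h * cos \<phi>, h * sin \<phi>))) (at t)"
      unfolding polar_def by (auto intro!: derivative_eq_intros)
    ultimately have 1: "((\<lambda>t. d (polar t \<phi>)) has_derivative (\<lambda>h. (h * cos \<phi>) *\<^sub>R a - (h * sin \<phi>) *\<^sub>R b)) (at t)"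
      by (auto dest: has_derivative_compose)
    have "((\<lambda>z. \<beta> z - \<beta>' z) has_derivative (\<lambda>h. fst h *\<^sub>R b + snd h *\<^sub>R a)) (at ?z)"
      by (rule has_derivative_eq_rhs[OF has_derivative_diff[OF df(2) dg(2)]])
        (simp add: fun_eq_iff a_def b_def algebra_simps)
    then have "((\<lambda>z. \<beta> z - \<beta>' z) has_derivative (\<lambda>h. fst h *\<^sub>R b + snd h *\<^sub>R a)) (at (polar t \<phi>))"
      by (simp add: polar_def)
    moreover have "(polar t has_derivative (\<lambda>h. (t * (- sin \<phi> * h), t * (cos \<phi> * h)))) (at \<phi>)"
      unfolding polar_def by (auto intro!: derivative_eq_intros)
    ultimately have "((\<lambda>\<phi>. \<beta> (polar t \<phi>) - \<beta>' (polar t \<phi>)) has_derivative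
        (\<lambda>h. (t * (- sin \<phi> * h)) *\<^sub>R b + (t * (cos \<phi> * h)) *\<^sub>R a)) (at \<phi>)"
      by (auto dest: has_derivative_compose)
    \<comment> \<open>The two \<beta> agree at every angle in (0, \<theta>), so the angular
      derivative of their difference is 0. By the Cauchy-Riemann equations it is t times the radial
      derivative of \<open>d\<close>.\<close>
    moreover have "((\<lambda>\<phi>. \<beta> (polar t \<phi>) - \<beta>' (polar t \<phi>)) has_derivative (\<lambda>h. 0)) (at \<phi>)"
      by (rule has_derivative_transform_within_open[of "\<lambda>_. 0" _ _ _ "{0<..<\<theta>}"])
         (use \<phi> \<beta>[OF t] in auto)
    ultimately have "(\<lambda>h. (t * (- sin \<phi> * h)) *\<^sub>R b + (t * (cos \<phi> * h)) *\<^sub>R a) = (\<lambda>h. 0)"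
      by (rule has_derivative_unique)
    from fun_cong[OF this, of 1] have "t *\<^sub>R (cos \<phi> *\<^sub>R a - sin \<phi> *\<^sub>R b) = 0"
      by (simp add: algebra_simps)
    then have "cos \<phi> *\<^sub>R a - sin \<phi> *\<^sub>R b = 0" using t by simp
    then have "(h * cos \<phi>) *\<^sub>R a - (h * sin \<phi>) *\<^sub>R b = 0" for h
      by (metis scaleR_scaleR scaleR_diff_right scaleR_zero_right)
    with 1 show ?thesis by (simp add: has_vector_derivative_def)
  qed
  note 0 = has_vector_derivative_at_within[OF this]
  obtain c where c: "\<And>t. t \<in> {0<..} \<Longrightarrow> d (polar t \<phi>) = c"
    by (rule has_vector_derivative_zero_constant[of "{0<..}" "\<lambda>t. d (polar t \<phi>)"]) (use 0 in auto)
  have eq: "f (slice_emb J (polar t \<phi>)) - g (slice_emb J (polar t \<phi>)) = c" if t: "t > 0" for t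
    using c[of t] t \<beta>[OF t \<phi>] by (simp add: slice_rep_eq[OF f pd[OF t] J] slice_rep_eq[OF g pd[OF t] J] d_def)
  have "((\<lambda>t. f (slice_emb J (polar t \<phi>)) - g (slice_emb J (polar t \<phi>))) \<longlongrightarrow> 0 - 0) (at_right 0)"
    by (rule tendsto_diff[OF decay_Q_tendsto_0[OF decay(1) _ J] decay_Q_tendsto_0[OF decay(2) _ J]])
       (use \<phi> in auto)
  moreover have "((\<lambda>t. f (slice_emb J (polar t \<phi>)) - g (slice_emb J (polar t \<phi>))) \<longlongrightarrow> c) (at_right 0)"
    by (rule tendsto_eventually)
       (use eventually_at_right_less[of "0::real"] in \<open>eventually_elim, simp add: eq\<close>)
  ultimately have "0 - 0 = c" by (rule tendsto_unique[rotated]) simp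
  then have "c = 0" by simp
  with eq[OF t] show ?thesis by simp
qed

end

section \<open>The integrals along the boundary of a sector\<close>

lemma qexpJ_minus: "qexpJ J (- \<phi>) = qexpJ (- J) \<phi>"
  by (simp add: qexpJ_def)

lemma inverse_unitS: "J \<in> unitS \<Longrightarrow> inverse J = - J"
  by (rule inverse_unique) (simp add: unitS_square)

lemma spath_polar:
  assumes "t > 0"
  shows "spath J \<phi> t = slice_emb (- J) (polar t \<phi>)" "spath J \<phi> (- t) = slice_emb J (polar t \<phi>)"
    "spath' J \<phi> t = qexpJ (- J) \<phi>" "spath' J \<phi> (- t) = - qexpJ J \<phi>"
  using assms by (simp_all add: spath_def spath'_def slice_emb_polar qexpJ_minus)

lemma qexpJ_times_unitS: "K \<in> unitS \<Longrightarrow> qexpJ K \<phi> * K = cos \<phi> *\<^sub>R K - sin \<phi> *\<^sub>R 1"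
  by (simp add: qexpJ_def of_real_def algebra_simps unitS_square)

lemma slice_rep_CR_pair:
  assumes "slice_rep m U f \<alpha> \<beta>" "S \<subseteq> slice_dom U"
  shows "CR_pair S \<alpha> \<beta> (pd_u \<alpha>) (pd_u \<beta>)"
  unfolding CR_pair_def
proof (intro conjI ballI)
  show "continuous_on S (pd_u \<alpha>)" "continuous_on S (pd_u \<beta>)"
    using slice_rep_continuous_pd[OF assms(1)] continuous_on_subset assms(2) by blast+
  fix z assume "z \<in> S"
  then have z: "(fst z, snd z) \<in> slice_dom U" using assms(2) by auto
  show "(\<alpha> has_derivative (\<lambda>h. fst h *\<^sub>R pd_u \<alpha> z - snd h *\<^sub>R pd_u \<beta> z)) (at z within S)"
    "(\<beta> has_derivative (\<lambda>h. fst h *\<^sub>R pd_u \<beta> z + snd h *\<^sub>R pd_u \<alpha> z)) (at z within S)"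
    using slice_rep_has_derivative[OF assms(1) z]
    by (auto intro: has_derivative_at_withinI simp: case_prod_beta')
qed

lemma (in quat_side) slice_rep_norm_le:
  assumes "slice_rep m U f \<alpha> \<beta>" "z \<in> slice_dom U" "J \<in> unitS"
    and "norm (f (slice_emb J z)) \<le> M" "norm (f (slice_emb (- J) z)) \<le> M"
  shows "norm (\<alpha> z) \<le> M" "norm (\<beta> z) \<le> M"
proof -
  note f = slice_rep_eq[OF assms(1,2)]
  have "2 *\<^sub>R \<alpha> z = f (slice_emb J z) + f (slice_emb (- J) z)"
    using assms(3) by (simp add: f unitS_minus minus_left scaleR_2)
  then have "2 * norm (\<alpha> z) \<le> M + M"
    using norm_triangle_mono[OF assms(4,5)] by (metis norm_scaleR abs_numeral)
  then show "norm (\<alpha> z) \<le> M" by simp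
  have "m J (2 *\<^sub>R \<beta> z) = f (slice_emb J z) - f (slice_emb (- J) z)"
    using assms(3) by (simp add: f unitS_minus minus_left scaleR_2 add_right)
  then have "norm (m J (2 *\<^sub>R \<beta> z)) \<le> M + M"
    using norm_triangle_ineq4[of "f (slice_emb J z)" "f (slice_emb (- J) z)"] assms(4,5) by simp
  then show "norm (\<beta> z) \<le> M" by (simp add: norm_m norm_unitS[OF assms(3)])
qed

context sectorial
begin

text \<open>The formal real and imaginary parts of \<open>(u + i v) (R_re + i R_im) (\<alpha> + i \<beta>)\<close>.\<close>

definition kernel_re :: "(real \<times> real \<Rightarrow> quat) \<Rightarrow> (real \<times> real \<Rightarrow> quat) \<Rightarrow> real \<times> real \<Rightarrow> 'v \<Rightarrow>\<^sub>L 'v" where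
  "kernel_re \<alpha> \<beta> z = (R_re z o\<^sub>L lm_op (fst z *\<^sub>R \<alpha> z - snd z *\<^sub>R \<beta> z)) - (R_im z o\<^sub>L lm_op (fst z *\<^sub>R \<beta> z + snd z *\<^sub>R \<alpha> z))"

definition kernel_im :: "(real \<times> real \<Rightarrow> quat) \<Rightarrow> (real \<times> real \<Rightarrow> quat) \<Rightarrow> real \<times> real \<Rightarrow> 'v \<Rightarrow>\<^sub>L 'v" where
  "kernel_im \<alpha> \<beta> z = (R_re z o\<^sub>L lm_op (fst z *\<^sub>R \<beta> z + snd z *\<^sub>R \<alpha> z)) + (R_im z o\<^sub>L lm_op (fst z *\<^sub>R \<alpha> z - snd z *\<^sub>R \<beta> z))"

text \<open>The path runs through the ray in direction \<open>K = J\<close> for negative and in direction \<open>K = - J\<close> for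
  positive parameters; in both cases \<open>\<gamma>' J\<inverse>\<close> is \<open>qexpJ K \<phi> * K\<close>.\<close>

definition ray_L :: "(quat \<Rightarrow> quat) \<Rightarrow> real \<Rightarrow> quat \<Rightarrow> real \<Rightarrow> 'v \<Rightarrow>\<^sub>L 'v" where
  "ray_L f \<phi> K t = (R_op (slice_emb K (polar t \<phi>)) o\<^sub>L lm_op (qexpJ K \<phi> * K * f (slice_emb K (polar t \<phi>))))"

definition ray_R :: "(quat \<Rightarrow> quat) \<Rightarrow> real \<Rightarrow> quat \<Rightarrow> real \<Rightarrow> 'v \<Rightarrow>\<^sub>L 'v" where
  "ray_R f \<phi> K t = (lm_op (f (slice_emb K (polar t \<phi>)) * qexpJ K \<phi> * K) o\<^sub>L R_op (slice_emb K (polar t \<phi>)))"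

end

context sectorial_bounds
begin

lemma polar_mem: "t > 0 \<Longrightarrow> polar t \<phi>0 \<in> polar_sector \<phi>0 \<phi>0"
  by (rule polar_in_polar_sector) auto

lemma outside_sector_polar: "t > 0 \<Longrightarrow> J \<in> unitS \<Longrightarrow> outside_sector (slice_emb J (polar t \<phi>0))"
  using outside_sector_slice_emb[OF polar_mem \<phi>0(2)] .

lemma kerL_eq:
  assumes J: "J \<in> unitS" and t: "t > 0"
  shows "kerL lm D Tc f J \<phi>0 t = blinfun_apply (ray_L f \<phi>0 (- J) t)"
    "kerL lm D Tc f J \<phi>0 (- t) = blinfun_apply (ray_L f \<phi>0 J t)"
  using outside_sector_polar[OF t J] outside_sector_polar[OF t unitS_minus[OF J]]
  by (auto simp: fun_eq_iff kerL_def ray_L_def spath_polar[OF t] inverse_unitS[OF J])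

lemma kerR_eq:
  assumes J: "J \<in> unitS" and t: "t > 0"
  shows "kerR lm D Tc f J \<phi>0 t = blinfun_apply (ray_R f \<phi>0 (- J) t)"
    "kerR lm D Tc f J \<phi>0 (- t) = blinfun_apply (ray_R f \<phi>0 J t)"
  using outside_sector_polar[OF t J] outside_sector_polar[OF t unitS_minus[OF J]]
  by (auto simp: fun_eq_iff kerR_def ray_R_def spath_polar[OF t] inverse_unitS[OF J])

lemma norm_kernel:
  assumes K: "K \<in> unitS" and t: "t > 0"
  shows "norm (ray_L f \<phi>0 K t) \<le> C / t\<^sup>2 * norm (f (slice_emb K (polar t \<phi>0)))"
    "norm (ray_R f \<phi>0 K t) \<le> C / t\<^sup>2 * norm (f (slice_emb K (polar t \<phi>0)))"
proof -
  have R: "norm (R_op (slice_emb K (polar t \<phi>0))) \<le> C / t\<^sup>2"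
    using norm_R_op[OF outside_sector_polar[OF t K]] t by (simp add: norm_slice_emb_polar[OF K])
  have L: "norm (lm_op (qexpJ K \<phi>0 * K * q)) \<le> norm q" "norm (lm_op (q * qexpJ K \<phi>0 * K)) \<le> norm q" for q
    using norm_lm_op[of "qexpJ K \<phi>0 * K * q"] norm_lm_op[of "q * qexpJ K \<phi>0 * K"]
    by (simp_all add: norm_mult norm_qexpJ[OF K] norm_unitS[OF K])
  show "norm (ray_L f \<phi>0 K t) \<le> C / t\<^sup>2 * norm (f (slice_emb K (polar t \<phi>0)))"
    unfolding ray_L_def using C
    by (intro order.trans[OF norm_blinfun_compose] mult_mono R L) auto
  show "norm (ray_R f \<phi>0 K t) \<le> C / t\<^sup>2 * norm (f (slice_emb K (polar t \<phi>0)))"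
    unfolding ray_R_def using C
    by (intro order.trans[OF norm_blinfun_compose] order.trans[OF mult_mono[OF L(2) R]]) (auto simp: mult.commute)
qed

text \<open>On the ray of K the kernel is an even part, free of K, plus a part odd in K; adding the
  rays of J and - J cancels the latter. Centrality of \<open>R_re\<close> and \<open>R_im\<close>
  makes the even part the same for both orders of multiplication.\<close>

lemma sum_kernel:
  assumes J: "J \<in> unitS" and t: "t > 0" and dom: "polar t \<phi>0 \<in> slice_dom U"
  shows "slice_rep (*) U f \<alpha> \<beta> \<Longrightarrow>
      ray_L f \<phi>0 J t + ray_L f \<phi>0 (- J) t = - 2 *\<^sub>R (kernel_im \<alpha> \<beta> (polar t \<phi>0) /\<^sub>R t)"
    and "slice_rep (\<lambda>x y. y * x) U f \<alpha> \<beta> \<Longrightarrow>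
      ray_R f \<phi>0 J t + ray_R f \<phi>0 (- J) t = - 2 *\<^sub>R (kernel_im \<alpha> \<beta> (polar t \<phi>0) /\<^sub>R t)"
proof -
  define z where "z = polar t \<phi>0"
  have z: "z \<in> polar_sector \<phi>0 \<phi>0" unfolding z_def by (rule polar_mem[OF t])
  \<comment> \<open>r + i p is e^(i \<phi>0) (\<alpha> + i \<beta>), that is, z (\<alpha> + i
    \<beta>) with the factor t removed.\<close>
  define p where "p = sin \<phi>0 *\<^sub>R \<alpha> z + cos \<phi>0 *\<^sub>R \<beta> z"
  define r where "r = cos \<phi>0 *\<^sub>R \<alpha> z - sin \<phi>0 *\<^sub>R \<beta> z"
  note c = R_re_R_im_central[OF \<phi>0(2) z]
  note simps = blinfun.bilinear_simps lm_add_left lm_diff_left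
  have R_op: "R_op (slice_emb K z) = R_re z + (lm_op K o\<^sub>L R_im z)" if "K \<in> unitS" for K
    using R_op_slice_emb[OF \<phi>0(2) z that] .
  have AB: "fst z *\<^sub>R \<beta> z + snd z *\<^sub>R \<alpha> z = t *\<^sub>R p" "fst z *\<^sub>R \<alpha> z - snd z *\<^sub>R \<beta> z = t *\<^sub>R r"
    by (simp_all add: p_def r_def z_def polar_def algebra_simps)
  have Q: "blinfun_apply (kernel_im \<alpha> \<beta> z /\<^sub>R t) v = blinfun_apply (R_re z) (lm p v) + blinfun_apply (R_im z) (lm r v)" for v
    unfolding kernel_im_def AB using t by (simp add: simps scaleR_add_right)
  have Q2: "blinfun_apply (- 2 *\<^sub>R (kernel_im \<alpha> \<beta> z /\<^sub>R t)) v
      = - (2 *\<^sub>R (blinfun_apply (R_re z) (lm p v) + blinfun_apply (R_im z) (lm r v)))" for v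
    unfolding Q[symmetric] by (simp add: blinfun.bilinear_simps)
  show "ray_L f \<phi>0 J t + ray_L f \<phi>0 (- J) t = - 2 *\<^sub>R (kernel_im \<alpha> \<beta> (polar t \<phi>0) /\<^sub>R t)"
    if rep: "slice_rep (*) U f \<alpha> \<beta>"
  proof (rule blinfun_eqI)
    have X: "blinfun_apply (ray_L f \<phi>0 K t) v = - (blinfun_apply (R_re z) (lm p v) + blinfun_apply (R_im z) (lm r v))
       + lm K (blinfun_apply (R_re z) (lm r v) - blinfun_apply (R_im z) (lm p v))" if K: "K \<in> unitS" for K v
    proof -
      have "qexpJ K \<phi>0 * K * f (slice_emb K z) = - p + K * r"
        unfolding qexpJ_times_unitS[OF K] slice_rep_eq[OF rep dom[folded z_def] K] p_def r_def
        by (simp add: algebra_simps unitS_square[OF K] mult.assoc[symmetric])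
      then show ?thesis
        unfolding ray_L_def z_def[symmetric] R_op[OF K]
        by (simp add: simps lm_lm[symmetric] c[symmetric] lm_lm[of K K] unitS_square[OF K] del: lm_minus)
    qed
    fix v
    show "blinfun_apply (ray_L f \<phi>0 J t + ray_L f \<phi>0 (- J) t) v = blinfun_apply (- 2 *\<^sub>R (kernel_im \<alpha> \<beta> (polar t \<phi>0) /\<^sub>R t)) v"
      unfolding z_def[symmetric] Q2 blinfun.add_left X[OF J] X[OF unitS_minus[OF J]]
      by (simp add: scaleR_2)
  qed
  show "ray_R f \<phi>0 J t + ray_R f \<phi>0 (- J) t = - 2 *\<^sub>R (kernel_im \<alpha> \<beta> (polar t \<phi>0) /\<^sub>R t)"
    if rep: "slice_rep (\<lambda>x y. y * x) U f \<alpha> \<beta>"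
  proof (rule blinfun_eqI)
    have X: "blinfun_apply (ray_R f \<phi>0 K t) v = - (blinfun_apply (R_re z) (lm p v) + blinfun_apply (R_im z) (lm r v))
       + (lm (r * K) (blinfun_apply (R_re z) v) - lm (p * K) (blinfun_apply (R_im z) v))" if K: "K \<in> unitS" for K v
    proof -
      have "f (slice_emb K z) * (qexpJ K \<phi>0 * K) = - p + r * K"
        unfolding qexpJ_times_unitS[OF K] slice_rep_eq[OF rep dom[folded z_def] K] p_def r_def
        by (simp add: algebra_simps unitS_square[OF K])
      moreover have "r * K * K = - r" by (simp add: mult.assoc unitS_square[OF K])
      ultimately show ?thesis
        unfolding ray_R_def z_def[symmetric] R_op[OF K] mult.assoc
        by (simp add: simps lm_lm c[symmetric] mult.assoc[symmetric] left_diff_distrib)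
    qed
    fix v
    show "blinfun_apply (ray_R f \<phi>0 J t + ray_R f \<phi>0 (- J) t) v = blinfun_apply (- 2 *\<^sub>R (kernel_im \<alpha> \<beta> (polar t \<phi>0) /\<^sub>R t)) v"
      unfolding z_def[symmetric] Q2 blinfun.add_left X[OF J] X[OF unitS_minus[OF J]]
      by (simp add: scaleR_2)
  qed
qed

end

section \<open>Convergence of the path integrals and their dependence on the angle\<close>

lemma continuous_on_slice_ray:
  assumes "quat_side m" "slice_rep m (sector \<theta>) f \<alpha> \<beta>" "\<bar>\<phi>\<bar> < \<theta>" "K \<in> unitS"
  shows "continuous_on {0<..} (\<lambda>t. f (slice_emb K (polar t \<phi>)))"
proof -
  interpret quat_side m by fact
  have dom: "polar t \<phi> \<in> slice_dom (sector \<theta>)" if "t > 0" for t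
    by (rule polar_slice_dom[OF that assms(3)])
  have c: "continuous_on (slice_dom (sector \<theta>)) \<alpha>" "continuous_on (slice_dom (sector \<theta>)) \<beta>"
    using CR_pair_continuous_on[OF slice_rep_CR_pair[OF assms(2) order_refl]] by auto
  have "continuous_on {0<..} (\<lambda>t. \<alpha> (polar t \<phi>) + m K (\<beta> (polar t \<phi>)))"
    by (intro continuous_intros continuous_on continuous_on_compose2[OF c(1) continuous_on_polar_ray]
        continuous_on_compose2[OF c(2) continuous_on_polar_ray]) (auto intro: dom)
  then show ?thesis
    by (rule continuous_on_eq) (simp add: slice_rep_eq[OF assms(2) dom assms(4)])
qed

lemma decay_times_inverse_square:
  fixes t :: real
  assumes "t > 0"
  shows "C / t\<^sup>2 * (Cf * t powr (1 + a) / b) = (C * Cf) * (t powr (a - 1) / b)"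
proof -
  have "t powr (1 + a) = t powr ((a - 1) + 2)" by (simp add: add.commute)
  also have "\<dots> = t powr (a - 1) * t\<^sup>2"
    using assms by (simp only: powr_add) (simp add: powr_numeral)
  finally show ?thesis using assms by simp
qed

context sectorial_bounds
begin

text \<open>\<open>X\<close> stands for \<open>ray_L f \<phi>0\<close> or
  \<open>ray_R f \<phi>0\<close> and \<open>E\<close> for their common
  \<open>kernel_im \<alpha> \<beta> (polar t \<phi>0) /\<^sub>R t\<close>, so that both sides are
  settled by one estimate.\<close>

lemma abs_conv_op_kernel:
  fixes ker :: "real \<Rightarrow> 'v \<Rightarrow> 'v" and X :: "quat \<Rightarrow> real \<Rightarrow> 'v \<Rightarrow>\<^sub>L 'v"
  assumes f: "decay_Q \<theta> f" "\<phi>0 < \<theta>" and J: "J \<in> unitS"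
    and ker: "\<And>t. t > 0 \<Longrightarrow> ker t = blinfun_apply (X (- J) t)" "\<And>t. t > 0 \<Longrightarrow> ker (- t) = blinfun_apply (X J t)"
    and cont: "\<And>K. K \<in> unitS \<Longrightarrow> continuous_on {0<..} (X K)"
    and X: "\<And>K t. K \<in> unitS \<Longrightarrow> t > 0 \<Longrightarrow> norm (X K t) \<le> C / t\<^sup>2 * norm (f (slice_emb K (polar t \<phi>0)))"
    and E: "\<And>t. t > 0 \<Longrightarrow> X J t + X (- J) t = - 2 *\<^sub>R E t"
  shows "abs_conv_op ker"
    and "integral (- {0}) (\<lambda>t. Blinfun (ker t)) = - 2 *\<^sub>R integral {0<..} E"
    and "(\<lambda>n. integral {1 / real (Suc n)..real (Suc n)} E) \<longlonglongrightarrow> integral {0<..} E"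
proof -
  obtain a Cf where a: "a > 0" and Cf: "Cf \<ge> 0"
    "\<And>s. s \<in> sector \<theta> \<Longrightarrow> norm (f s) \<le> Cf * norm s powr (1 + a) / (1 + norm s powr (1 + 2 * a))"
    using f(1) unfolding decay_Q_def by blast
  have le: "norm (X K t) \<le> (C * Cf) * (t powr (a - 1) / (1 + t powr (1 + 2 * a)))" if K: "K \<in> unitS" and t: "t > 0" for K t
  proof -
    have "\<bar>\<phi>0\<bar> < \<theta>" using f(2) omega \<phi>0 by simp
    then have "norm (f (slice_emb K (polar t \<phi>0))) \<le> Cf * t powr (1 + a) / (1 + t powr (1 + 2 * a))"
      using Cf(2)[OF slice_emb_polar_sector[OF t _ K]] norm_slice_emb_polar[OF K] t by simp
    then have "C / t\<^sup>2 * norm (f (slice_emb K (polar t \<phi>0))) \<le> C / t\<^sup>2 * (Cf * t powr (1 + a) / (1 + t powr (1 + 2 * a)))"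
      using C by (intro mult_left_mono) auto
    then show ?thesis
      using X[OF K t] unfolding decay_times_inverse_square[OF t] by (rule order.trans[rotated])
  qed
  note J' = unitS_minus[OF J]
  have k: "Blinfun (ker t) = X (- J) t" "Blinfun (ker (- t)) = X J t" if "t > 0" for t
    by (simp_all add: ker[OF that] blinfun_apply_inverse)
  have E': "X (- J) t + X J t = - 2 *\<^sub>R E t" if "t > 0" for t
    using E[OF that] by (simp add: add.commute)
  note * = integral_punctured_line[where k = "\<lambda>t. Blinfun (ker t)", OF k cont[OF J'] cont[OF J] a le[OF J'] le[OF J] E']
  have "bounded_linear (ker t)" if "t \<noteq> 0" for t
    using ker[of t] ker[of "- t"] that blinfun.bounded_linear_right
    by (cases "t > 0") auto
  then show "abs_conv_op ker" using *(1,2) unfolding abs_conv_op_def by auto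
  show "integral (- {0}) (\<lambda>t. Blinfun (ker t)) = - 2 *\<^sub>R integral {0<..} E" using *(3) by auto
  show "(\<lambda>n. integral {1 / real (Suc n)..real (Suc n)} E) \<longlonglongrightarrow> integral {0<..} E" using *(4) by auto
qed

lemma continuous_on_kernel:
  assumes "continuous_on {0<..} (\<lambda>t. f (slice_emb K (polar t \<phi>0)))" "K \<in> unitS"
  shows "continuous_on {0<..} (ray_L f \<phi>0 K)" "continuous_on {0<..} (ray_R f \<phi>0 K)"
proof -
  have R: "continuous_on {0<..} (\<lambda>t. R_op (slice_emb K (polar t \<phi>0)))"
    by (rule continuous_on_compose2[OF continuous_on_R_op_TR_op(1)[OF \<phi>0(2) assms(2)] continuous_on_polar_ray])
       (auto intro: polar_mem)
  show "continuous_on {0<..} (ray_L f \<phi>0 K)" "continuous_on {0<..} (ray_R f \<phi>0 K)"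
    unfolding ray_L_def[abs_def] ray_R_def[abs_def]
    by (intro bounded_bilinear.continuous_on[OF bounded_bilinear_blinfun_compose] R
      bounded_linear.continuous_on[OF bounded_linear_lm_op] continuous_intros assms)+
qed

text \<open>The constant 2 / pi is (- 1 / pi) * (- 2). The right-hand side is free of
  \<open>J\<close>, which leaves only the dependence on the angle.\<close>

lemma kernel_L:
  assumes f: "slice_rep (*) (sector \<theta>) f \<alpha> \<beta>" "decay_Q \<theta> f" "\<phi>0 < \<theta>" and J: "J \<in> unitS"
  shows "abs_conv_op (kerL lm D Tc f J \<phi>0)"
    and "DfT lm D Tc f \<phi>0 J = (2 / pi) *\<^sub>R integral {0<..} (\<lambda>t. kernel_im \<alpha> \<beta> (polar t \<phi>0) /\<^sub>R t)"
    and "(\<lambda>n. integral {1 / real (Suc n)..real (Suc n)} (\<lambda>t. kernel_im \<alpha> \<beta> (polar t \<phi>0) /\<^sub>R t))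
      \<longlonglongrightarrow> integral {0<..} (\<lambda>t. kernel_im \<alpha> \<beta> (polar t \<phi>0) /\<^sub>R t)"
proof -
  have \<phi>: "\<bar>\<phi>0\<bar> < \<theta>" using f(3) omega \<phi>0 by simp
  note * = abs_conv_op_kernel[OF f(2,3) J kerL_eq[OF J] continuous_on_kernel(1)[OF continuous_on_slice_ray[OF quat_side_left f(1) \<phi>]]
    norm_kernel(1) sum_kernel(1)[OF J _ polar_slice_dom[OF _ \<phi>] f(1)]]
  show "abs_conv_op (kerL lm D Tc f J \<phi>0)" by (rule *(1))
  show "DfT lm D Tc f \<phi>0 J = (2 / pi) *\<^sub>R integral {0<..} (\<lambda>t. kernel_im \<alpha> \<beta> (polar t \<phi>0) /\<^sub>R t)"
    unfolding DfT_def by (subst *(2)) simp_all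
  show "(\<lambda>n. integral {1 / real (Suc n)..real (Suc n)} (\<lambda>t. kernel_im \<alpha> \<beta> (polar t \<phi>0) /\<^sub>R t))
      \<longlonglongrightarrow> integral {0<..} (\<lambda>t. kernel_im \<alpha> \<beta> (polar t \<phi>0) /\<^sub>R t)" by (rule *(3))
qed

lemma kernel_R:
  assumes f: "slice_rep (\<lambda>x y. y * x) (sector \<theta>) f \<alpha> \<beta>" "decay_Q \<theta> f" "\<phi>0 < \<theta>" and J: "J \<in> unitS"
  shows "abs_conv_op (kerR lm D Tc f J \<phi>0)"
    and "fDT lm D Tc f \<phi>0 J = (2 / pi) *\<^sub>R integral {0<..} (\<lambda>t. kernel_im \<alpha> \<beta> (polar t \<phi>0) /\<^sub>R t)"
    and "(\<lambda>n. integral {1 / real (Suc n)..real (Suc n)} (\<lambda>t. kernel_im \<alpha> \<beta> (polar t \<phi>0) /\<^sub>R t))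
      \<longlonglongrightarrow> integral {0<..} (\<lambda>t. kernel_im \<alpha> \<beta> (polar t \<phi>0) /\<^sub>R t)"
proof -
  have \<phi>: "\<bar>\<phi>0\<bar> < \<theta>" using f(3) omega \<phi>0 by simp
  note * = abs_conv_op_kernel[OF f(2,3) J kerR_eq[OF J] continuous_on_kernel(2)[OF continuous_on_slice_ray[OF quat_side_right f(1) \<phi>]]
    norm_kernel(2) sum_kernel(2)[OF J _ polar_slice_dom[OF _ \<phi>] f(1)]]
  show "abs_conv_op (kerR lm D Tc f J \<phi>0)" by (rule *(1))
  show "fDT lm D Tc f \<phi>0 J = (2 / pi) *\<^sub>R integral {0<..} (\<lambda>t. kernel_im \<alpha> \<beta> (polar t \<phi>0) /\<^sub>R t)"
    unfolding fDT_def by (subst *(2)) simp_all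
  show "(\<lambda>n. integral {1 / real (Suc n)..real (Suc n)} (\<lambda>t. kernel_im \<alpha> \<beta> (polar t \<phi>0) /\<^sub>R t))
      \<longlonglongrightarrow> integral {0<..} (\<lambda>t. kernel_im \<alpha> \<beta> (polar t \<phi>0) /\<^sub>R t)" by (rule *(3))
qed

text \<open>\<open>kernel_re\<close> and \<open>kernel_im\<close> form a Cauchy-Riemann pair, being
  the parts of a product of three. The factor z = t e^(i \<phi>) is included so that the integrand
  is \<open>kernel_im\<close> divided by t, the form in which the angular derivative becomes an
  exact t-derivative.\<close>

lemma kernel_im_integral_independent:
  assumes m: "quat_side m" and f: "slice_rep m (sector \<theta>) f \<alpha> \<beta>" "decay_Q \<theta> f"
    and \<phi>2: "\<phi>0 \<le> \<phi>2" "\<phi>2 < \<theta>" and \<theta>: "\<theta> < pi"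
    and lim: "\<And>\<phi>. \<phi> \<in> {\<phi>0..\<phi>2} \<Longrightarrow>
      (\<lambda>n. integral {1 / real (Suc n)..real (Suc n)} (\<lambda>t. kernel_im \<alpha> \<beta> (polar t \<phi>) /\<^sub>R t))
      \<longlonglongrightarrow> integral {0<..} (\<lambda>t. kernel_im \<alpha> \<beta> (polar t \<phi>) /\<^sub>R t)"
  shows "integral {0<..} (\<lambda>t. kernel_im \<alpha> \<beta> (polar t \<phi>0) /\<^sub>R t) = integral {0<..} (\<lambda>t. kernel_im \<alpha> \<beta> (polar t \<phi>2) /\<^sub>R t)"
proof -
  interpret quat_side m by fact
  let ?S = "polar_sector \<phi>0 \<phi>2"
  have \<phi>2_pi: "\<phi>2 < pi" using \<phi>2 \<theta> by simp
  have ang: "\<bar>\<phi>\<bar> < \<theta>" if "\<phi> \<in> {\<phi>0..\<phi>2}" for \<phi> using that \<phi>2 omega \<phi>0 by auto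
  have S: "?S \<subseteq> slice_dom (sector \<theta>)"
    using ang by (auto simp: polar_sector_def intro!: polar_slice_dom)
  have bil: "bounded_bilinear (\<lambda>(X :: 'v \<Rightarrow>\<^sub>L 'v) q. X o\<^sub>L lm_op q)"
    by (rule bounded_bilinear.comp[OF bounded_bilinear_blinfun_compose bounded_linear_ident bounded_linear_lm_op])
  have PQk: "kernel_re \<alpha> \<beta> = (\<lambda>z. (R_re z o\<^sub>L lm_op (fst z *\<^sub>R \<alpha> z - snd z *\<^sub>R \<beta> z)) - (R_im z o\<^sub>L lm_op (fst z *\<^sub>R \<beta> z + snd z *\<^sub>R \<alpha> z)))"
    "kernel_im \<alpha> \<beta> = (\<lambda>z. (R_re z o\<^sub>L lm_op (fst z *\<^sub>R \<beta> z + snd z *\<^sub>R \<alpha> z)) + (R_im z o\<^sub>L lm_op (fst z *\<^sub>R \<alpha> z - snd z *\<^sub>R \<beta> z)))"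
    by (simp_all add: fun_eq_iff kernel_re_def kernel_im_def)
  obtain P' Q' where PQ: "CR_pair ?S (kernel_re \<alpha> \<beta>) (kernel_im \<alpha> \<beta>) P' Q'"
    using CR_pair_mult[OF bil CR_pair_resolvent[OF \<phi>2_pi]
        CR_pair_mult[OF bounded_bilinear_scaleR CR_pair_id slice_rep_CR_pair[OF f(1) S]]]
    unfolding PQk[symmetric] by blast
  obtain a Cf where a: "a > 0" and Cf: "Cf \<ge> 0"
    "\<And>s. s \<in> sector \<theta> \<Longrightarrow> norm (f s) \<le> Cf * norm s powr (1 + a) / (1 + norm s powr (1 + 2 * a))"
    using f(2) unfolding decay_Q_def by blast
  \<comment> \<open>Two compositions, each bounded by C / t^2 times 2 t M, where M is the decay
    bound of f; collecting the powers of t gives t^a in the numerator.\<close>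
  define mm where "mm t = 4 * C * Cf * (t powr a / (1 + t powr (1 + 2 * a)))" for t
  show ?thesis
  proof (rule integral_independent_of_angle[where q = "\<lambda>t \<phi>. kernel_im \<alpha> \<beta> (polar t \<phi>)" and p = "\<lambda>t \<phi>. kernel_re \<alpha> \<beta> (polar t \<phi>)"
      and pt = "\<lambda>t \<phi>. cos \<phi> *\<^sub>R P' (polar t \<phi>) - sin \<phi> *\<^sub>R Q' (polar t \<phi>)" and m = mm, OF \<phi>2(1)])
    fix t \<phi> :: real assume t: "t > 0" and \<phi>: "\<phi> \<in> {\<phi>0..\<phi>2}"
    show "((\<lambda>\<phi>. kernel_im \<alpha> \<beta> (polar t \<phi>)) has_vector_derivative t *\<^sub>R (cos \<phi> *\<^sub>R P' (polar t \<phi>) - sin \<phi> *\<^sub>R Q' (polar t \<phi>)))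
      (at \<phi> within {\<phi>0..\<phi>2})"
      "((\<lambda>t. kernel_re \<alpha> \<beta> (polar t \<phi>)) has_vector_derivative cos \<phi> *\<^sub>R P' (polar t \<phi>) - sin \<phi> *\<^sub>R Q' (polar t \<phi>)) (at t)"
      using CR_pair_polar[OF PQ t \<phi>] by auto
    let ?z = "polar t \<phi>"
    have z: "?z \<in> ?S" by (rule polar_in_polar_sector[OF t \<phi>])
    define M where "M = Cf * t powr (1 + a) / (1 + t powr (1 + 2 * a))"
    have M0: "M \<ge> 0" using Cf(1) by (auto simp: M_def intro!: divide_nonneg_nonneg add_nonneg_nonneg)
    have fM: "norm (f (slice_emb K ?z)) \<le> M" if "K \<in> unitS" for K
      using Cf(2)[OF slice_emb_polar_sector[OF t ang[OF \<phi>] that]] norm_slice_emb_polar[OF that] t by (simp add: M_def)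
    have ab: "norm (\<alpha> ?z) \<le> M" "norm (\<beta> ?z) \<le> M"
      using slice_rep_norm_le[OF f(1) _ qe_unitS fM[OF qe_unitS] fM[OF unitS_minus[OF qe_unitS]]] z S by auto
    have AB: "norm (fst ?z *\<^sub>R \<alpha> ?z - snd ?z *\<^sub>R \<beta> ?z) \<le> t * (2 * M)"
      "norm (fst ?z *\<^sub>R \<beta> ?z + snd ?z *\<^sub>R \<alpha> ?z) \<le> t * (2 * M)"
    proof -
      have cs: "norm (cos \<phi> *\<^sub>R x) \<le> M" "norm (sin \<phi> *\<^sub>R x) \<le> M" if "norm x \<le> M" for x :: quat
        using that mult_mono[of "\<bar>cos \<phi>\<bar>" 1 "norm x" M] mult_mono[of "\<bar>sin \<phi>\<bar>" 1 "norm x" M] by auto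
      have 1: "fst ?z *\<^sub>R \<alpha> ?z - snd ?z *\<^sub>R \<beta> ?z = t *\<^sub>R (cos \<phi> *\<^sub>R \<alpha> ?z - sin \<phi> *\<^sub>R \<beta> ?z)"
        and 2: "fst ?z *\<^sub>R \<beta> ?z + snd ?z *\<^sub>R \<alpha> ?z = t *\<^sub>R (cos \<phi> *\<^sub>R \<beta> ?z + sin \<phi> *\<^sub>R \<alpha> ?z)"
        by (simp_all add: polar_def algebra_simps)
      have 3: "norm (cos \<phi> *\<^sub>R \<alpha> ?z - sin \<phi> *\<^sub>R \<beta> ?z) \<le> 2 * M" "norm (cos \<phi> *\<^sub>R \<beta> ?z + sin \<phi> *\<^sub>R \<alpha> ?z) \<le> 2 * M"
        using norm_triangle_ineq4[of "cos \<phi> *\<^sub>R \<alpha> ?z" "sin \<phi> *\<^sub>R \<beta> ?z"]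
          norm_triangle_ineq[of "cos \<phi> *\<^sub>R \<beta> ?z" "sin \<phi> *\<^sub>R \<alpha> ?z"] cs[OF ab(1)] cs[OF ab(2)] by linarith+
      show "norm (fst ?z *\<^sub>R \<alpha> ?z - snd ?z *\<^sub>R \<beta> ?z) \<le> t * (2 * M)"
        "norm (fst ?z *\<^sub>R \<beta> ?z + snd ?z *\<^sub>R \<alpha> ?z) \<le> t * (2 * M)"
        unfolding 1 2 norm_scaleR using 3 t by (auto simp: abs_of_pos)
    qed
    have R: "norm (R_op (slice_emb K ?z)) \<le> C / t\<^sup>2" if "K \<in> unitS" for K
      using norm_R_op[OF outside_sector_slice_emb[OF z \<phi>2_pi that]] t by (simp add: norm_slice_emb_polar[OF that])
    have R1: "norm (R_op (slice_emb (qe 1) ?z)) \<le> C / t\<^sup>2" and R2: "norm (R_op (slice_emb (- qe 1) ?z)) \<le> C / t\<^sup>2"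
      by (rule R[OF qe_unitS], rule R[OF unitS_minus[OF qe_unitS]])
    have half: "\<bar>1 / 2\<bar> * n \<le> x" "\<bar>- (1 / 2)\<bar> * n \<le> x" if "n \<le> x + x" for n x :: real
      using that by simp_all
    have G: "norm (R_re ?z) \<le> C / t\<^sup>2"
      unfolding R_re_def norm_scaleR by (rule half(1)[OF norm_triangle_mono[OF R1 R2]])
    have H: "norm (R_im ?z) \<le> C / t\<^sup>2"
      unfolding R_im_def norm_scaleR
    proof (rule half(2))
      have "norm (lm_op (qe 1) o\<^sub>L (R_op (slice_emb (qe 1) ?z) - R_op (slice_emb (- qe 1) ?z)))
        \<le> norm (lm_op (qe 1)) * norm (R_op (slice_emb (qe 1) ?z) - R_op (slice_emb (- qe 1) ?z))"
        by (rule norm_blinfun_compose)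
      also have "\<dots> \<le> 1 * (C / t\<^sup>2 + C / t\<^sup>2)"
        using norm_lm_op[of "qe 1"] norm_unitS[OF qe_unitS]
        by (intro mult_mono order.trans[OF norm_triangle_ineq4 add_mono[OF R1 R2]]) simp_all
      finally show "norm (lm_op (qe 1) o\<^sub>L (R_op (slice_emb (qe 1) ?z) - R_op (slice_emb (- qe 1) ?z))) \<le> C / t\<^sup>2 + C / t\<^sup>2"
        by simp
    qed
    have prod: "norm (X o\<^sub>L lm_op q) \<le> C / t\<^sup>2 * (t * (2 * M))" if "norm X \<le> C / t\<^sup>2" "norm q \<le> t * (2 * M)" for X :: "'v \<Rightarrow>\<^sub>L 'v" and q
      by (rule order.trans[OF norm_blinfun_compose], rule mult_mono)
         (use that C order.trans[OF norm_lm_op] in auto)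
    have "norm (kernel_re \<alpha> \<beta> ?z) \<le> C / t\<^sup>2 * (t * (2 * M)) + C / t\<^sup>2 * (t * (2 * M))"
      unfolding kernel_re_def
      by (rule order.trans[OF norm_triangle_ineq4 add_mono[OF prod[OF G AB(1)] prod[OF H AB(2)]]])
    also have "\<dots> = 4 * t * (C / t\<^sup>2 * M)" by simp
    also have "\<dots> = 4 * t * ((C * Cf) * (t powr (a - 1) / (1 + t powr (1 + 2 * a))))"
      unfolding M_def decay_times_inverse_square[OF t] ..
    also have "\<dots> = 4 * C * Cf * ((t * t powr (a - 1)) / (1 + t powr (1 + 2 * a)))" by simp
    also have "t * t powr (a - 1) = t powr a" using t by (simp add: powr_mult_base)
    finally show "norm (kernel_re \<alpha> \<beta> (polar t \<phi>)) \<le> mm t" by (simp add: mm_def)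
  next
    have c: "continuous_on ?S P'" "continuous_on ?S Q'" using PQ by (auto simp: CR_pair_def)
    have "continuous_on ({0<..} \<times> {\<phi>0..\<phi>2}) (\<lambda>z. cos (snd z) *\<^sub>R P' (polar (fst z) (snd z)) - sin (snd z) *\<^sub>R Q' (polar (fst z) (snd z)))"
      by (intro continuous_intros continuous_on_compose2[OF c(1) continuous_on_polar]
          continuous_on_compose2[OF c(2) continuous_on_polar]) (auto intro!: polar_in_polar_sector)
    then show "continuous_on ({0<..} \<times> {\<phi>0..\<phi>2}) (\<lambda>(t, \<phi>). cos \<phi> *\<^sub>R P' (polar t \<phi>) - sin \<phi> *\<^sub>R Q' (polar t \<phi>))"
      by (simp add: case_prod_beta)
    show "continuous_on {0<..} (\<lambda>t. kernel_im \<alpha> \<beta> (polar t \<phi>))" if "\<phi> \<in> {\<phi>0..\<phi>2}" for \<phi>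
      by (rule continuous_on_compose2[OF CR_pair_continuous_on(2)[OF PQ] continuous_on_polar_ray])
         (use that in \<open>auto intro!: polar_in_polar_sector\<close>)
    have "((\<lambda>t. t powr a / (1 + t powr (1 + 2 * a))) \<longlongrightarrow> 0) (at_right 0)" using a by real_asymp
    then show "(mm \<longlongrightarrow> 0) (at_right 0)" unfolding mm_def[abs_def] by (rule tendsto_mult_right_zero)
    have "((\<lambda>t. t powr a / (1 + t powr (1 + 2 * a))) \<longlongrightarrow> 0) at_top" using a by real_asymp
    then show "(mm \<longlongrightarrow> 0) at_top" unfolding mm_def[abs_def] by (rule tendsto_mult_right_zero)
  qed (rule lim)
qed

end

section \<open>From slice representations to the theorem\<close>

lemma PsiL_E:
  assumes "f \<in> PsiL \<theta>"
  obtains \<alpha> \<beta> where "slice_rep (*) (sector \<theta>) f \<alpha> \<beta>" "decay_Q \<theta> f"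
    "open (sector \<theta>)" "axially_symmetric (sector \<theta>)"
  using assms unfolding PsiL_def slice_hol_L_iff by blast

lemma PsiR_E:
  assumes "f \<in> PsiR \<theta>"
  obtains \<alpha> \<beta> where "slice_rep (\<lambda>x y. y * x) (sector \<theta>) f \<alpha> \<beta>" "decay_Q \<theta> f"
    "open (sector \<theta>)" "axially_symmetric (sector \<theta>)"
  using assms unfolding PsiR_def slice_hol_R_iff by blast

lemma PsiL_agree:
  assumes "f \<in> PsiL \<theta>" "g \<in> PsiL \<theta>" "\<And>q. q \<in> sector \<theta> \<Longrightarrow> CF_L f q = CF_L g q"
    and "0 < \<phi>" "\<phi> < \<theta>" "\<theta> \<le> pi" "t > 0" "J \<in> unitS"
  shows "f (slice_emb J (polar t \<phi>)) = g (slice_emb J (polar t \<phi>))"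
  by (rule PsiL_E[OF assms(1)], rule PsiL_E[OF assms(2)], rule quat_side.slice_functions_agree[OF quat_side_left])
    (use assms(3-) in \<open>auto simp: CF_L_def qpartial_def\<close>)

lemma PsiR_agree:
  assumes "f \<in> PsiR \<theta>" "g \<in> PsiR \<theta>" "\<And>q. q \<in> sector \<theta> \<Longrightarrow> CF_R f q = CF_R g q"
    and "0 < \<phi>" "\<phi> < \<theta>" "\<theta> \<le> pi" "t > 0" "J \<in> unitS"
  shows "f (slice_emb J (polar t \<phi>)) = g (slice_emb J (polar t \<phi>))"
  by (rule PsiR_E[OF assms(1)], rule PsiR_E[OF assms(2)], rule quat_side.slice_functions_agree[OF quat_side_right])
    (use assms(3-) in \<open>auto simp: CF_R_def qpartial_def\<close>)

lemma spath_eqI: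
  assumes "\<And>t J. t > 0 \<Longrightarrow> J \<in> unitS \<Longrightarrow> f (slice_emb J (polar t \<phi>)) = g (slice_emb J (polar t \<phi>))"
    and "J \<in> unitS" "t \<noteq> 0"
  shows "f (spath J \<phi> t) = g (spath J \<phi> t)"
  using assms(1)[of t "- J"] assms(1)[of "- t" J] assms(2,3) spath_polar(1)[of t J \<phi>] spath_polar(2)[of "- t" J \<phi>]
  by (cases "t > 0") (auto simp: unitS_minus)

theorem theorem3p4:
  fixes lm :: "quat \<Rightarrow> 'v::banach \<Rightarrow> 'v" and rm :: "'v \<Rightarrow> quat \<Rightarrow> 'v"
    and D :: "'v set" and Tc :: "nat \<Rightarrow> 'v \<Rightarrow> 'v" and \<omega> \<theta> :: real
  assumes V: "two_sided_banach lm rm"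
    and T_KC: "KC lm rm D Tc"
    and T_type: "op_type lm D Tc \<omega>"
    and Tbar_type: "op_type lm D (conjT Tc) \<omega>"
    and \<omega>: "0 < \<omega>" "\<omega> < pi"
    and \<theta>: "\<omega> < \<theta>" "\<theta> < pi"
  shows
    "(\<forall>f\<in>PsiL \<theta>. \<forall>\<phi>\<in>{\<omega><..<\<theta>}. \<forall>J\<in>unitS. abs_conv_op (kerL lm D Tc f J \<phi>)) \<and>
     (\<forall>f\<in>PsiL \<theta>. \<forall>\<phi>1\<in>{\<omega><..<\<theta>}. \<forall>\<phi>2\<in>{\<omega><..<\<theta>}. \<forall>J1\<in>unitS. \<forall>J2\<in>unitS.
        DfT lm D Tc f \<phi>1 J1 = DfT lm D Tc f \<phi>2 J2) \<and>
     (\<forall>f\<in>PsiL \<theta>. \<forall>g\<in>PsiL \<theta>. (\<forall>q\<in>sector \<theta>. CF_L f q = CF_L g q) \<longrightarrow>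
        (\<forall>\<phi>\<in>{\<omega><..<\<theta>}. \<forall>J\<in>unitS. DfT lm D Tc f \<phi> J = DfT lm D Tc g \<phi> J)) \<and>
     (\<forall>f\<in>PsiR \<theta>. \<forall>\<phi>\<in>{\<omega><..<\<theta>}. \<forall>J\<in>unitS. abs_conv_op (kerR lm D Tc f J \<phi>)) \<and>
     (\<forall>f\<in>PsiR \<theta>. \<forall>\<phi>1\<in>{\<omega><..<\<theta>}. \<forall>\<phi>2\<in>{\<omega><..<\<theta>}. \<forall>J1\<in>unitS. \<forall>J2\<in>unitS.
        fDT lm D Tc f \<phi>1 J1 = fDT lm D Tc f \<phi>2 J2) \<and>
     (\<forall>f\<in>PsiR \<theta>. \<forall>g\<in>PsiR \<theta>. (\<forall>q\<in>sector \<theta>. CF_R f q = CF_R g q) \<longrightarrow>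
        (\<forall>\<phi>\<in>{\<omega><..<\<theta>}. \<forall>J\<in>unitS. fDT lm D Tc f \<phi> J = fDT lm D Tc g \<phi> J))"
proof -
  interpret sectorial lm rm D Tc \<omega>
    by unfold_locales (rule V T_KC T_type Tbar_type)+
  have bounds: "\<exists>C. sectorial_bounds lm rm D Tc \<omega> \<phi> C" if "\<phi> \<in> {\<omega><..<\<theta>}" for \<phi>
  proof -
    have \<phi>: "\<omega> < \<phi>" "\<phi> < pi" using that \<theta> by auto
    from resolvent_bounds[OF \<phi>] obtain C where "C \<ge> 0"
      "\<And>s v. s \<noteq> 0 \<Longrightarrow> re0 s \<le> norm s * cos \<phi> \<Longrightarrow> norm (R s v) \<le> C / (norm s)\<^sup>2 * norm v"
      "\<And>s v. s \<noteq> 0 \<Longrightarrow> re0 s \<le> norm s * cos \<phi> \<Longrightarrow> norm (lm s (R s v) - Tc 0 (R s v)) \<le> C / norm s * norm v"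
      by metis
    with \<phi> show ?thesis by (intro exI[of _ C]) (unfold_locales, auto)
  qed
  \<comment> \<open>Up to the factor 2 / pi this is the value of the left and of the right integral;
    neither the imaginary unit nor the resolvent constant occurs in it.\<close>
  define I where "I \<alpha> \<beta> \<phi> = integral {0<..} (\<lambda>t. kernel_im \<alpha> \<beta> (polar t \<phi>) /\<^sub>R t)" for \<alpha> \<beta> \<phi>
  have L: "abs_conv_op (kerL lm D Tc f J \<phi>)" "DfT lm D Tc f \<phi> J = (2 / pi) *\<^sub>R I \<alpha> \<beta> \<phi>"
      "(\<lambda>n. integral {1 / real (Suc n)..real (Suc n)} (\<lambda>t. kernel_im \<alpha> \<beta> (polar t \<phi>) /\<^sub>R t)) \<longlonglongrightarrow> I \<alpha> \<beta> \<phi>"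
    if "slice_rep (*) (sector \<theta>) f \<alpha> \<beta>" "decay_Q \<theta> f" "\<phi> \<in> {\<omega><..<\<theta>}" "J \<in> unitS" for f \<alpha> \<beta> \<phi> J
  proof -
    from bounds[OF that(3)] obtain C where "sectorial_bounds lm rm D Tc \<omega> \<phi> C" ..
    then interpret S: sectorial_bounds lm rm D Tc \<omega> \<phi> C .
    show "abs_conv_op (kerL lm D Tc f J \<phi>)" "DfT lm D Tc f \<phi> J = (2 / pi) *\<^sub>R I \<alpha> \<beta> \<phi>"
      "(\<lambda>n. integral {1 / real (Suc n)..real (Suc n)} (\<lambda>t. kernel_im \<alpha> \<beta> (polar t \<phi>) /\<^sub>R t)) \<longlonglongrightarrow> I \<alpha> \<beta> \<phi>"
      using S.kernel_L[OF that(1,2) _ that(4)] that(3) unfolding I_def by auto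
  qed
  have R: "abs_conv_op (kerR lm D Tc f J \<phi>)" "fDT lm D Tc f \<phi> J = (2 / pi) *\<^sub>R I \<alpha> \<beta> \<phi>"
      "(\<lambda>n. integral {1 / real (Suc n)..real (Suc n)} (\<lambda>t. kernel_im \<alpha> \<beta> (polar t \<phi>) /\<^sub>R t)) \<longlonglongrightarrow> I \<alpha> \<beta> \<phi>"
    if "slice_rep (\<lambda>x y. y * x) (sector \<theta>) f \<alpha> \<beta>" "decay_Q \<theta> f" "\<phi> \<in> {\<omega><..<\<theta>}" "J \<in> unitS" for f \<alpha> \<beta> \<phi> J
  proof -
    from bounds[OF that(3)] obtain C where "sectorial_bounds lm rm D Tc \<omega> \<phi> C" ..
    then interpret S: sectorial_bounds lm rm D Tc \<omega> \<phi> C .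
    show "abs_conv_op (kerR lm D Tc f J \<phi>)" "fDT lm D Tc f \<phi> J = (2 / pi) *\<^sub>R I \<alpha> \<beta> \<phi>"
      "(\<lambda>n. integral {1 / real (Suc n)..real (Suc n)} (\<lambda>t. kernel_im \<alpha> \<beta> (polar t \<phi>) /\<^sub>R t)) \<longlonglongrightarrow> I \<alpha> \<beta> \<phi>"
      using S.kernel_R[OF that(1,2) _ that(4)] that(3) unfolding I_def by auto
  qed
  have indep: "I \<alpha> \<beta> \<phi>1 = I \<alpha> \<beta> \<phi>2"
    if m: "quat_side m" and f: "slice_rep m (sector \<theta>) f \<alpha> \<beta>" "decay_Q \<theta> f"
      and \<phi>: "\<phi>1 \<in> {\<omega><..<\<theta>}" "\<phi>2 \<in> {\<omega><..<\<theta>}"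
      and lim: "\<And>\<phi>. \<phi> \<in> {\<omega><..<\<theta>} \<Longrightarrow>
        (\<lambda>n. integral {1 / real (Suc n)..real (Suc n)} (\<lambda>t. kernel_im \<alpha> \<beta> (polar t \<phi>) /\<^sub>R t)) \<longlonglongrightarrow> I \<alpha> \<beta> \<phi>"
    for m f \<alpha> \<beta> \<phi>1 \<phi>2
  proof -
    \<comment> \<open>The locale is instantiated at the smaller angle, because its estimates extend
      to all larger ones.\<close>
    have *: "I \<alpha> \<beta> \<phi>1 = I \<alpha> \<beta> \<phi>2" if \<phi>: "\<phi>1 \<in> {\<omega><..<\<theta>}" "\<phi>2 \<in> {\<omega><..<\<theta>}" "\<phi>1 \<le> \<phi>2" for \<phi>1 \<phi>2
    proof -
      from bounds[OF \<phi>(1)] obtain C where "sectorial_bounds lm rm D Tc \<omega> \<phi>1 C" ..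
      then interpret S: sectorial_bounds lm rm D Tc \<omega> \<phi>1 C .
      show ?thesis
        unfolding I_def
        by (rule S.kernel_im_integral_independent[OF m f \<phi>(3) _ \<theta>(2) lim[unfolded I_def]]) (use \<phi> in auto)
    qed
    show ?thesis using linear[of \<phi>1 \<phi>2] *[OF \<phi>] *[OF \<phi>(2,1), THEN sym] by (rule disjE)
  qed
  show ?thesis
  proof (intro conjI ballI impI)
    fix f \<phi> J assume f: "f \<in> PsiL \<theta>" and \<phi>: "\<phi> \<in> {\<omega><..<\<theta>}" and J: "J \<in> unitS"
    show "abs_conv_op (kerL lm D Tc f J \<phi>)" by (rule PsiL_E[OF f]) (rule L(1)[OF _ _ \<phi> J])
  next
    fix f \<phi>1 \<phi>2 J1 J2 assume f: "f \<in> PsiL \<theta>" and \<phi>: "\<phi>1 \<in> {\<omega><..<\<theta>}" "\<phi>2 \<in> {\<omega><..<\<theta>}" and J: "J1 \<in> unitS" "J2 \<in> unitS"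
    from f obtain \<alpha> \<beta> where r: "slice_rep (*) (sector \<theta>) f \<alpha> \<beta>" "decay_Q \<theta> f" by (rule PsiL_E)
    show "DfT lm D Tc f \<phi>1 J1 = DfT lm D Tc f \<phi>2 J2"
      unfolding L(2)[OF r \<phi>(1) J(1)] L(2)[OF r \<phi>(2) J(2)]
      using indep[OF quat_side_left r \<phi> L(3)[OF r _ J(1)]] by simp
  next
    fix f g \<phi> J assume f: "f \<in> PsiL \<theta>" "g \<in> PsiL \<theta>" and CF: "\<forall>q\<in>sector \<theta>. CF_L f q = CF_L g q"
      and \<phi>: "\<phi> \<in> {\<omega><..<\<theta>}" and J: "J \<in> unitS"
    \<comment> \<open>As 0 < \<phi> < pi, every point of the path with t \<noteq> 0 is off the real
      axis, where f and g agree; the two integrands then coincide, whatever the slice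
      representations are.\<close>
    have "f (spath J \<phi> t) = g (spath J \<phi> t)" if "t \<noteq> 0" for t
      by (rule spath_eqI[OF _ J that], rule PsiL_agree[OF f]) (use CF \<phi> \<omega> \<theta> in auto)
    then show "DfT lm D Tc f \<phi> J = DfT lm D Tc g \<phi> J"
      unfolding DfT_def kerL_def by (intro arg_cong2[where f = scaleR] refl Henstock_Kurzweil_Integration.integral_cong) auto
  next
    fix f \<phi> J assume f: "f \<in> PsiR \<theta>" and \<phi>: "\<phi> \<in> {\<omega><..<\<theta>}" and J: "J \<in> unitS"
    show "abs_conv_op (kerR lm D Tc f J \<phi>)" by (rule PsiR_E[OF f]) (rule R(1)[OF _ _ \<phi> J])
  next
    fix f \<phi>1 \<phi>2 J1 J2 assume f: "f \<in> PsiR \<theta>" and \<phi>: "\<phi>1 \<in> {\<omega><..<\<theta>}" "\<phi>2 \<in> {\<omega><..<\<theta>}" and J: "J1 \<in> unitS" "J2 \<in> unitS"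
    from f obtain \<alpha> \<beta> where r: "slice_rep (\<lambda>x y. y * x) (sector \<theta>) f \<alpha> \<beta>" "decay_Q \<theta> f" by (rule PsiR_E)
    show "fDT lm D Tc f \<phi>1 J1 = fDT lm D Tc f \<phi>2 J2"
      unfolding R(2)[OF r \<phi>(1) J(1)] R(2)[OF r \<phi>(2) J(2)]
      using indep[OF quat_side_right r \<phi> R(3)[OF r _ J(1)]] by simp
  next
    fix f g \<phi> J assume f: "f \<in> PsiR \<theta>" "g \<in> PsiR \<theta>" and CF: "\<forall>q\<in>sector \<theta>. CF_R f q = CF_R g q"
      and \<phi>: "\<phi> \<in> {\<omega><..<\<theta>}" and J: "J \<in> unitS"
    have "f (spath J \<phi> t) = g (spath J \<phi> t)" if "t \<noteq> 0" for t
      by (rule spath_eqI[OF _ J that], rule PsiR_agree[OF f]) (use CF \<phi> \<omega> \<theta> in auto)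
    then show "fDT lm D Tc f \<phi> J = fDT lm D Tc g \<phi> J"
      unfolding fDT_def kerR_def by (intro arg_cong2[where f = scaleR] refl Henstock_Kurzweil_Integration.integral_cong) auto
  qed
qed

end
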